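(* Let $T>0$, $p\in(2,5]$, $\rho>\min\left(\frac32-\frac2p,\,1\right)$, $\gamma>1/2$, and let $w\in C([0,T];\mathbb{R})$ be $(\rho,\gamma)$-irregular on $[0,T]$. Then there exist a finite constant $C_{w,T}>0$ and an exponent $\gamma^\star(p)>0$ such that $$\left\|\int_0^{\cdot}U^w_{\cdot}(U^w_s)^{-1}\psi_s\,ds\right\|_{L^p([0,T],L^{2p}(\mathbb{R}))}\le C_{w,T}\,T^{\gamma^\star(p)}\,\|\psi\|_{L^1([0,T],L^2(\mathbb{R}))}$$ for all $\psi\in L^1([0,T],L^2(\mathbb{R}))$.
   Context: $U^w_t=e^{w_t\,i\partial_x^2}$ is the Fourier multiplier by $e^{-iw_t\xi^2}$ on $L^2(\mathbb{R})$; the function inside the norm is $t\mapsto\int_0^tU^w_t(U^w_s)^{-1}\psi_s\,ds$. Irregularity: $\Phi^w_t(a)=\int_0^t e^{iaw_r}\,dr$ and $$\|\Phi^w\|_{\mathcal{W}^{\rho,\gamma}_T}=\sup_{a\in\mathbb{R}}\ \sup_{0\le s<t\le T}(1+|a|)^\rho\,\frac{|\Phi^w_t(a)-\Phi^w_s(a)|}{|t-s|^\gamma}.$$ $w$ is $(\rho,\gamma)$-irregular on $[0,T]$ if this quantity is finite. *)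

theory Defs
  imports "HOL-Analysis.Analysis"
begin

section \<open>The space of square integrable functions on the line\<close>

text \<open>
  \<open>in_Lq\<close> and \<open>Lq_norm\<close> concern functions; \<open>l2\<close> below is the Hilbert space of almost-everywhere
  classes.  The norm of a function outside \<open>L\<^sup>q\<close> is meaningless (a non-integrable function has
  integral \<open>0\<close>), so \<open>Lq_norm\<close> is only to be used together with \<open>in_Lq\<close>.
\<close>

definition in_Lq :: "real \<Rightarrow> (real \<Rightarrow> complex) \<Rightarrow> bool" where
  "in_Lq q f \<longleftrightarrow> f \<in> borel_measurable lborel \<and> integrable lborel (\<lambda>x. cmod (f x) powr q)"

definition Lq_norm :: "real \<Rightarrow> (real \<Rightarrow> complex) \<Rightarrow> real" where
  "Lq_norm q f = (LINT x|lborel. cmod (f x) powr q) powr (1 / q)"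

lemma in_L2_iff:
  "in_Lq 2 f \<longleftrightarrow> f \<in> borel_measurable lborel \<and> integrable lborel (\<lambda>x. (cmod (f x))\<^sup>2)"
  by (simp add: in_Lq_def)

lemma Lq_norm_2: "Lq_norm 2 f = sqrt (LINT x|lborel. (cmod (f x))\<^sup>2)"
  by (simp add: Lq_norm_def powr_half_sqrt)

lemma in_L2_measurable [measurable_dest]: "in_Lq 2 f \<Longrightarrow> f \<in> borel_measurable borel"
  by (simp add: in_Lq_def)

lemma in_L2_dominated:
  assumes "in_Lq 2 f" "in_Lq 2 g" "h \<in> borel_measurable borel"
    and le: "\<And>x. (cmod (h x))\<^sup>2 \<le> C * ((cmod (f x))\<^sup>2 + (cmod (g x))\<^sup>2)"
  shows "in_Lq 2 h"
proof -
  have "integrable lborel (\<lambda>x. C * ((cmod (f x))\<^sup>2 + (cmod (g x))\<^sup>2))"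
    using assms by (auto simp: in_L2_iff)
  then have "integrable lborel (\<lambda>x. (cmod (h x))\<^sup>2)"
    by (rule Bochner_Integration.integrable_bound)
      (use assms in \<open>auto intro!: AE_I2 order_trans[OF le]\<close>)
  then show ?thesis using assms by (simp add: in_L2_iff)
qed

lemma in_L2_0: "in_Lq 2 (\<lambda>x. 0)"
  by (simp add: in_L2_iff)

lemma cmod_add_sq: "(cmod (a + b))\<^sup>2 \<le> 2 * ((cmod a)\<^sup>2 + (cmod b)\<^sup>2)"
proof -
  have "(cmod (a + b))\<^sup>2 \<le> (cmod a + cmod b)\<^sup>2"
    by (intro power_mono norm_triangle_ineq) auto
  also have "\<dots> \<le> 2 * ((cmod a)\<^sup>2 + (cmod b)\<^sup>2)"
    using sum_squares_bound[of "cmod a" "cmod b"] by (simp add: power2_sum)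
  finally show ?thesis .
qed

lemma in_L2_add: "in_Lq 2 f \<Longrightarrow> in_Lq 2 g \<Longrightarrow> in_Lq 2 (\<lambda>x. f x + g x)"
  by (rule in_L2_dominated[of f g _ 2]) (use cmod_add_sq in \<open>auto simp: in_L2_measurable\<close>)

lemma in_L2_uminus: "in_Lq 2 f \<Longrightarrow> in_Lq 2 (\<lambda>x. - f x)"
  by (rule in_L2_dominated[of f f _ 1]) (auto simp: in_L2_measurable)

lemma in_L2_diff: "in_Lq 2 f \<Longrightarrow> in_Lq 2 g \<Longrightarrow> in_Lq 2 (\<lambda>x. f x - g x)"
  using in_L2_add[OF _ in_L2_uminus, of f g] by simp

lemma in_L2_scaleR: "in_Lq 2 f \<Longrightarrow> in_Lq 2 (\<lambda>x. r *\<^sub>R f x)"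
  by (rule in_L2_dominated[of f f _ "r\<^sup>2"])
    (auto simp: in_L2_measurable power_mult_distrib algebra_simps)

lemma integrable_inner_L2:
  assumes "in_Lq 2 f" "in_Lq 2 g"
  shows "integrable lborel (\<lambda>x. f x \<bullet> g x)"
proof (rule Bochner_Integration.integrable_bound)
  show "integrable lborel (\<lambda>x. (cmod (f x))\<^sup>2 + (cmod (g x))\<^sup>2)"
    using assms by (auto simp: in_L2_iff)
  show "(\<lambda>x. f x \<bullet> g x) \<in> borel_measurable lborel"
    using assms by (auto simp: in_L2_measurable)
  have "\<bar>f x \<bullet> g x\<bar> \<le> (cmod (f x))\<^sup>2 + (cmod (g x))\<^sup>2" for x
    using Cauchy_Schwarz_ineq2[of "f x" "g x"] sum_squares_bound[of "cmod (f x)" "cmod (g x)"]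
      mult_nonneg_nonneg[OF norm_ge_zero norm_ge_zero, of "f x" "g x"]
    by linarith
  then show "AE x in lborel. norm (f x \<bullet> g x) \<le> norm ((cmod (f x))\<^sup>2 + (cmod (g x))\<^sup>2)"
    by auto
qed

definition L2_rel :: "(real \<Rightarrow> complex) \<Rightarrow> (real \<Rightarrow> complex) \<Rightarrow> bool" where
  "L2_rel f g \<longleftrightarrow> in_Lq 2 f \<and> in_Lq 2 g \<and> (AE x in lborel. f x = g x)"

lemma L2_rel_refl: "L2_rel f f \<longleftrightarrow> in_Lq 2 f"
  by (simp add: L2_rel_def)

lemma L2_relI: "in_Lq 2 f \<Longrightarrow> (\<And>x. f x = g x) \<Longrightarrow> L2_rel f g"
  by (metis L2_rel_refl ext)

lemma L2_rel_part_equivp: "part_equivp L2_rel"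
proof (rule part_equivpI)
  show "\<exists>x. L2_rel x x" using in_L2_0 by (auto simp: L2_rel_def)
  show "symp L2_rel"
  proof (rule sympI)
    fix f g assume "L2_rel f g"
    then have "in_Lq 2 f" "in_Lq 2 g" and *: "AE x in lborel. f x = g x"
      by (simp_all add: L2_rel_def)
    moreover from * have "AE x in lborel. g x = f x"
      by eventually_elim (rule sym)
    ultimately show "L2_rel g f" by (simp add: L2_rel_def)
  qed
  show "transp L2_rel"
  proof (rule transpI)
    fix f g h assume "L2_rel f g" "L2_rel g h"
    then have "in_Lq 2 f" "in_Lq 2 h"
      and *: "AE x in lborel. f x = g x" "AE x in lborel. g x = h x"
      by (simp_all add: L2_rel_def)
    moreover from * have "AE x in lborel. f x = h x"
      by eventually_elim (rule trans)
    ultimately show "L2_rel f h" by (simp add: L2_rel_def)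
  qed
qed

quotient_type l2 = "real \<Rightarrow> complex" / partial: L2_rel
  morphisms rep_l2 abs_l2
  by (rule L2_rel_part_equivp)

lemma L2_rel_rep_abs: "in_Lq 2 f \<Longrightarrow> L2_rel (rep_l2 (abs_l2 f)) f"
  by (rule rep_abs_rsp_left[OF Quotient3_l2]) (simp only: L2_rel_refl)

lemma in_L2_rep: "in_Lq 2 (rep_l2 u)"
  using Quotient3_rep_reflp[OF Quotient3_l2, of u] by (simp only: L2_rel_refl)

lemma rep_abs_l2: "in_Lq 2 f \<Longrightarrow> AE x in lborel. rep_l2 (abs_l2 f) x = f x"
  using L2_rel_rep_abs[of f] by (simp add: L2_rel_def)

lemma abs_rep_l2: "abs_l2 (rep_l2 u) = u"
  by (rule Quotient3_abs_rep[OF Quotient3_l2])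

lemma l2_abs_eq_iff:
  "in_Lq 2 f \<Longrightarrow> in_Lq 2 g \<Longrightarrow> abs_l2 f = abs_l2 g \<longleftrightarrow> (AE x in lborel. f x = g x)"
  using Quotient3_rel[OF Quotient3_l2, of f g] unfolding L2_rel_refl by (simp add: L2_rel_def)

instantiation l2 :: real_inner
begin

lift_definition zero_l2 :: l2 is "\<lambda>x. 0"
  by (simp add: L2_rel_def in_L2_0)

lift_definition plus_l2 :: "l2 \<Rightarrow> l2 \<Rightarrow> l2" is "\<lambda>f g x. f x + g x"
  by (auto simp: L2_rel_def in_L2_add)

lift_definition minus_l2 :: "l2 \<Rightarrow> l2 \<Rightarrow> l2" is "\<lambda>f g x. f x - g x"
  by (auto simp: L2_rel_def in_L2_diff)

lift_definition uminus_l2 :: "l2 \<Rightarrow> l2" is "\<lambda>f x. - f x"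
  by (auto simp: L2_rel_def in_L2_uminus)

lift_definition scaleR_l2 :: "real \<Rightarrow> l2 \<Rightarrow> l2" is "\<lambda>r f x. r *\<^sub>R f x"
  by (auto simp: L2_rel_def in_L2_scaleR)

lift_definition inner_l2 :: "l2 \<Rightarrow> l2 \<Rightarrow> real" is "\<lambda>f g. LINT x|lborel. f x \<bullet> g x"
  by (auto simp: L2_rel_def in_L2_measurable intro!: integral_cong_AE)

lift_definition norm_l2 :: "l2 \<Rightarrow> real" is "Lq_norm 2"
  unfolding Lq_norm_def
  by (auto simp: L2_rel_def in_L2_measurable intro!: arg_cong[where f = "\<lambda>x. x powr _"] integral_cong_AE)

definition sgn_l2 :: "l2 \<Rightarrow> l2" where "sgn_l2 u = scaleR (inverse (norm u)) u"
definition dist_l2 :: "l2 \<Rightarrow> l2 \<Rightarrow> real" where "dist_l2 u v = norm (u - v)"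
definition uniformity_l2 :: "(l2 \<times> l2) filter" where
  "uniformity_l2 = (INF e\<in>{0<..}. principal {(x, y). dist x y < e})"
definition open_l2 :: "l2 set \<Rightarrow> bool" where
  "open_l2 U = (\<forall>x\<in>U. eventually (\<lambda>(x', y). x' = x \<longrightarrow> y \<in> U) uniformity)"

instance
proof
  fix x y z :: l2 and r s :: real
  show "x + y + z = x + (y + z)"
    by transfer (rule L2_relI, auto simp: L2_rel_refl intro!: in_L2_add)
  show "x + y = y + x"
    by transfer (rule L2_relI, auto simp: L2_rel_refl intro!: in_L2_add)
  show "0 + x = x"
    by transfer simp
  show "- x + x = 0"
    by transfer (simp add: L2_rel_refl in_L2_0)
  show "x - y = x + - y"
    by transfer (rule L2_relI, auto simp: L2_rel_refl intro!: in_L2_diff)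
  show "r *\<^sub>R (x + y) = r *\<^sub>R x + r *\<^sub>R y"
    by transfer (rule L2_relI, auto simp only: L2_rel_refl scaleR_add_right intro!: in_L2_scaleR in_L2_add)
  show "(r + s) *\<^sub>R x = r *\<^sub>R x + s *\<^sub>R x"
    by transfer (rule L2_relI, auto simp only: L2_rel_refl scaleR_add_left intro!: in_L2_scaleR in_L2_add)
  show "r *\<^sub>R s *\<^sub>R x = (r * s) *\<^sub>R x"
    by transfer (rule L2_relI, auto simp only: L2_rel_refl scaleR_scaleR intro!: in_L2_scaleR)
  show "1 *\<^sub>R x = x"
    by transfer simp
  show "sgn x = scaleR (inverse (norm x)) x" by (rule sgn_l2_def)
  show "dist x y = norm (x - y)" by (rule dist_l2_def)
  show "(uniformity :: (l2 \<times> l2) filter) = (INF e\<in>{0<..}. principal {(x, y). dist x y < e})"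
    by (rule uniformity_l2_def)
  show "open U = (\<forall>x\<in>U. eventually (\<lambda>(x', y). x' = x \<longrightarrow> y \<in> U) uniformity)" for U :: "l2 set"
    by (rule open_l2_def)
  show "inner x y = inner y x"
    by transfer (simp add: inner_commute)
  show "inner (x + y) z = inner x z + inner y z"
    by transfer (simp add: L2_rel_refl inner_add_left integrable_inner_L2)
  show "inner (r *\<^sub>R x) y = r * inner x y"
    by transfer (simp only: inner_scaleR_left integral_mult_right_zero)
  show "0 \<le> inner x x"
    by transfer simp
  show "inner x x = 0 \<longleftrightarrow> x = 0"
  proof transfer
    fix f assume "L2_rel f f"
    then have "in_Lq 2 f" by (simp add: L2_rel_def)
    then show "((LINT x|lborel. f x \<bullet> f x) = 0) = L2_rel f (\<lambda>x. 0)"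
      by (subst integral_nonneg_eq_0_iff_AE) (auto simp: integrable_inner_L2 L2_rel_def in_L2_0)
  qed
  show "norm x = sqrt (inner x x)"
    by transfer (simp add: Lq_norm_2 power2_norm_eq_inner)
qed

end

lemma norm_l2_eq: "norm u = Lq_norm 2 (rep_l2 u)"
  by (rule norm_l2.rep_eq)

lemma abs_l2_diff:
  assumes "in_Lq 2 f" "in_Lq 2 g"
  shows "abs_l2 (\<lambda>x. f x - g x) = abs_l2 f - abs_l2 g"
  using assms by (simp add: minus_l2.abs_eq L2_rel_def)

lemma abs_l2_add:
  assumes "in_Lq 2 f" "in_Lq 2 g"
  shows "abs_l2 (\<lambda>x. f x + g x) = abs_l2 f + abs_l2 g"
  using assms by (simp add: plus_l2.abs_eq L2_rel_def)

lemma abs_l2_scaleR: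
  assumes "in_Lq 2 f"
  shows "abs_l2 (\<lambda>x. r *\<^sub>R f x) = r *\<^sub>R abs_l2 f"
  using assms by (simp add: scaleR_l2.abs_eq L2_rel_def)

lemma norm_abs_l2: "in_Lq 2 f \<Longrightarrow> norm (abs_l2 f) = sqrt (LINT x|lborel. (cmod (f x))\<^sup>2)"
  using norm_l2.abs_eq[of f] by (simp add: L2_rel_def Lq_norm_2)


subsection \<open>Completeness\<close>

lemma nn_integral_sq_l2:
  "(\<integral>\<^sup>+x. ennreal ((cmod (rep_l2 u x - rep_l2 v x))\<^sup>2) \<partial>lborel) = ennreal ((norm (u - v))\<^sup>2)"
proof -
  have L: "in_Lq 2 (\<lambda>x. rep_l2 u x - rep_l2 v x)"
    by (intro in_L2_diff in_L2_rep)
  have "u - v = abs_l2 (\<lambda>x. rep_l2 u x - rep_l2 v x)"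
    by (simp add: abs_l2_diff in_L2_rep abs_rep_l2)
  then have "(norm (u - v))\<^sup>2 = (LINT x|lborel. (cmod (rep_l2 u x - rep_l2 v x))\<^sup>2)"
    using norm_abs_l2[OF L] by simp
  then show ?thesis
    using L by (simp add: in_L2_iff nn_integral_eq_integral)
qed

lemma ennreal_sq_le_D: "0 \<le> b \<Longrightarrow> ennreal (a\<^sup>2) \<le> ennreal (b\<^sup>2) \<Longrightarrow> a \<le> b" for a b :: real
  by (metis ennreal_le_iff zero_le_power2 power2_le_imp_le)

lemma pos_prod_le: "0 < a \<Longrightarrow> 0 \<le> a * b \<Longrightarrow> 0 \<le> b" for a b :: real
  by (simp add: zero_le_mult_iff)

lemma quarter: "((1/2::real)^k)\<^sup>2 = (1/4)^k"
  by (simp add: power2_eq_square power_mult_distrib[symmetric] del: power_mult_distrib)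

instance l2 :: banach
proof
  fix X :: "nat \<Rightarrow> l2" assume C: "Cauchy X"
  have "\<exists>N. \<forall>m\<ge>N. \<forall>n\<ge>N. (norm (X m - X n))\<^sup>2 \<le> (1/4) ^ k" for k :: nat
  proof -
    obtain N where N: "\<And>m n. m \<ge> N \<Longrightarrow> n \<ge> N \<Longrightarrow> norm (X m - X n) < (1/2) ^ k"
      using CauchyD[OF C, of "(1/2)^k"] by auto
    have "(norm (X m - X n))\<^sup>2 \<le> ((1/2)^k)\<^sup>2" if "m \<ge> N" "n \<ge> N" for m n
      using N[OF that] by (intro power_mono) auto
    moreover have "((1/2::real)^k)\<^sup>2 = (1/4)^k"
      by (rule quarter)
    ultimately show ?thesis by auto
  qed
  then obtain N where N: "\<And>k m n. m \<ge> N k \<Longrightarrow> n \<ge> N k \<Longrightarrow> (norm (X m - X n))\<^sup>2 \<le> (1/4::real) ^ k"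
    by metis
  define r where "r k = k + (\<Sum>i\<le>k. N i)" for k
  have rN: "r k \<ge> N k" for k
    unfolding r_def using member_le_sum[of k "{..k}" N] by simp
  have rSuc: "r k \<le> r (Suc k)" for k by (simp add: r_def)
  have rk: "r k \<ge> k" for k by (simp add: r_def)
  define F where "F k = rep_l2 (X (r k))" for k
  have Fm [measurable]: "F k \<in> borel_measurable borel" for k
    unfolding F_def by (rule in_L2_measurable[OF in_L2_rep])
  have sq: "(\<integral>\<^sup>+x. ennreal ((cmod (F k x - F m x))\<^sup>2) \<partial>lborel) = ennreal ((norm (X (r k) - X (r m)))\<^sup>2)" for k m
    unfolding F_def by (rule nn_integral_sq_l2)
  have "(\<integral>\<^sup>+x. (\<Sum>k. ennreal (2 ^ k * (cmod (F (Suc k) x - F k x))\<^sup>2)) \<partial>lborel)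
      = (\<Sum>k. \<integral>\<^sup>+x. ennreal (2 ^ k * (cmod (F (Suc k) x - F k x))\<^sup>2) \<partial>lborel)"
    by (subst nn_integral_suminf) auto
  also have "\<dots> \<le> (\<Sum>k. ennreal ((1/2) ^ k))"
  proof (intro suminf_le summableI)
    fix k
    have "(\<integral>\<^sup>+x. ennreal (2 ^ k * (cmod (F (Suc k) x - F k x))\<^sup>2) \<partial>lborel)
        = ennreal (2 ^ k) * (\<integral>\<^sup>+x. ennreal ((cmod (F (Suc k) x - F k x))\<^sup>2) \<partial>lborel)"
      by (subst nn_integral_cmult[symmetric]) (auto simp: ennreal_mult)
    also have "\<dots> = ennreal (2 ^ k * (norm (X (r (Suc k)) - X (r k)))\<^sup>2)"
      by (simp add: sq ennreal_mult)
    also have "\<dots> \<le> ennreal ((1/2) ^ k)"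
    proof (rule ennreal_leI)
      have "(norm (X (r (Suc k)) - X (r k)))\<^sup>2 \<le> (1/4) ^ k"
        using rN[of k] rSuc[of k] by (intro N) auto
      then have "2 ^ k * (norm (X (r (Suc k)) - X (r k)))\<^sup>2 \<le> 2 ^ k * (1/4) ^ k"
        by (intro mult_left_mono) auto
      also have "\<dots> = (1/2::real) ^ k" by (simp only: power_mult_distrib[symmetric]) simp
      finally show "2 ^ k * (norm (X (r (Suc k)) - X (r k)))\<^sup>2 \<le> (1/2) ^ k" .
    qed
    finally show "(\<integral>\<^sup>+x. ennreal (2 ^ k * (cmod (F (Suc k) x - F k x))\<^sup>2) \<partial>lborel) \<le> ennreal ((1/2) ^ k)" .
  qed
  also have "\<dots> < \<infinity>"
    unfolding infinity_ennreal_def less_top[symmetric]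
    by (intro ennreal_suminf_neq_top summable_geometric) auto
  finally have "AE x in lborel. (\<Sum>k. ennreal (2 ^ k * (cmod (F (Suc k) x - F k x))\<^sup>2)) \<noteq> \<infinity>"
    by (intro nn_integral_PInf_AE) auto
  then have conv: "AE x in lborel. convergent (\<lambda>k. F k x)"
  proof (rule eventually_mono)
    fix x assume "(\<Sum>k. ennreal (2 ^ k * (cmod (F (Suc k) x - F k x))\<^sup>2)) \<noteq> \<infinity>"
    then have s: "summable (\<lambda>k. 2 ^ k * (cmod (F (Suc k) x - F k x))\<^sup>2)"
      by (intro summable_suminf_not_top) auto
    have "summable (\<lambda>k. norm (F (Suc k) x - F k x))"
    proof (rule summable_comparison_test')
      show "summable (\<lambda>k. 2 ^ k * (cmod (F (Suc k) x - F k x))\<^sup>2 + (1/2) ^ k)"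
        by (intro summable_add s summable_geometric) auto
      fix k
      define d where "d = cmod (F (Suc k) x - F k x)"
      have "0 \<le> (2 ^ k * d - 1)\<^sup>2 + d * 0" by simp
      also have "\<dots> = 2 ^ k * (2 ^ k * d\<^sup>2 - 2 * d + (1/2)^k)"
        by (simp add: power2_eq_square field_simps power_one_over)
      finally have "0 \<le> 2 ^ k * d\<^sup>2 - 2 * d + (1/2)^k"
        by (rule pos_prod_le[rotated]) simp
      moreover have "0 \<le> d" by (simp add: d_def)
      ultimately have "d \<le> 2 ^ k * d\<^sup>2 + (1/2)^k" by linarith
      then show "norm (norm (F (Suc k) x - F k x)) \<le> 2 ^ k * (cmod (F (Suc k) x - F k x))\<^sup>2 + (1/2) ^ k"
        by (simp add: d_def)
    qed
    then have "summable (\<lambda>k. F (Suc k) x - F k x)"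
      by (rule summable_norm_cancel)
    then have "convergent (\<lambda>n. \<Sum>i<n. F (Suc i) x - F i x)"
      by (simp add: summable_iff_convergent)
    then have "convergent (\<lambda>n. F n x - F 0 x)"
      by (simp only: sum_lessThan_telescope[of "\<lambda>i. F i x"])
    then obtain l where "(\<lambda>n. F n x - F 0 x) \<longlonglongrightarrow> l"
      by (auto simp: convergent_def)
    from tendsto_add[OF this tendsto_const[of "F 0 x"]]
    show "convergent (\<lambda>k. F k x)" by (auto simp: convergent_def)
  qed
  define f where "f x = lim (\<lambda>k. F k x)" for x
  have fm [measurable]: "f \<in> borel_measurable borel"
    unfolding f_def by measurable
  have lim: "AE x in lborel. (\<lambda>k. F k x) \<longlonglongrightarrow> f x"
    using conv by (auto simp: f_def convergent_LIMSEQ_iff)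
  have fatou: "(\<integral>\<^sup>+x. ennreal ((cmod (F n x - f x))\<^sup>2) \<partial>lborel) \<le> ennreal ((1/4) ^ n)" for n
  proof -
    have "(\<integral>\<^sup>+x. ennreal ((cmod (F n x - f x))\<^sup>2) \<partial>lborel)
        = (\<integral>\<^sup>+x. liminf (\<lambda>k. ennreal ((cmod (F n x - F k x))\<^sup>2)) \<partial>lborel)"
    proof (rule nn_integral_cong_AE, use lim in \<open>rule eventually_mono\<close>)
      fix x assume "(\<lambda>k. F k x) \<longlonglongrightarrow> f x"
      then have "(\<lambda>k. ennreal ((cmod (F n x - F k x))\<^sup>2)) \<longlonglongrightarrow> ennreal ((cmod (F n x - f x))\<^sup>2)"
        by (intro tendsto_intros)
      then show "ennreal ((cmod (F n x - f x))\<^sup>2) = liminf (\<lambda>k. ennreal ((cmod (F n x - F k x))\<^sup>2))"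
        by (rule lim_imp_Liminf[OF trivial_limit_sequentially, symmetric])
    qed
    also have "\<dots> \<le> liminf (\<lambda>k. \<integral>\<^sup>+x. ennreal ((cmod (F n x - F k x))\<^sup>2) \<partial>lborel)"
      by (rule nn_integral_liminf) auto
    also have "\<dots> = liminf (\<lambda>k. ennreal ((norm (X (r n) - X (r k)))\<^sup>2))"
      by (simp add: sq)
    also have "\<dots> \<le> limsup (\<lambda>k. ennreal ((norm (X (r n) - X (r k)))\<^sup>2))"
      by (rule Liminf_le_Limsup) simp
    also have "\<dots> \<le> ennreal ((1/4) ^ n)"
    proof (rule Limsup_bounded, rule eventually_sequentiallyI)
      fix k assume "k \<ge> N n"
      then show "ennreal ((norm (X (r n) - X (r k)))\<^sup>2) \<le> ennreal ((1/4) ^ n)"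
        using rN[of n] rk[of k] by (intro ennreal_leI N) auto
    qed
    finally show ?thesis .
  qed
  have Ld: "in_Lq 2 (\<lambda>x. F n x - f x)" for n
  proof -
    have "(\<integral>\<^sup>+x. ennreal (norm ((cmod (F n x - f x))\<^sup>2)) \<partial>lborel) < \<infinity>"
      using le_less_trans[OF fatou[of n] ennreal_less_top] by simp
    then show ?thesis by (auto simp: in_L2_iff intro!: integrableI_bounded)
  qed
  have "in_Lq 2 (\<lambda>x. F 0 x - (F 0 x - f x))"
    by (intro in_L2_diff[OF _ Ld]) (simp add: F_def in_L2_rep)
  then have Lf: "in_Lq 2 f" by simp
  have b: "norm (X (r n) - abs_l2 f) \<le> (1/2) ^ n" for n
  proof -
    have "X (r n) - abs_l2 f = abs_l2 (\<lambda>x. F n x - f x)"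
      unfolding F_def by (simp add: abs_l2_diff in_L2_rep Lf abs_rep_l2)
    then have "(norm (X (r n) - abs_l2 f))\<^sup>2 = (LINT x|lborel. (cmod (F n x - f x))\<^sup>2)"
      using norm_abs_l2[OF Ld[of n]] by simp
    then have "ennreal ((norm (X (r n) - abs_l2 f))\<^sup>2) = (\<integral>\<^sup>+x. ennreal ((cmod (F n x - f x))\<^sup>2) \<partial>lborel)"
      using Ld[of n] by (simp add: in_L2_iff nn_integral_eq_integral)
    also have "\<dots> \<le> ennreal (((1/2) ^ n)\<^sup>2)"
      using fatou[of n] by (simp only: quarter)
    finally show ?thesis by (rule ennreal_sq_le_D[rotated]) simp
  qed
  have "X \<longlonglongrightarrow> abs_l2 f"
  proof (rule LIMSEQ_I)
    fix e :: real assume e: "0 < e"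
    obtain M where M: "\<And>m n. m \<ge> M \<Longrightarrow> n \<ge> M \<Longrightarrow> norm (X m - X n) < e / 2"
      using CauchyD[OF C, of "e/2"] e by auto
    obtain k where k: "(1/2) ^ k < e / 2"
      using real_arch_pow_inv[of "e/2" "1/2"] e by auto
    define j where "j = max k M"
    have "(1/2) ^ j \<le> (1/2::real) ^ k" by (intro power_decreasing) (auto simp: j_def)
    then have 1: "norm (X (r j) - abs_l2 f) < e / 2" using b[of j] k by linarith
    have "norm (X n - abs_l2 f) < e" if "n \<ge> M" for n
    proof -
      have "norm (X n - X (r j)) < e / 2" using that rk[of j] by (intro M) (auto simp: j_def)
      then show ?thesis
        using 1 norm_triangle_ineq[of "X n - X (r j)" "X (r j) - abs_l2 f"] by simp
    qed
    then show "\<exists>no. \<forall>n\<ge>no. norm (X n - abs_l2 f) < e" by blast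
  qed
  then show "convergent X" by (auto simp: convergent_def)
qed

subsection \<open>Separability\<close>

lemma l2_dominated_convergence:
  assumes g: "in_Lq 2 g" and fm: "\<And>k. f k \<in> borel_measurable borel"
    and le: "\<And>k x. cmod (f k x) \<le> C * cmod (g x)"
    and lim: "\<And>x. (\<lambda>k. f k x) \<longlonglongrightarrow> f' x"
  shows "in_Lq 2 (f k)" and "in_Lq 2 f'" and "(\<lambda>k. abs_l2 (f k)) \<longlonglongrightarrow> abs_l2 f'"
proof -
  have f'm: "f' \<in> borel_measurable borel"
    using fm lim by (rule borel_measurable_LIMSEQ_metric)
  have le': "cmod (f' x) \<le> C * cmod (g x)" for x
    by (rule LIMSEQ_le_const2[OF tendsto_norm[OF lim]]) (use le in auto)
  have sq: "(cmod a)\<^sup>2 \<le> C\<^sup>2 * ((cmod b)\<^sup>2 + (cmod b)\<^sup>2)" if "cmod a \<le> C * cmod b" for a b :: complex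
  proof -
    have "(cmod a)\<^sup>2 \<le> (C * cmod b)\<^sup>2" using that by (intro power_mono) auto
    also have "\<dots> \<le> C\<^sup>2 * ((cmod b)\<^sup>2 + (cmod b)\<^sup>2)"
      by (simp add: power_mult_distrib mult_left_mono)
    finally show ?thesis .
  qed
  show Lf: "in_Lq 2 (f k)" for k
    by (rule in_L2_dominated[OF g g fm sq[OF le]])
  show Lf': "in_Lq 2 f'"
    by (rule in_L2_dominated[OF g g f'm sq[OF le']])
  have "(\<lambda>k. LINT x|lborel. (cmod (f k x - f' x))\<^sup>2) \<longlonglongrightarrow> (LINT x|(lborel :: real measure). 0)"
  proof (rule integral_dominated_convergence[where w = "\<lambda>x. (2 * C)\<^sup>2 * (cmod (g x))\<^sup>2"])
    show "integrable lborel (\<lambda>x. (2 * C)\<^sup>2 * (cmod (g x))\<^sup>2)"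
      using g by (auto simp: in_L2_iff)
    show "(\<lambda>x. (cmod (f k x - f' x))\<^sup>2) \<in> borel_measurable lborel" for k
      using fm f'm by measurable
    have "(cmod (f k x - f' x))\<^sup>2 \<le> (2 * C)\<^sup>2 * (cmod (g x))\<^sup>2" for k x
    proof -
      have "cmod (f k x - f' x) \<le> 2 * C * cmod (g x)"
        using norm_triangle_ineq4[of "f k x" "f' x"] le[of k x] le'[of x] by linarith
      then have "(cmod (f k x - f' x))\<^sup>2 \<le> (2 * C * cmod (g x))\<^sup>2"
        by (intro power_mono) auto
      then show ?thesis by (simp only: power_mult_distrib)
    qed
    then show "AE x in lborel. norm ((cmod (f k x - f' x))\<^sup>2) \<le> (2 * C)\<^sup>2 * (cmod (g x))\<^sup>2" for k
      by simp
    have "(\<lambda>k. (cmod (f k x - f' x))\<^sup>2) \<longlonglongrightarrow> (cmod (f' x - f' x))\<^sup>2" for x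
      by (intro tendsto_intros lim)
    then show "AE x in lborel. (\<lambda>k. (cmod (f k x - f' x))\<^sup>2) \<longlonglongrightarrow> 0"
      by simp
  qed simp
  then have "(\<lambda>k. sqrt (LINT x|lborel. (cmod (f k x - f' x))\<^sup>2)) \<longlonglongrightarrow> sqrt 0"
    by (intro tendsto_real_sqrt) simp
  moreover have "norm (abs_l2 (f k) - abs_l2 f') = sqrt (LINT x|lborel. (cmod (f k x - f' x))\<^sup>2)" for k
    using norm_abs_l2[OF in_L2_diff[OF Lf[of k] Lf']] by (simp add: abs_l2_diff Lf Lf')
  ultimately have "(\<lambda>k. norm (abs_l2 (f k) - abs_l2 f')) \<longlonglongrightarrow> 0"
    by simp
  then show "(\<lambda>k. abs_l2 (f k)) \<longlonglongrightarrow> abs_l2 f'"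
    by (simp only: tendsto_norm_zero_iff LIM_zero_iff)
qed

definition box_ind :: "nat \<Rightarrow> real set \<Rightarrow> complex \<Rightarrow> real \<Rightarrow> complex" where
  "box_ind n A c x = indicator (A \<inter> {- real n..real n}) x *\<^sub>R c"

lemma box_ind_cmod: "cmod (box_ind n A c x) \<le> cmod c * cmod (box_ind n UNIV 1 x)"
  by (auto simp: box_ind_def indicator_def)

lemma box_ind_measurable [measurable]: "A \<in> sets borel \<Longrightarrow> box_ind n A c \<in> borel_measurable borel"
  unfolding box_ind_def[abs_def]
  by (intro borel_measurable_scaleR borel_measurable_indicator borel_measurable_const) auto

lemma in_L2_box: "A \<in> sets borel \<Longrightarrow> in_Lq 2 (box_ind n A c)"
proof -
  assume A: "A \<in> sets borel"
  have "integrable lborel (\<lambda>x. indicator (A \<inter> {- real n..real n}) x * (cmod c)\<^sup>2 :: real)"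
  proof (intro integrable_mult_left integrable_real_indicator)
    show "A \<inter> {- real n..real n} \<in> sets lborel" using A by auto
    have "emeasure lborel (A \<inter> {- real n..real n}) \<le> emeasure lborel {- real n..real n}"
      by (intro emeasure_mono) auto
    also have "\<dots> < \<infinity>" by simp
    finally show "emeasure lborel (A \<inter> {- real n..real n}) < \<infinity>" .
  qed
  moreover have "(\<lambda>x. (cmod (box_ind n A c x))\<^sup>2)
      = (\<lambda>x. indicator (A \<inter> {- real n..real n}) x * (cmod c)\<^sup>2)"
    by (auto simp: box_ind_def indicator_def)
  ultimately show ?thesis
    using box_ind_measurable[OF A, of n c] by (simp add: in_L2_iff)
qed

lemma box_ind_decomp:
  assumes "A \<in> sets borel"
  shows "abs_l2 (box_ind n A c)
    = Re c *\<^sub>R abs_l2 (box_ind n A 1) + Im c *\<^sub>R abs_l2 (box_ind n A \<i>)"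
proof -
  have "box_ind n A c = (\<lambda>x. Re c *\<^sub>R box_ind n A 1 x + Im c *\<^sub>R box_ind n A \<i> x)"
    by (auto simp: box_ind_def indicator_def complex_eq_iff)
  then show ?thesis
    using in_L2_box[OF assms] by (simp only: abs_l2_add abs_l2_scaleR in_L2_scaleR)
qed

lemma borel_UNIV: "(UNIV :: real set) \<in> sets borel"
  by simp

lemma l2_separable: "\<exists>D :: l2 set. countable D \<and> closure D = UNIV"
proof -
  obtain Bs :: "real set set" where Bs: "countable Bs" "topological_basis Bs"
    using ex_countable_basis by blast
  define P where "P = (\<lambda>F. \<Inter>F) ` {F. finite F \<and> F \<subseteq> Bs}"
  have P_count: "countable P"
    unfolding P_def by (intro countable_image countable_Collect_finite_subset Bs)
  have P_borel: "P \<subseteq> sets borel"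
  proof
    fix A assume "A \<in> P"
    then obtain F where "finite F" "F \<subseteq> Bs" "A = \<Inter>F" by (auto simp: P_def)
    then have "open A"
      using topological_basis_open[OF Bs(2)] by (auto intro!: open_Inter)
    then show "A \<in> sets borel" by simp
  qed
  have P_UNIV: "UNIV \<in> P"
    unfolding P_def by (rule image_eqI[where x = "{}"]) auto
  have P_stable: "Int_stable P"
  proof (rule Int_stableI)
    fix a b assume "a \<in> P" "b \<in> P"
    then obtain F G where "finite F" "F \<subseteq> Bs" "a = \<Inter>F" "finite G" "G \<subseteq> Bs" "b = \<Inter>G"
      by (auto simp: P_def)
    then show "a \<inter> b \<in> P"
      unfolding P_def by (intro image_eqI[where x = "F \<union> G"]) auto
  qed
  have sets_P: "A \<in> sigma_sets UNIV P" if "A \<in> sets borel" for A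
  proof -
    have "Bs \<subseteq> P"
    proof
      fix b assume "b \<in> Bs"
      then show "b \<in> P" unfolding P_def by (intro image_eqI[where x = "{b}"]) auto
    qed
    then have "sigma_sets UNIV Bs \<subseteq> sigma_sets UNIV P" by (rule sigma_sets_mono')
    moreover have "sets borel = sigma_sets UNIV Bs"
      by (subst borel_eq_countable_basis[OF Bs]) (simp add: sets_measure_of)
    ultimately show ?thesis using that by auto
  qed

  define S where "S = (\<lambda>(n, A, c). abs_l2 (box_ind n A c)) ` (UNIV \<times> P \<times> {1, \<i>})"
  define val :: "(rat \<times> l2) list \<Rightarrow> l2"
    where "val l = sum_list (map (\<lambda>(q, s). real_of_rat q *\<^sub>R s) l)" for l
  define D where "D = val ` lists (UNIV \<times> S)"
  have "countable S" unfolding S_def by (intro countable_image countable_SIGMA P_count) auto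
  then have D_count: "countable D"
    unfolding D_def by (intro countable_image countable_lists countable_SIGMA) auto
  have D_add: "u + v \<in> D" if uv: "u \<in> D" "v \<in> D" for u v
  proof -
    obtain a b where ab: "a \<in> lists (UNIV \<times> S)" "b \<in> lists (UNIV \<times> S)" "u = val a" "v = val b"
      using uv unfolding D_def by blast
    then have "u + v = val (a @ b)" by (simp add: val_def)
    moreover have "a @ b \<in> lists (UNIV \<times> S)" using ab by auto
    ultimately show ?thesis unfolding D_def by (rule image_eqI)
  qed
  have D_rat: "real_of_rat q *\<^sub>R u \<in> D" if u: "u \<in> D" for q u
  proof -
    obtain a where a: "a \<in> lists (UNIV \<times> S)" "u = val a" using u unfolding D_def by blast
    have "real_of_rat q *\<^sub>R val a = val (map (\<lambda>(r, s). (q * r, s)) a)"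
      by (induction a) (auto simp: val_def scaleR_add_right of_rat_mult)
    moreover have "map (\<lambda>(r, s). (q * r, s)) a \<in> lists (UNIV \<times> S)" using a by auto
    ultimately show ?thesis unfolding D_def a by (rule image_eqI)
  qed
  define V where "V = closure D"
  have V_closed: "closed V" by (simp add: V_def)
  have V_add: "u + v \<in> V" if uv: "u \<in> V" "v \<in> V" for u v
  proof -
    obtain x y where "\<And>n::nat. x n \<in> D" "x \<longlonglongrightarrow> u" "\<And>n::nat. y n \<in> D" "y \<longlonglongrightarrow> v"
      using uv unfolding V_def closure_sequential by blast
    then show ?thesis unfolding V_def closure_sequential
      by (intro exI[of _ "\<lambda>n. x n + y n"]) (auto intro: D_add tendsto_add)
  qed
  have V_rat: "real_of_rat q *\<^sub>R u \<in> V" if uv: "u \<in> V" for q u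
  proof -
    obtain x where "\<And>n::nat. x n \<in> D" "x \<longlonglongrightarrow> u"
      using uv unfolding V_def closure_sequential by blast
    then show ?thesis unfolding V_def closure_sequential
      by (intro exI[of _ "\<lambda>n. real_of_rat q *\<^sub>R x n"]) (auto intro: D_rat tendsto_intros)
  qed
  have V_scale: "r *\<^sub>R u \<in> V" if "u \<in> V" for r u
  proof -
    have "r \<in> closure \<rat>" by (simp add: Rats_closure_real)
    then obtain t where t: "\<And>n::nat. t n \<in> \<rat>" "t \<longlonglongrightarrow> r"
      unfolding closure_sequential by blast
    show ?thesis
    proof (rule closed_sequentially[OF V_closed])
      show "t n *\<^sub>R u \<in> V" for n
        using t(1)[of n] V_rat[OF that] by (auto simp: Rats_def)
      show "(\<lambda>n. t n *\<^sub>R u) \<longlonglongrightarrow> r *\<^sub>R u"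
        by (intro tendsto_intros t)
    qed
  qed
  have V_0: "0 \<in> V"
  proof -
    have "val [] \<in> D" unfolding D_def by (intro imageI) simp
    then show ?thesis using closure_subset[of D] by (auto simp: V_def val_def)
  qed
  have S_V: "S \<subseteq> V"
  proof
    fix s assume "s \<in> S"
    then have "val [(1, s)] \<in> D" unfolding D_def by (intro imageI) auto
    then show "s \<in> V" using closure_subset[of D] by (auto simp: V_def val_def)
  qed

  have box1: "abs_l2 (box_ind n A c) \<in> V" if c: "c \<in> {1, \<i>}" and A: "A \<in> sets borel" for n A c
    using P_stable subset_UNIV[of P, folded Pow_UNIV] sets_P[OF A]
  proof (induction rule: sigma_sets_induct_disjoint)
    case (basic A)
    then have "abs_l2 (box_ind n A c) \<in> S" using c unfolding S_def by force
    then show ?case using S_V by auto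
  next
    case empty
    have "box_ind n {} c = (\<lambda>x. 0)" by (auto simp: box_ind_def)
    then show ?case using V_0 by (simp add: zero_l2.abs_eq)
  next
    case (compl A)
    have A: "A \<in> sets borel"
      using compl(1) sets.sigma_sets_subset[OF P_borel] by auto
    have "box_ind n (UNIV - A) c = (\<lambda>x. box_ind n UNIV c x + (-1) *\<^sub>R box_ind n A c x)"
      by (auto simp: box_ind_def indicator_def)
    then have "abs_l2 (box_ind n (UNIV - A) c)
        = abs_l2 (box_ind n UNIV c) + (-1) *\<^sub>R abs_l2 (box_ind n A c)"
      by (simp only: abs_l2_add abs_l2_scaleR in_L2_scaleR in_L2_box[OF A] in_L2_box[OF borel_UNIV])
    moreover have "abs_l2 (box_ind n UNIV c) \<in> S" using c P_UNIV unfolding S_def by force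
    ultimately show ?case
      using V_add[OF subsetD[OF S_V] V_scale[OF compl(2), of "-1"]] by metis
  next
    case (union A)
    have A: "A i \<in> sets borel" for i
      using union(2) sets.sigma_sets_subset[OF P_borel] by auto
    have fin: "abs_l2 (box_ind n (\<Union>i<k. A i) c) \<in> V" for k
    proof (induction k)
      case 0
      have "box_ind n {} c = (\<lambda>x. 0)" by (auto simp: box_ind_def)
      then show ?case using V_0 by (simp add: zero_l2.abs_eq)
    next
      case (Suc k)
      have U: "(\<Union>i<k. A i) \<in> sets borel" using A by auto
      have disj: "x \<notin> A k" if "i < k" "x \<in> A i" for i x
        using disjoint_family_onD[OF union(1), of i k] that by auto
      have "box_ind n (\<Union>i<Suc k. A i) c x = box_ind n (\<Union>i<k. A i) c x + box_ind n (A k) c x" for x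
        using disj by (auto simp: box_ind_def indicator_def less_Suc_eq)
      then have "box_ind n (\<Union>i<Suc k. A i) c = (\<lambda>x. box_ind n (\<Union>i<k. A i) c x + box_ind n (A k) c x)"
        by blast
      then have "abs_l2 (box_ind n (\<Union>i<Suc k. A i) c)
          = abs_l2 (box_ind n (\<Union>i<k. A i) c) + abs_l2 (box_ind n (A k) c)"
        using in_L2_box[OF U] in_L2_box[OF A] by (simp only: abs_l2_add)
      then show ?case using Suc union(3) by (auto intro: V_add)
    qed
    have "(\<lambda>k. abs_l2 (box_ind n (\<Union>i<k. A i) c)) \<longlonglongrightarrow> abs_l2 (box_ind n (\<Union>i. A i) c)"
    proof (rule l2_dominated_convergence(3)[where g = "box_ind n UNIV 1" and C = "cmod c"])
      show "in_Lq 2 (box_ind n UNIV 1)" by (rule in_L2_box) simp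
      show "box_ind n (\<Union>i<k. A i) c \<in> borel_measurable borel" for k
        using A by (intro box_ind_measurable) auto
      show "cmod (box_ind n (\<Union>i<k. A i) c x) \<le> cmod c * cmod (box_ind n UNIV 1 x)" for k x
        by (rule box_ind_cmod)
      show "(\<lambda>k. box_ind n (\<Union>i<k. A i) c x) \<longlonglongrightarrow> box_ind n (\<Union>i. A i) c x" for x
        unfolding box_ind_def indicator_inter_arith
        by (intro tendsto_intros LIMSEQ_indicator_UN)
    qed
    then show ?case by (rule closed_sequentially[OF V_closed fin])
  qed
  have box: "abs_l2 (box_ind n A c) \<in> V" if "A \<in> sets borel" for n A c
    by (subst box_ind_decomp[OF that]) (intro V_add V_scale box1 that; simp)

  have "u \<in> V" for u
  proof -
    define f where "f = rep_l2 u"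
    have Lf: "in_Lq 2 f" unfolding f_def by (rule in_L2_rep)
    obtain F where F: "\<And>i::nat. simple_function borel (F i)" "\<And>x. (\<lambda>i. F i x) \<longlonglongrightarrow> f x"
      and F_le: "\<And>i x. dist (F i x) 0 \<le> 2 * dist (f x) 0"
      using borel_measurable_implies_sequence_metric[OF in_L2_measurable[OF Lf], of 0] by auto
    define G where "G i x = (\<Sum>y\<in>range (F i). box_ind i (F i -` {y}) y x)" for i x
    have fin: "finite (range (F i))" for i
      using simple_functionD(1)[OF F(1), of i] by simp
    have level: "F i -` {y} \<in> sets borel" for i y
      using simple_functionD(2)[OF F(1), of i "{y}"] by simp
    have G_eq: "G i x = indicator {- real i..real i} x *\<^sub>R F i x" for i x
    proof -
      have "G i x = (\<Sum>y\<in>range (F i). if y = F i x then indicator {- real i..real i} x *\<^sub>R y else 0)"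
        unfolding G_def by (intro sum.cong) (auto simp: box_ind_def indicator_def)
      then show ?thesis by (simp add: sum.delta fin)
    qed
    have Y: "in_Lq 2 (\<lambda>x. \<Sum>y\<in>Y. box_ind i (F i -` {y}) y x)
        \<and> abs_l2 (\<lambda>x. \<Sum>y\<in>Y. box_ind i (F i -` {y}) y x) \<in> V" if "finite Y" for i Y
      using that
    proof (induction Y rule: finite_induct)
      case empty
      then show ?case using V_0 by (simp add: zero_l2.abs_eq in_L2_0)
    next
      case (insert y Y)
      then show ?case
        using in_L2_box[OF level, of i i y y] box[OF level, of i i y y]
        by (simp add: in_L2_add abs_l2_add V_add)
    qed
    have G_V: "abs_l2 (G i) \<in> V" and G_L: "in_Lq 2 (G i)" for i
      using Y[OF fin, of i i] by (simp_all add: G_def[abs_def])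
    have "(\<lambda>i. abs_l2 (G i)) \<longlonglongrightarrow> abs_l2 f"
    proof (rule l2_dominated_convergence(3)[OF Lf, where C = 2])
      show "G i \<in> borel_measurable borel" for i by (rule in_L2_measurable[OF G_L])
      show "cmod (G i x) \<le> 2 * cmod (f x)" for i x
        using F_le[of i x] by (auto simp: G_eq indicator_def)
      show "(\<lambda>i. G i x) \<longlonglongrightarrow> f x" for x
      proof (rule Lim_transform_eventually[OF F(2)])
        obtain N :: nat where "\<bar>x\<bar> \<le> real N" using real_arch_simple by blast
        then show "\<forall>\<^sub>F i in sequentially. F i x = G i x"
          by (intro eventually_sequentiallyI[of N]) (auto simp: G_eq indicator_def)
      qed
    qed
    then have "abs_l2 f \<in> V" by (rule closed_sequentially[OF V_closed G_V])
    then show ?thesis by (simp add: f_def abs_rep_l2)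
  qed
  then show ?thesis using D_count by (auto simp: V_def)
qed

instance l2 :: second_countable_topology
proof
  obtain D :: "l2 set" where D: "countable D" "closure D = UNIV"
    using l2_separable by blast
  define B where "B = (\<lambda>(d, q). ball d (real_of_rat q)) ` (D \<times> UNIV)"
  have "countable B" unfolding B_def by (intro countable_image countable_SIGMA D) auto
  moreover have "topological_basis B"
  proof (rule topological_basisI)
    show "open b" if "b \<in> B" for b using that by (auto simp: B_def)
    fix U and u :: l2 assume "open U" "u \<in> U"
    then obtain e where e: "e > 0" "ball u e \<subseteq> U" by (auto simp: open_contains_ball)
    obtain d where d: "d \<in> D" "dist d u < e / 3"
      using closure_approachable[of u D] D(2) e(1) by (metis UNIV_I zero_less_divide_iff zero_less_numeral)
    obtain q where q: "e / 3 < real_of_rat q" "real_of_rat q < 2 * e / 3"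
      using of_rat_dense[of "e / 3" "2 * e / 3"] e(1) by auto
    have "ball d (real_of_rat q) \<subseteq> ball u e"
    proof
      fix y assume "y \<in> ball d (real_of_rat q)"
      then show "y \<in> ball u e"
        using d(2) q(2) dist_triangle[of u y d] by (simp add: dist_commute)
    qed
    moreover have "u \<in> ball d (real_of_rat q)" using d(2) q(1) by simp
    moreover have "ball d (real_of_rat q) \<in> B" using d(1) by (auto simp: B_def)
    ultimately show "\<exists>b\<in>B. u \<in> b \<and> b \<subseteq> U" using e(2) by blast
  qed
  ultimately show "\<exists>B :: l2 set set. countable B \<and> open = generate_topology B"
    using topological_basis_imp_subbasis by blast
qed


section \<open>Modulated Schroedinger propagator\<close>

definition fourier_cutoff :: "real \<Rightarrow> l2 \<Rightarrow> real \<Rightarrow> complex" where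
  "fourier_cutoff R f \<xi> = (LBINT x:{-R..R}. exp (- (\<i> * of_real (x * \<xi>))) * rep_l2 f x)"

text \<open>
  The Fourier transform on \<open>L\<^sup>2\<close> is the limit in mean of the transforms of the truncations.
  Its existence and its bijectivity (Plancherel) are not proved here, hence the definite descriptions.
\<close>

definition is_fourier :: "l2 \<Rightarrow> l2 \<Rightarrow> bool" where
  "is_fourier f g \<longleftrightarrow>
    ((\<lambda>R. \<integral>\<^sup>+\<xi>. ennreal ((cmod (fourier_cutoff R f \<xi> - rep_l2 g \<xi>))\<^sup>2) \<partial>lborel) \<longlongrightarrow> 0) at_top"

definition fourier :: "l2 \<Rightarrow> l2" where
  "fourier f = (THE g. is_fourier f g)"

definition fourier_multiplier :: "(real \<Rightarrow> complex) \<Rightarrow> l2 \<Rightarrow> l2" where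
  "fourier_multiplier m f =
    (THE g. AE \<xi> in lborel. rep_l2 (fourier g) \<xi> = m \<xi> * rep_l2 (fourier f) \<xi>)"

definition U :: "(real \<Rightarrow> real) \<Rightarrow> real \<Rightarrow> l2 \<Rightarrow> l2" where
  "U w t = fourier_multiplier (\<lambda>\<xi>. exp (- (\<i> * of_real (w t * \<xi>\<^sup>2))))"

definition duhamel :: "(real \<Rightarrow> real) \<Rightarrow> (real \<Rightarrow> l2) \<Rightarrow> real \<Rightarrow> l2" where
  "duhamel w \<psi> t = (LINT s|lebesgue_on {0..t}. U w t (inv (U w s) (\<psi> s)))"


section \<open>Irregularity\<close>

definition Phi :: "(real \<Rightarrow> real) \<Rightarrow> real \<Rightarrow> real \<Rightarrow> complex" where
  "Phi w t a = (LBINT r:{0..t}. exp (\<i> * of_real (a * w r)))"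

definition W_norm :: "real \<Rightarrow> real \<Rightarrow> real \<Rightarrow> (real \<Rightarrow> real) \<Rightarrow> ennreal" where
  "W_norm \<rho> \<gamma> T w =
    (SUP a. SUP (s, t)\<in>{(s, t). 0 \<le> s \<and> s < t \<and> t \<le> T}.
      ennreal ((1 + \<bar>a\<bar>) powr \<rho> * (cmod (Phi w t a - Phi w s a) / \<bar>t - s\<bar> powr \<gamma>)))"

definition irregular :: "real \<Rightarrow> real \<Rightarrow> real \<Rightarrow> (real \<Rightarrow> real) \<Rightarrow> bool" where
  "irregular \<rho> \<gamma> T w \<longleftrightarrow> W_norm \<rho> \<gamma> T w < \<infinity>"


section \<open>Mixed space-time norms\<close>

text \<open>
  The exponent \<open>q\<close> is a term, so \<open>L\<^sup>q\<close> cannot be a type instance and the Bochner space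
  \<open>L\<^sup>p([0,T], L\<^sup>q)\<close> is spelled out for maps into functions: strong measurability
  (almost everywhere limit in \<open>L\<^sup>q\<close> of simple functions) and integrability of
  the \<open>p\<close>-th power of the norm.
\<close>

definition strongly_measurable_Lq :: "real \<Rightarrow> real \<Rightarrow> (real \<Rightarrow> real \<Rightarrow> complex) \<Rightarrow> bool" where
  "strongly_measurable_Lq T q u \<longleftrightarrow>
    (\<exists>\<sigma> :: nat \<Rightarrow> real \<Rightarrow> real \<Rightarrow> complex.
      (\<forall>n. simple_function (lebesgue_on {0..T}) (\<sigma> n) \<and> (\<forall>t\<in>{0..T}. in_Lq q (\<sigma> n t))) \<and>
      (AE t in lebesgue_on {0..T}. in_Lq q (u t) \<and>
        (\<lambda>n. Lq_norm q (\<lambda>x. \<sigma> n t x - u t x)) \<longlonglongrightarrow> 0))"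

definition in_Lp_Lq :: "real \<Rightarrow> real \<Rightarrow> real \<Rightarrow> (real \<Rightarrow> real \<Rightarrow> complex) \<Rightarrow> bool" where
  "in_Lp_Lq T p q u \<longleftrightarrow> strongly_measurable_Lq T q u \<and>
    integrable (lebesgue_on {0..T}) (\<lambda>t. Lq_norm q (u t) powr p)"

definition Lp_Lq_norm :: "real \<Rightarrow> real \<Rightarrow> real \<Rightarrow> (real \<Rightarrow> real \<Rightarrow> complex) \<Rightarrow> real" where
  "Lp_Lq_norm T p q u = (LINT t|lebesgue_on {0..T}. Lq_norm q (u t) powr p) powr (1 / p)"

end

theory Submission
  imports Defs "HOL-Probability.Characteristic_Functions"
begin

text \<open>
  Interpolating with the conservation of the \<open>L\<^sup>2\<close> norm, \<open>\<parallel>u\<parallel>\<^bsub>2p\<^esub>\<^bsup>p\<^esup> \<le> \<parallel>u\<parallel>\<^bsub>\<infinity>\<^esub>\<^bsup>p-1\<^esup> \<parallel>u\<parallel>\<^bsub>2\<^esub>\<close>, so it is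
  enough to bound the spatial supremum of the solution in \<open>L\<^sup>q\<close> in time for some \<open>q \<ge> p - 1\<close>.  By the
  \<open>TT*\<close> argument and the dispersive estimate this reduces to a Hardy--Littlewood--Sobolev inequality on
  \<open>[0,T]\<close> for the kernel \<open>\<bar>w\<^sub>t - w\<^sub>s\<bar> powr (-1/2)\<close>, which holds for \<open>q = 4 \<sigma> > 2\<close> as soon as
  the occupation measure of \<open>w\<close> gives mass at most \<open>A r powr \<sigma>\<close> to intervals of radius \<open>r\<close>.
  Irregularity says that the Fourier transform of this measure decays with exponent \<open>\<rho>\<close>; comparing the
  indicator of an interval with a Gaussian gives the mass bound for every \<open>\<sigma> \<le> 1\<close>, \<open>\<sigma> < \<rho>\<close>.  The choice
  \<open>\<sigma> = min (3/2 - 2/p) 1\<close> satisfies \<open>\<sigma> > 1/2\<close> and \<open>4 \<sigma> \<ge> p - 1\<close> because \<open>2 < p \<le> 5\<close>.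
  As the constant may depend on \<open>T\<close>, the power of \<open>T\<close> in the statement can be taken to be \<open>1\<close>.
\<close>


section \<open>Gaussian integrals\<close>

text \<open>Two features shape the argument: the solution is retarded, and classes in L2 have no
  point values. Retardation is harmless because the data are only L1 in time: after duality, what
  must be bounded uniformly in \<open>s\<close> is the norm of an integral over
  \<open>t \<ge> s\<close>, and cutting at \<open>s\<close> only decreases the nonnegative weight
  that the kernel estimate sees. Point values are replaced by pairings with Gaussian-damped plane
  waves on the Fourier side, taken from a countable family; the dispersive bound for two of them
  depends on \<open>w t - w s\<close> alone, not on positions or damping, so a time-dependent choice
  of test function is as good as a fixed one. The path need not be invertible, so time cannot be
  changed to \<open>w\<close>; the occupation measure acts as a \<sigma>-dimensional measure, and
  \<open>q = 4 * \<sigma>\<close> is the exponent that scaling dictates for the kernel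
  \<open>\<bar>x\<bar> powr (-1/2)\<close> in dimension \<sigma>. Since \<open>fourier\<close>,
  \<open>fourier_multiplier\<close> and \<open>inv (U w s)\<close> are given by descriptions or
  choice, Plancherel and inversion come before any computation with them.\<close>

lemma borel_measurable_cis [measurable (raw)]:
  "f \<in> borel_measurable M \<Longrightarrow> (\<lambda>x. cis (f x)) \<in> borel_measurable M"
  unfolding cis_conv_exp by measurable

text \<open>The characteristic function of the standard normal law, rescaled by
  \<open>c = 1 / sqrt (2 * a)\<close> so that the density becomes
  \<open>exp (- a * x\<^sup>2)\<close> up to a constant.\<close>

lemma gauss_fourier:
  assumes a: "a > 0"
  shows "has_bochner_integral lborel (\<lambda>x. complex_of_real (exp (- a * x\<^sup>2)) * cis (y * x))
    (complex_of_real (sqrt (pi / a) * exp (- y\<^sup>2 / (4 * a))))"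
proof -
  define c where "c = 1 / sqrt (2 * a)"
  have c: "c > 0" "c\<^sup>2 = 1 / (2 * a)" using a by (auto simp: c_def power_divide)
  have i: "integrable lborel (\<lambda>x. std_normal_density x *\<^sub>R iexp (y * c * x))"
  proof (rule Bochner_Integration.integrable_bound)
    show "integrable lborel std_normal_density" using integrable_std_normal_moment[of 0] by simp
  qed (auto simp: normal_density_nonneg)
  have "(LBINT x. std_normal_density x *\<^sub>R iexp (y * c * x)) = char std_normal_distribution (y * c)"
    unfolding char_def by (subst integral_density) (auto simp: normal_density_nonneg)
  also have "\<dots> = complex_of_real (exp (- (y * c)\<^sup>2 / 2))"
    by (simp add: char_std_normal_distribution)
  finally have "has_bochner_integral lborel (\<lambda>x. std_normal_density x *\<^sub>R iexp (y * c * x))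
     (complex_of_real (exp (- (y * c)\<^sup>2 / 2)))"
    using i by (simp add: has_bochner_integral_iff)
  then have h: "has_bochner_integral lborel (\<lambda>x. sqrt (2 * pi) *\<^sub>R (std_normal_density x *\<^sub>R iexp (y * c * x)))
     (sqrt (2 * pi) *\<^sub>R (complex_of_real (exp (- (y * c)\<^sup>2 / 2))))"
    by (rule has_bochner_integral_scaleR_right)
  have e: "sqrt (2 * pi) *\<^sub>R (std_normal_density x *\<^sub>R iexp (y * c * x))
    = complex_of_real (exp (- a * (0 + c * x)\<^sup>2)) * cis (y * (0 + c * x))" for x
    using a by (simp add: std_normal_density_def cis_conv_exp power_mult_distrib c scaleR_conv_of_real field_simps flip: of_real_mult)
  have v: "sqrt (2 * pi) *\<^sub>R (complex_of_real (exp (- (y * c)\<^sup>2 / 2)))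
    = complex_of_real (sqrt (pi / a) * exp (- y\<^sup>2 / (4 * a))) /\<^sub>R \<bar>c\<bar>"
  proof -
    have "sqrt (2 * pi) = sqrt (pi / a) / c"
      using a by (simp add: c_def real_sqrt_mult[symmetric] real_sqrt_divide[symmetric])
    moreover have "(y * c)\<^sup>2 / 2 = y\<^sup>2 / (4 * a)" by (simp add: power_mult_distrib c)
    ultimately show ?thesis using c(1)
      by (simp only: scaleR_conv_of_real abs_of_pos of_real_mult divide_inverse of_real_inverse mult_ac minus_mult_left[symmetric] minus_mult_right[symmetric] minus_divide_left[symmetric])
  qed
  show ?thesis
    using h c unfolding e v
    by (subst lborel_has_bochner_integral_real_affine_iff[where c = c and t = 0]) auto
qed

lemma gauss_integral:
  assumes a: "a > 0"
  shows "has_bochner_integral lborel (\<lambda>x. exp (- a * x\<^sup>2)) (sqrt (pi / a))"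
proof -
  have "has_bochner_integral lborel (\<lambda>x. Re (complex_of_real (exp (- a * x\<^sup>2)) * cis (0 * x)))
    (Re (complex_of_real (sqrt (pi / a) * exp (- 0\<^sup>2 / (4 * a)))))"
    by (rule has_bochner_integral_Re[OF gauss_fourier[OF a]])
  then show ?thesis by simp
qed

text \<open>Justifies Fubini for autocorrelations; for fixed \<open>x\<close>, translation
  invariance removes the shift from the inner integral.\<close>

lemma integrable_prod_shift:
  fixes f g :: "real \<Rightarrow> complex"
  assumes f: "integrable lborel f" and g: "integrable lborel g"
  shows "integrable (lborel \<Otimes>\<^sub>M lborel) (\<lambda>(x, u). f (x + u) * g x)"
proof (rule lborel_pair.Fubini_integrable)
  have [measurable]: "f \<in> borel_measurable borel" "g \<in> borel_measurable borel"
    using f g by auto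
  show "(\<lambda>(x, u). f (x + u) * g x) \<in> borel_measurable (lborel \<Otimes>\<^sub>M lborel)" by measurable
  have "(\<integral>u. norm (f (x + u) * g x) \<partial>lborel) = (\<integral>u. norm (f u) \<partial>lborel) * norm (g x)" for x
  proof -
    have "(\<integral>u. norm (f (x + u)) \<partial>lborel) = (\<integral>u. norm (f u) \<partial>lborel)"
      using lborel_integral_real_affine[of 1 "\<lambda>u. norm (f u)" x] by simp
    then show ?thesis by (simp add: norm_mult)
  qed
  then show "integrable lborel (\<lambda>x. \<integral>u. norm (case (x, u) of (x, u) \<Rightarrow> f (x + u) * g x) \<partial>lborel)"
    using g by simp
  show "AE x in lborel. integrable lborel (\<lambda>u. case (x, u) of (x, u) \<Rightarrow> f (x + u) * g x)"
    using lborel_integrable_real_affine[OF f, of 1] by simp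
qed

lemma integral_shift: "(LBINT x. f (x + u)) = (LBINT x. f x)"
  for f :: "real \<Rightarrow> 'b :: {banach, second_countable_topology}"
  using lborel_integral_real_affine[of 1 f u] by (simp add: add.commute)

lemma gauss_oscillatory_integrable:
  assumes a: "a > 0"
  shows "integrable lborel (\<lambda>x. complex_of_real (exp (- a * x\<^sup>2)) * cis (b * x\<^sup>2 + y * x))"
proof (rule Bochner_Integration.integrable_bound)
  show "integrable lborel (\<lambda>x. exp (- a * x\<^sup>2))"
    using gauss_integral[OF a] by (simp add: has_bochner_integral_iff)
qed (auto simp: norm_mult)

text \<open>The square of the integral is a double integral which factorizes, up to a Gaussian in
  \<open>u\<close>, in the variables \<open>u = \<xi> - \<eta>\<close>, \<open>v = (\<xi> + \<eta>) / 2\<close>, so that no complex Gaussian has to be computed.\<close>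

lemma gauss_oscillatory_bound:
  assumes a: "a > 0" and b: "b \<noteq> 0"
  shows "cmod (LBINT x. complex_of_real (exp (- a * x\<^sup>2)) * cis (b * x\<^sup>2 + y * x)) \<le> sqrt (pi / \<bar>b\<bar>)"
proof -
  define F where "F x = complex_of_real (exp (- a * x\<^sup>2)) * cis (b * x\<^sup>2 + y * x)" for x
  define I where "I = (LBINT x. F x)"
  \<comment> \<open>Decay rate in \<open>u\<close> once \<open>v\<close> is integrated out:
    \<open>a / 2\<close> comes from the two damping factors, \<open>b\<^sup>2 / (2 * a)\<close> from
    the Fourier transform in \<open>v\<close> of a Gaussian at frequency
    \<open>2 * b * u\<close>.\<close>
  define k where "k = a / 2 + b\<^sup>2 / (2 * a)"
  have k: "k > 0" using a b by (simp add: k_def add_pos_nonneg)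
  have iF: "integrable lborel F"
    unfolding F_def by (rule gauss_oscillatory_integrable[OF a])
  have iC: "integrable lborel (\<lambda>x. cnj (F x))" using iF by simp
  have inner: "(LBINT x. F (x + u) * cnj (F x))
      = complex_of_real (sqrt (pi / (2 * a)) * exp (- k * u\<^sup>2)) * cis (y * u)" for u
  proof -
    have "F (v + u / 2) * cnj (F (v - u / 2))
        = complex_of_real (exp (- a * u\<^sup>2 / 2)) * cis (y * u)
          * (complex_of_real (exp (- (2 * a) * v\<^sup>2)) * cis (2 * b * u * v))" for v
    proof -
      have "- a * (v + u / 2)\<^sup>2 + - a * (v - u / 2)\<^sup>2 = - a * u\<^sup>2 / 2 + - (2 * a) * v\<^sup>2"
        by (simp add: power2_eq_square field_simps)
      moreover have "b * (v + u / 2)\<^sup>2 + y * (v + u / 2) - (b * (v - u / 2)\<^sup>2 + y * (v - u / 2))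
         = y * u + 2 * b * u * v" by (simp add: power2_eq_square field_simps)
      ultimately have "exp (- a * (v + u / 2)\<^sup>2) * exp (- a * (v - u / 2)\<^sup>2)
          = exp (- a * u\<^sup>2 / 2) * exp (- (2 * a) * v\<^sup>2)"
        "cis (b * (v + u / 2)\<^sup>2 + y * (v + u / 2)) * cnj (cis (b * (v - u / 2)\<^sup>2 + y * (v - u / 2)))
          = cis (y * u) * cis (2 * b * u * v)"
        by (simp_all only: exp_add[symmetric] cis_cnj cis_mult diff_conv_add_uminus)
      then have "complex_of_real (exp (- a * (v + u / 2)\<^sup>2)) * complex_of_real (exp (- a * (v - u / 2)\<^sup>2))
            * (cis (b * (v + u / 2)\<^sup>2 + y * (v + u / 2)) * cnj (cis (b * (v - u / 2)\<^sup>2 + y * (v - u / 2))))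
          = complex_of_real (exp (- a * u\<^sup>2 / 2)) * complex_of_real (exp (- (2 * a) * v\<^sup>2)) * (cis (y * u) * cis (2 * b * u * v))"
        by (simp only: of_real_mult[symmetric])
      then show ?thesis unfolding F_def
        by (simp only: complex_cnj_mult complex_cnj_complex_of_real mult_ac)
    qed
    then have "(LBINT v. F (v + u / 2) * cnj (F (v - u / 2)))
        = complex_of_real (exp (- a * u\<^sup>2 / 2)) * cis (y * u)
          * (LBINT v. complex_of_real (exp (- (2 * a) * v\<^sup>2)) * cis (2 * b * u * v))"
      by simp
    also have "(LBINT v. complex_of_real (exp (- (2 * a) * v\<^sup>2)) * cis (2 * b * u * v))
        = complex_of_real (sqrt (pi / (2 * a)) * exp (- (2 * b * u)\<^sup>2 / (4 * (2 * a))))"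
      using gauss_fourier[of "2 * a" "2 * b * u"] a by (simp add: has_bochner_integral_iff)
    also have "complex_of_real (exp (- a * u\<^sup>2 / 2)) * cis (y * u) * \<dots>
        = complex_of_real (sqrt (pi / (2 * a)) * (exp (- a * u\<^sup>2 / 2) * exp (- (2 * b * u)\<^sup>2 / (4 * (2 * a))))) * cis (y * u)"
      by simp
    also have "exp (- a * u\<^sup>2 / 2) * exp (- (2 * b * u)\<^sup>2 / (4 * (2 * a))) = exp (- k * u\<^sup>2)"
      using a by (simp add: exp_add[symmetric] k_def power_mult_distrib field_simps power2_eq_square)
    finally show ?thesis
      using integral_shift[of "\<lambda>v. F (v + u / 2) * cnj (F (v - u / 2))" "u / 2"] by (simp add: add.commute)
  qed
  have sq: "complex_of_real ((cmod I)\<^sup>2) = (LBINT u. (LBINT x. F (x + u) * cnj (F x)))"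
  proof -
    have "complex_of_real ((cmod I)\<^sup>2) = I * cnj I" by (rule complex_norm_square)
    also have "\<dots> = (LBINT x. I * cnj (F x))" by (simp add: I_def)
    also have "\<dots> = (LBINT x. (LBINT u. F (x + u) * cnj (F x)))"
    proof (intro Bochner_Integration.integral_cong refl)
      fix x
      have "(LBINT u. F (x + u)) = I"
        using integral_shift[of F x] by (simp add: add.commute I_def)
      then show "I * cnj (F x) = (LBINT u. F (x + u) * cnj (F x))" by simp
    qed
    also have "\<dots> = (LBINT u. (LBINT x. F (x + u) * cnj (F x)))"
      using lborel_pair.Fubini_integral[OF integrable_prod_shift[OF iF iC]] by simp
    finally show ?thesis .
  qed
  have "(cmod I)\<^sup>2 = cmod (complex_of_real ((cmod I)\<^sup>2))" by (simp del: of_real_power)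
  also have "\<dots> \<le> (LBINT u. cmod (complex_of_real (sqrt (pi / (2 * a)) * exp (- k * u\<^sup>2)) * cis (y * u)))"
    unfolding sq inner by (rule integral_norm_bound)
  also have "\<dots> = (LBINT u. sqrt (pi / (2 * a)) * exp (- k * u\<^sup>2))"
    using a by (simp add: norm_mult)
  also have "\<dots> = sqrt (pi / (2 * a)) * sqrt (pi / k)"
    using gauss_integral[OF k] by (simp add: has_bochner_integral_iff)
  \<comment> \<open>Here \<open>2 * a * k = a\<^sup>2 + b\<^sup>2\<close>, so the damping
    \<open>a\<close> can only help and the final bound is uniform in it.\<close>
  also have "\<dots> = sqrt (pi\<^sup>2 / (a\<^sup>2 + b\<^sup>2))"
    using a by (simp add: real_sqrt_mult[symmetric] k_def field_simps power2_eq_square)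
  also have "\<dots> \<le> sqrt (pi\<^sup>2 / b\<^sup>2)"
    using b by (intro real_sqrt_le_mono divide_left_mono) (auto intro!: mult_pos_pos add_nonneg_pos)
  also have "\<dots> = pi / \<bar>b\<bar>" by (simp add: real_sqrt_divide)
  finally have "cmod I \<le> sqrt (pi / \<bar>b\<bar>)" by (rule real_le_rsqrt)
  then show ?thesis by (simp add: I_def F_def)
qed


section \<open>Fractional integration along a path\<close>

text \<open>Dyadic summation. The layers \<open>B i\<close> may overlap: wherever \<open>f\<close>
  is nonzero one of them already controls it, and the sum over all layers is only larger. Height
  times mass decays geometrically, which fixes the constant.\<close>

lemma nn_integral_le_geometric:
  assumes B: "\<And>i::nat. B i \<in> sets M" "\<And>i. emeasure M (B i) \<le> ennreal (m i)"
    and nn: "\<And>i. 0 \<le> c i" "\<And>i. 0 \<le> m i"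
    and le: "\<And>s. s \<in> space M \<Longrightarrow> f s \<noteq> 0 \<Longrightarrow> \<exists>i. s \<in> B i \<and> f s \<le> ennreal (c i)"
    and geo: "\<And>i. c i * m i = D * \<theta> ^ i" "0 \<le> \<theta>" "\<theta> < 1"
  shows "(\<integral>\<^sup>+s. f s \<partial>M) \<le> ennreal (D / (1 - \<theta>))"
proof -
  have D: "0 \<le> D" using geo(1)[of 0] nn[of 0] by (metis mult_nonneg_nonneg mult.right_neutral power_0)
  have "(\<integral>\<^sup>+s. f s \<partial>M) \<le> (\<integral>\<^sup>+s. (\<Sum>i. ennreal (c i) * indicator (B i) s) \<partial>M)"
  proof (rule nn_integral_mono)
    fix s assume s: "s \<in> space M"
    show "f s \<le> (\<Sum>i. ennreal (c i) * indicator (B i) s)"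
    proof (cases "f s = 0")
      case False
      from le[OF s this] obtain i where i: "s \<in> B i" "f s \<le> ennreal (c i)" by blast
      have "f s \<le> (\<Sum>i\<in>{i}. ennreal (c i) * indicator (B i) s)" using i by simp
      also have "\<dots> \<le> (\<Sum>i. ennreal (c i) * indicator (B i) s)"
        by (rule sum_le_suminf) auto
      finally show ?thesis .
    qed simp
  qed
  also have "\<dots> = (\<Sum>i. ennreal (c i) * emeasure M (B i))"
    using B(1) by (subst nn_integral_suminf) (auto intro!: suminf_cong nn_integral_cmult_indicator)
  also have "\<dots> \<le> (\<Sum>i. ennreal (D * \<theta> ^ i))"
  proof (rule suminf_le)
    fix i
    have "ennreal (c i) * emeasure M (B i) \<le> ennreal (c i) * ennreal (m i)"
      by (intro mult_left_mono B) auto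
    then show "ennreal (c i) * emeasure M (B i) \<le> ennreal (D * \<theta> ^ i)"
      using nn by (simp add: ennreal_mult[symmetric] geo(1))
  qed auto
  also have "\<dots> = ennreal (D * (1 / (1 - \<theta>)))"
    using D geo by (intro suminf_ennreal_eq sums_mult geometric_sums) auto
  finally show ?thesis by simp
qed

text \<open>The ball is cut into shells where \<open>d s\<close> lies between
  \<open>r / 2 ^ Suc i\<close> and \<open>r / 2 ^ i\<close>. From one shell to the next the
  singularity grows by \<open>2 powr \<alpha>\<close> and the mass bound shrinks by
  \<open>2 powr - \<sigma>\<close>.\<close>

lemma nn_integral_powr_near:
  assumes d: "d \<in> borel_measurable M" "\<And>s. 0 \<le> d s"
    and ball: "\<And>r. r > 0 \<Longrightarrow> emeasure M {s\<in>space M. d s < r} \<le> ennreal (A * r powr \<sigma>)"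
    and A: "A \<ge> 0" and \<alpha>: "0 < \<alpha>" "\<alpha> < \<sigma>" and r: "r > 0"
  shows "(\<integral>\<^sup>+s. ennreal (if d s < r then d s powr - \<alpha> else 0) \<partial>M)
    \<le> ennreal (A * 2 powr \<alpha> / (1 - 2 powr (\<alpha> - \<sigma>)) * r powr (\<sigma> - \<alpha>))"
proof -
  have "(\<integral>\<^sup>+s. ennreal (if d s < r then d s powr - \<alpha> else 0) \<partial>M)
    \<le> ennreal ((A * 2 powr \<alpha> * r powr (\<sigma> - \<alpha>)) / (1 - 2 powr (\<alpha> - \<sigma>)))"
  proof (rule nn_integral_le_geometric[where B = "\<lambda>i. {s\<in>space M. d s < r / 2 ^ i}"
        and m = "\<lambda>i. A * (r / 2 ^ i) powr \<sigma>" and c = "\<lambda>i. (r / 2 ^ Suc i) powr - \<alpha>"])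
    fix s assume "s \<in> space M" and "ennreal (if d s < r then d s powr - \<alpha> else 0) \<noteq> 0"
    \<comment> \<open>Points with \<open>d s = 0\<close> drop out because
      \<open>0 powr x = 0\<close>.\<close>
    then have s: "s \<in> space M" "d s < r" "d s > 0"
      using d(2)[of s] by (auto split: if_splits simp: less_le)
    define i where "i = (LEAST i. r / 2 ^ Suc i \<le> d s)"
    have "\<exists>i. r / 2 ^ Suc i \<le> d s"
    proof -
      obtain n where "(1/2) ^ n < d s / r" using real_arch_pow_inv[of "d s / r" "1/2"] s r by auto
      then have "r / 2 ^ n < d s" using r by (simp add: field_simps)
      moreover have "r / 2 ^ Suc n \<le> r / 2 ^ n" using r by (simp add: field_simps)
      ultimately show ?thesis by (intro exI[of _ n]) linarith
    qed
    then have i: "r / 2 ^ Suc i \<le> d s" unfolding i_def by (rule LeastI_ex)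
    have i2: "d s < r / 2 ^ i"
    proof (cases i)
      case (Suc j)
      then have "\<not> r / 2 ^ Suc j \<le> d s" using not_less_Least[of j "\<lambda>i. r / 2 ^ Suc i \<le> d s"] by (simp add: i_def)
      then show ?thesis using Suc by simp
    qed (use s in simp)
    have "d s powr - \<alpha> \<le> (r / 2 ^ Suc i) powr - \<alpha>"
      using i r \<alpha> by (intro powr_mono2') auto
    then show "\<exists>i. s \<in> {s \<in> space M. d s < r / 2 ^ i} \<and>
        ennreal (if d s < r then d s powr - \<alpha> else 0) \<le> ennreal ((r / 2 ^ Suc i) powr - \<alpha>)"
      using s i2 by (intro exI[of _ i]) (auto intro: ennreal_leI)
  next
    fix i
    have 1: "(r / 2 ^ Suc i) powr - \<alpha> = r powr - \<alpha> * (2 powr \<alpha> * (2 ^ i) powr \<alpha>)"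
      using r by (simp add: powr_divide powr_mult powr_minus field_simps)
    have 2: "(r / 2 ^ i) powr \<sigma> = r powr \<sigma> * (2 ^ i) powr - \<sigma>"
      using r by (simp add: powr_divide powr_minus field_simps)
    have 3: "((2::real) ^ i) powr \<alpha> * (2 ^ i) powr - \<sigma> = (2 powr (\<alpha> - \<sigma>)) ^ i"
      by (simp add: powr_add[symmetric] powr_realpow[symmetric] powr_powr algebra_simps)
    have 4: "r powr \<sigma> * r powr - \<alpha> = r powr (\<sigma> - \<alpha>)" by (simp add: powr_add[symmetric])
    have "(r / 2 ^ Suc i) powr - \<alpha> * (A * (r / 2 ^ i) powr \<sigma>)
        = A * 2 powr \<alpha> * (r powr \<sigma> * r powr - \<alpha>) * ((2 ^ i) powr \<alpha> * (2 ^ i) powr - \<sigma>)"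
      by (simp only: 1 2 mult_ac)
    then show "(r / 2 ^ Suc i) powr - \<alpha> * (A * (r / 2 ^ i) powr \<sigma>)
        = A * 2 powr \<alpha> * r powr (\<sigma> - \<alpha>) * (2 powr (\<alpha> - \<sigma>)) ^ i"
      by (simp only: 3 4)
  next
    show "2 powr (\<alpha> - \<sigma>) < 1" using \<alpha> by (intro powr_less_one) auto
  qed (use d r A ball in auto)
  then show ?thesis by (simp add: field_simps)
qed

text \<open>The same shells run outwards: the mass bound now grows, by
  \<open>2 powr \<sigma>\<close> per doubling, and the faster decay with exponent \<beta>
  wins.\<close>

lemma nn_integral_powr_far:
  assumes d: "d \<in> borel_measurable M" "\<And>s. 0 \<le> d s"
    and ball: "\<And>r. r > 0 \<Longrightarrow> emeasure M {s\<in>space M. d s < r} \<le> ennreal (A * r powr \<sigma>)"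
    and A: "A \<ge> 0" and \<beta>: "0 < \<sigma>" "\<sigma> < \<beta>" and r: "r > 0"
  shows "(\<integral>\<^sup>+s. ennreal (if r \<le> d s then d s powr - \<beta> else 0) \<partial>M)
    \<le> ennreal (A * 2 powr \<sigma> / (1 - 2 powr (\<sigma> - \<beta>)) * r powr (\<sigma> - \<beta>))"
proof -
  have "(\<integral>\<^sup>+s. ennreal (if r \<le> d s then d s powr - \<beta> else 0) \<partial>M)
    \<le> ennreal ((A * 2 powr \<sigma> * r powr (\<sigma> - \<beta>)) / (1 - 2 powr (\<sigma> - \<beta>)))"
  proof (rule nn_integral_le_geometric[where B = "\<lambda>i. {s\<in>space M. d s < r * 2 ^ Suc i}"
        and m = "\<lambda>i. A * (r * 2 ^ Suc i) powr \<sigma>" and c = "\<lambda>i. (r * 2 ^ i) powr - \<beta>"])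
    fix s assume "s \<in> space M" and "ennreal (if r \<le> d s then d s powr - \<beta> else 0) \<noteq> 0"
    then have s: "s \<in> space M" "r \<le> d s"
      by (auto split: if_splits)
    define i where "i = (LEAST i. d s < r * 2 ^ Suc i)"
    have "\<exists>i. d s < r * 2 ^ Suc i"
    proof -
      obtain n where "d s / r < 2 ^ n" using real_arch_pow[of 2 "d s / r"] by auto
      then have "d s < r * 2 ^ n" using r by (simp add: field_simps)
      moreover have "r * 2 ^ n \<le> r * 2 ^ Suc n" using r by simp
      ultimately show ?thesis by (intro exI[of _ n]) linarith
    qed
    then have i: "d s < r * 2 ^ Suc i" unfolding i_def by (rule LeastI_ex)
    have i2: "r * 2 ^ i \<le> d s"
    proof (cases i)
      case (Suc j)
      then have "\<not> d s < r * 2 ^ Suc j" using not_less_Least[of j "\<lambda>i. d s < r * 2 ^ Suc i"] by (simp add: i_def)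
      then show ?thesis using Suc by simp
    qed (use s in simp)
    have "d s powr - \<beta> \<le> (r * 2 ^ i) powr - \<beta>"
      using i2 r \<beta> by (intro powr_mono2') auto
    then show "\<exists>i. s \<in> {s \<in> space M. d s < r * 2 ^ Suc i} \<and>
        ennreal (if r \<le> d s then d s powr - \<beta> else 0) \<le> ennreal ((r * 2 ^ i) powr - \<beta>)"
      using s i by (intro exI[of _ i]) (auto intro: ennreal_leI)
  next
    fix i
    have 1: "(r * 2 ^ Suc i) powr \<sigma> = r powr \<sigma> * (2 powr \<sigma> * (2 ^ i) powr \<sigma>)"
      using r by (simp add: powr_mult)
    have 2: "(r * 2 ^ i) powr - \<beta> = r powr - \<beta> * (2 ^ i) powr - \<beta>"
      using r by (simp add: powr_mult)
    have 3: "((2::real) ^ i) powr \<sigma> * (2 ^ i) powr - \<beta> = (2 powr (\<sigma> - \<beta>)) ^ i"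
      by (simp add: powr_add[symmetric] powr_realpow[symmetric] powr_powr algebra_simps)
    have 4: "r powr \<sigma> * r powr - \<beta> = r powr (\<sigma> - \<beta>)" by (simp add: powr_add[symmetric])
    have "(r * 2 ^ i) powr - \<beta> * (A * (r * 2 ^ Suc i) powr \<sigma>)
        = A * 2 powr \<sigma> * (r powr \<sigma> * r powr - \<beta>) * ((2 ^ i) powr \<sigma> * (2 ^ i) powr - \<beta>)"
      by (simp only: 1 2 mult_ac)
    then show "(r * 2 ^ i) powr - \<beta> * (A * (r * 2 ^ Suc i) powr \<sigma>)
        = A * 2 powr \<sigma> * r powr (\<sigma> - \<beta>) * (2 powr (\<sigma> - \<beta>)) ^ i"
      by (simp only: 3 4)
  next
    show "2 powr (\<sigma> - \<beta>) < 1" using \<beta> by (intro powr_less_one) auto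
  qed (use d r A ball in auto)
  then show ?thesis by (simp add: field_simps)
qed

text \<open>Inner integral of the fractional integration form, restricted to \<open>h s \<le> h t\<close>: near the
  singularity \<open>h s\<close> is replaced by \<open>h t = H\<close>, away from it Young's inequality is used; the radius
  \<open>H powr (-4/(q-1))\<close> and the weight \<open>H powr (-1/q)\<close> balance both contributions.\<close>

lemma fractional_integral_inner:
  fixes h d :: "'a \<Rightarrow> real"
  assumes [measurable]: "d \<in> borel_measurable M" "h \<in> borel_measurable M"
    and d: "\<And>s. 0 \<le> d s"
    and ball: "\<And>r. r > 0 \<Longrightarrow> emeasure M {s\<in>space M. d s < r} \<le> ennreal (A * r powr \<sigma>)"
    and A: "A \<ge> 0" and \<sigma>: "1/2 < \<sigma>" and q: "q = 4 * \<sigma>" "q' = q / (q - 1)"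
    and h: "\<And>s. 0 \<le> h s" "(\<integral>\<^sup>+s. ennreal (h s powr q') \<partial>M) \<le> 1" and H: "H > 0"
  shows "(\<integral>\<^sup>+s. ennreal (if h s \<le> H then d s powr - (1/2) * h s else 0) \<partial>M)
    \<le> ennreal ((A * 2 powr (1/2) / (1 - 2 powr (1/2 - \<sigma>)) + A * 2 powr \<sigma> / (1 - 2 powr - \<sigma>) + 1)
        * H powr (1 / (q - 1)))"
proof -
  define r where "r = H powr - (4 / (q - 1))"
  define \<mu> where "\<mu> = H powr - (1 / q)"
  have q2: "q > 2" using \<sigma> q(1) by simp
  then have q1: "q > 2" "q' > 1" "1 / q + 1 / q' = 1"
    unfolding q(2) by (simp_all add: divide_simps)
  have r: "r > 0" and l: "\<mu> > 0" using H by (auto simp: r_def \<mu>_def)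
  let ?C1 = "A * 2 powr (1/2) / (1 - 2 powr (1/2 - \<sigma>))"
  let ?C2 = "A * 2 powr \<sigma> / (1 - 2 powr - \<sigma>)"
  have c: "?C1 \<ge> 0" "?C2 \<ge> 0"
    using A \<sigma> by (auto intro!: divide_nonneg_nonneg mult_nonneg_nonneg less_imp_le[OF powr_less_one])
  have pt: "(if h s \<le> H then d s powr - (1/2) * h s else 0)
     \<le> H * (if d s < r then d s powr - (1/2) else 0)
       + (\<mu> powr q * (if r \<le> d s then d s powr - (2 * \<sigma>) else 0) + \<mu> powr - q' * h s powr q')" for s
  proof -
    have nn: "0 \<le> H * (if d s < r then d s powr - (1/2) else 0)"
       "0 \<le> \<mu> powr q * (if r \<le> d s then d s powr - (2 * \<sigma>) else 0)"
       "0 \<le> \<mu> powr - q' * h s powr q'" using H by auto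
    consider "\<not> h s \<le> H" | "h s \<le> H" "d s < r" | "h s \<le> H" "r \<le> d s" by linarith
    then show ?thesis
    proof cases
      case 1 then show ?thesis using nn by auto
    next
      case 2
      then have "d s powr - (1/2) * h s \<le> H * d s powr - (1/2)"
        by (simp add: mult.commute mult_right_mono)
      then have "d s powr - (1/2) * h s \<le> H * d s powr - (1/2) + \<mu> powr - q' * h s powr q'"
        using nn(3) by linarith
      then show ?thesis using 2 by simp
    next
      case 3
      have ds: "d s > 0" using 3 r by linarith
      \<comment> \<open>The weight \<open>\<mu>\<close> distributes the product before Young's
        inequality. The power \<open>q = 4 * \<sigma>\<close> turns the kernel into
        \<open>d s powr - (2 * \<sigma>)\<close>, which decays faster than balls grow.\<close>
      have "d s powr - (1/2) * h s = (\<mu> * d s powr - (1/2)) * (h s / \<mu>)" using l by simp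
      also have "\<dots> \<le> (\<mu> * d s powr - (1/2)) powr q / q + (h s / \<mu>) powr q' / q'"
        using q1 h l by (intro Youngs_inequality) auto
      also have "\<dots> \<le> (\<mu> * d s powr - (1/2)) powr q + (h s / \<mu>) powr q'"
      proof -
        have "x / b \<le> x" if "0 \<le> x" "1 \<le> b" for x b :: real
          using that mult_left_mono[of 1 b x] by (simp add: divide_le_eq)
        then show ?thesis using q1 by (intro add_mono) auto
      qed
      also have "\<dots> = \<mu> powr q * d s powr - (2 * \<sigma>) + \<mu> powr - q' * h s powr q'"
      proof -
        have "(\<mu> * d s powr - (1/2)) powr q = \<mu> powr q * d s powr (- (1/2) * q)"
          using ds l by (simp add: powr_mult powr_powr)
        moreover have "(h s / \<mu>) powr q' = \<mu> powr - q' * h s powr q'"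
          using l h(1)[of s] by (simp add: powr_divide powr_minus_divide)
        moreover have "- (1/2) * q = - (2 * \<sigma>)" using q(1) by simp
        ultimately show ?thesis by simp
      qed
      finally show ?thesis using 3 nn by auto
    qed
  qed
  have "(\<integral>\<^sup>+s. ennreal (if h s \<le> H then d s powr - (1/2) * h s else 0) \<partial>M)
    \<le> (\<integral>\<^sup>+s. ennreal H * ennreal (if d s < r then d s powr - (1/2) else 0)
       + (ennreal (\<mu> powr q) * ennreal (if r \<le> d s then d s powr - (2 * \<sigma>) else 0)
       + ennreal (\<mu> powr - q') * ennreal (h s powr q')) \<partial>M)"
    using H by (intro nn_integral_mono order_trans[OF ennreal_leI[OF pt]])
      (auto simp: ennreal_plus ennreal_mult)
  also have "\<dots> = ennreal H * (\<integral>\<^sup>+s. ennreal (if d s < r then d s powr - (1/2) else 0) \<partial>M)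
       + (ennreal (\<mu> powr q) * (\<integral>\<^sup>+s. ennreal (if r \<le> d s then d s powr - (2 * \<sigma>) else 0) \<partial>M)
       + ennreal (\<mu> powr - q') * (\<integral>\<^sup>+s. ennreal (h s powr q') \<partial>M))"
    by (simp add: nn_integral_add nn_integral_cmult)
  also have "\<dots> \<le> ennreal H * ennreal (?C1 * r powr (\<sigma> - 1/2))
       + (ennreal (\<mu> powr q) * ennreal (?C2 * r powr - \<sigma>) + ennreal (\<mu> powr - q') * 1)"
  proof (intro add_mono mult_left_mono h(2))
    show "(\<integral>\<^sup>+s. ennreal (if d s < r then d s powr - (1/2) else 0) \<partial>M) \<le> ennreal (?C1 * r powr (\<sigma> - 1/2))"
      by (rule nn_integral_powr_near[OF _ d ball A]) (use \<sigma> r in auto)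
    show "(\<integral>\<^sup>+s. ennreal (if r \<le> d s then d s powr - (2 * \<sigma>) else 0) \<partial>M) \<le> ennreal (?C2 * r powr - \<sigma>)"
      using nn_integral_powr_far[OF _ d ball A, of "2 * \<sigma>" r] \<sigma> r by simp
  qed auto
  also have "\<dots> = ennreal (H * (?C1 * r powr (\<sigma> - 1/2)) + (\<mu> powr q * (?C2 * r powr - \<sigma>) + \<mu> powr - q'))"
  proof -
    have "ennreal a * ennreal b + (ennreal c * ennreal d + ennreal e * 1) = ennreal (a * b + (c * d + e))"
      if "0 \<le> a" "0 \<le> b" "0 \<le> c" "0 \<le> d" "0 \<le> e" for a b c d e
      using that by (simp add: ennreal_mult ennreal_plus)
    then show ?thesis using c H by (simp only: mult_nonneg_nonneg powr_ge_zero less_imp_le)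
  qed
  also have "H * (?C1 * r powr (\<sigma> - 1/2)) + (\<mu> powr q * (?C2 * r powr - \<sigma>) + \<mu> powr - q')
      = (?C1 + ?C2 + 1) * H powr (1 / (q - 1))"
  proof -
    have "H * r powr (\<sigma> - 1/2) = H powr (1 / (q - 1))"
    proof -
      have "H * r powr (\<sigma> - 1/2) = H powr 1 * H powr (- (4 / (q - 1)) * (\<sigma> - 1/2))"
        using H by (simp add: r_def powr_powr)
      also have "\<dots> = H powr (1 + - (4 / (q - 1)) * (\<sigma> - 1/2))" by (simp only: powr_add)
      also have "1 + - (4 / (q - 1)) * (\<sigma> - 1/2) = 1 / (q - 1)"
        using q1 q(1) by (simp add: field_simps)
      finally show ?thesis .
    qed
    moreover have "\<mu> powr q * r powr - \<sigma> = H powr (1 / (q - 1))"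
    proof -
      have "\<mu> powr q * r powr - \<sigma> = H powr (- (1 / q) * q) * H powr (- (4 / (q - 1)) * - \<sigma>)"
        by (simp only: r_def \<mu>_def powr_powr)
      also have "\<dots> = H powr (- (1 / q) * q + - (4 / (q - 1)) * - \<sigma>)" by (simp only: powr_add)
      also have "- (1 / q) * q + - (4 / (q - 1)) * - \<sigma> = 1 / (q - 1)"
        using q1 q(1) by (simp add: field_simps)
      finally show ?thesis .
    qed
    moreover have "\<mu> powr - q' = H powr (1 / (q - 1))"
      using q1 by (simp add: \<mu>_def powr_powr q(2))
    moreover have "H * (a * x) + (y * (b * z) + u) = a * (H * x) + b * (y * z) + u" for a b x y z u :: real
      by (simp add: algebra_simps)
    ultimately show ?thesis by (simp only: distrib_right mult_1)
  qed
  finally show ?thesis .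
qed

text \<open>The diagonal case of the Hardy--Littlewood--Sobolev inequality, for the image measure of \<open>w\<close>.\<close>

proposition fractional_integral_form:
  fixes w :: "'a \<Rightarrow> real"
  assumes M: "sigma_finite_measure M" and w [measurable]: "w \<in> borel_measurable M"
    and ball: "\<And>x r. r > 0 \<Longrightarrow> emeasure M {s\<in>space M. \<bar>x - w s\<bar> < r} \<le> ennreal (A * r powr \<sigma>)"
    and A: "A \<ge> 0" and \<sigma>: "1/2 < \<sigma>" and q: "q = 4 * \<sigma>" "q' = q / (q - 1)"
  shows "\<exists>C>0. \<forall>h Y. h \<in> borel_measurable M \<longrightarrow> (\<forall>s. 0 \<le> h s) \<longrightarrow> 0 < Y \<longrightarrow>
    (\<integral>\<^sup>+s. ennreal (h s powr q') \<partial>M) \<le> ennreal (Y powr q') \<longrightarrow>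
    (\<integral>\<^sup>+t. \<integral>\<^sup>+s. ennreal (\<bar>w t - w s\<bar> powr - (1/2) * h t * h s) \<partial>M \<partial>M) \<le> ennreal (C * Y\<^sup>2)"
proof -
  interpret sigma_finite_measure M by (rule M)
  interpret pair_sigma_finite M M ..
  define C where "C = A * 2 powr (1/2) / (1 - 2 powr (1/2 - \<sigma>)) + A * 2 powr \<sigma> / (1 - 2 powr - \<sigma>) + 1"
  have "A * 2 powr (1/2) / (1 - 2 powr (1/2 - \<sigma>)) \<ge> 0" "A * 2 powr \<sigma> / (1 - 2 powr - \<sigma>) \<ge> 0"
    using A \<sigma> by (auto intro!: divide_nonneg_nonneg mult_nonneg_nonneg less_imp_le[OF powr_less_one])
  then have C: "C > 0" unfolding C_def by linarith
  have q2: "q > 2" using \<sigma> q(1) by simp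
  then have q1: "q > 2" "q' > 1" unfolding q(2) by (simp_all add: divide_simps)
  have unit: "(\<integral>\<^sup>+t. \<integral>\<^sup>+s. ennreal (\<bar>w t - w s\<bar> powr - (1/2) * h t * h s) \<partial>M \<partial>M) \<le> ennreal (2 * C)"
    if [measurable]: "h \<in> borel_measurable M" and h: "\<And>s. 0 \<le> h s"
      "(\<integral>\<^sup>+s. ennreal (h s powr q') \<partial>M) \<le> 1" for h
  proof -
    \<comment> \<open>Each pair of times is charged to the one with the larger value of
      \<open>h\<close>, so that the inner estimate applies with \<open>H = h t\<close>; ties are
      counted twice, which is harmless for an upper bound.\<close>
    define k where "k t s = (if h s \<le> h t then \<bar>w t - w s\<bar> powr - (1/2) * h t * h s else 0)" for t s
    have [measurable]: "(\<lambda>(t, s). k t s) \<in> borel_measurable (M \<Otimes>\<^sub>M M)" unfolding k_def by measurable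
    have k0: "0 \<le> k t s" for t s using h by (auto simp: k_def)
    have "ennreal (\<bar>w t - w s\<bar> powr - (1/2) * h t * h s) \<le> ennreal (k t s) + ennreal (k s t)" for t s
    proof -
      have "\<bar>w t - w s\<bar> powr - (1/2) * h t * h s \<le> k t s + k s t"
        using h by (auto simp: k_def abs_minus_commute mult_ac)
      then show ?thesis using k0 by (simp add: ennreal_plus[symmetric] ennreal_leI del: ennreal_plus)
    qed
    then have "(\<integral>\<^sup>+t. \<integral>\<^sup>+s. ennreal (\<bar>w t - w s\<bar> powr - (1/2) * h t * h s) \<partial>M \<partial>M)
       \<le> (\<integral>\<^sup>+t. \<integral>\<^sup>+s. ennreal (k t s) + ennreal (k s t) \<partial>M \<partial>M)"
      by (intro nn_integral_mono) auto
    also have "\<dots> = (\<integral>\<^sup>+t. \<integral>\<^sup>+s. ennreal (k t s) \<partial>M \<partial>M) + (\<integral>\<^sup>+t. \<integral>\<^sup>+s. ennreal (k s t) \<partial>M \<partial>M)"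
    proof -
      have "(\<integral>\<^sup>+s. ennreal (k t s) + ennreal (k s t) \<partial>M) = (\<integral>\<^sup>+s. ennreal (k t s) \<partial>M) + (\<integral>\<^sup>+s. ennreal (k s t) \<partial>M)"
        if "t \<in> space M" for t
      proof (rule nn_integral_add)
        show "(\<lambda>s. ennreal (k t s)) \<in> borel_measurable M" "(\<lambda>s. ennreal (k s t)) \<in> borel_measurable M"
          unfolding k_def using that by measurable
      qed
      then have "(\<integral>\<^sup>+t. \<integral>\<^sup>+s. ennreal (k t s) + ennreal (k s t) \<partial>M \<partial>M)
          = (\<integral>\<^sup>+t. (\<integral>\<^sup>+s. ennreal (k t s) \<partial>M) + (\<integral>\<^sup>+s. ennreal (k s t) \<partial>M) \<partial>M)"
        by (intro nn_integral_cong) auto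
      also have "\<dots> = (\<integral>\<^sup>+t. \<integral>\<^sup>+s. ennreal (k t s) \<partial>M \<partial>M) + (\<integral>\<^sup>+t. \<integral>\<^sup>+s. ennreal (k s t) \<partial>M \<partial>M)"
        by (rule nn_integral_add) measurable
      finally show ?thesis .
    qed
    also have "(\<integral>\<^sup>+t. \<integral>\<^sup>+s. ennreal (k s t) \<partial>M \<partial>M) = (\<integral>\<^sup>+t. \<integral>\<^sup>+s. ennreal (k t s) \<partial>M \<partial>M)"
      by (rule Fubini'[of "\<lambda>s t. ennreal (k s t)"]) measurable
    finally have two: "(\<integral>\<^sup>+t. \<integral>\<^sup>+s. ennreal (\<bar>w t - w s\<bar> powr - (1/2) * h t * h s) \<partial>M \<partial>M)
      \<le> (\<integral>\<^sup>+t. \<integral>\<^sup>+s. ennreal (k t s) \<partial>M \<partial>M) + (\<integral>\<^sup>+t. \<integral>\<^sup>+s. ennreal (k t s) \<partial>M \<partial>M)" .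
    have "(\<integral>\<^sup>+t. \<integral>\<^sup>+s. ennreal (k t s) \<partial>M \<partial>M) \<le> (\<integral>\<^sup>+t. ennreal C * ennreal (h t powr q') \<partial>M)"
    proof (rule nn_integral_mono)
      fix t assume t: "t \<in> space M"
      show "(\<integral>\<^sup>+s. ennreal (k t s) \<partial>M) \<le> ennreal C * ennreal (h t powr q')"
      proof (cases "h t = 0")
        case True
        then have "k t s = 0" for s by (auto simp: k_def)
        then show ?thesis by simp
      next
        case False
        then have ht: "h t > 0" using h(1)[of t] by simp
        have "(\<integral>\<^sup>+s. ennreal (k t s) \<partial>M) = (\<integral>\<^sup>+s. ennreal (h t) * ennreal (if h s \<le> h t then \<bar>w t - w s\<bar> powr - (1/2) * h s else 0) \<partial>M)"
          using ht by (intro nn_integral_cong) (auto simp: k_def ennreal_mult'[symmetric] mult_ac)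
        also have "\<dots> = ennreal (h t) * (\<integral>\<^sup>+s. ennreal (if h s \<le> h t then \<bar>w t - w s\<bar> powr - (1/2) * h s else 0) \<partial>M)"
          by (rule nn_integral_cmult) measurable
        also have "\<dots> \<le> ennreal (h t) * ennreal (C * h t powr (1 / (q - 1)))"
          unfolding C_def
          by (intro mult_left_mono fractional_integral_inner[OF _ _ _ ball A \<sigma> q h ht]) auto
        also have "\<dots> = ennreal (C * (h t * h t powr (1 / (q - 1))))"
          using ht by (simp add: ennreal_mult'[symmetric] mult_ac)
        \<comment> \<open>The exponent \<open>1 / (q - 1)\<close> of the inner estimate is exactly
          what turns the outer integrand into \<open>h t powr q'\<close>, the normalised
          quantity.\<close>
        also have "h t * h t powr (1 / (q - 1)) = h t powr (1 + 1 / (q - 1))"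
          using ht by (simp add: powr_add)
        also have "1 + 1 / (q - 1) = q'" using q1 by (simp add: q(2) field_simps)
        finally show ?thesis using C by (simp add: ennreal_mult')
      qed
    qed
    also have "\<dots> = ennreal C * (\<integral>\<^sup>+t. ennreal (h t powr q') \<partial>M)" by (rule nn_integral_cmult) measurable
    also have "\<dots> \<le> ennreal C * 1" by (intro mult_left_mono h) auto
    finally have half: "(\<integral>\<^sup>+t. \<integral>\<^sup>+s. ennreal (k t s) \<partial>M \<partial>M) \<le> ennreal C" by simp
    have "ennreal C + ennreal C = ennreal (2 * C)"
      using C by (subst ennreal_plus[symmetric]) auto
    then show ?thesis using order_trans[OF two add_mono[OF half half]] by simp
  qed
  show ?thesis
  proof (intro exI[of _ "2 * C"] conjI allI impI)
    show "0 < 2 * C" using C by simp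
    fix h and Y :: real
    assume [measurable]: "h \<in> borel_measurable M" and h: "\<forall>s. 0 \<le> h s" and Y: "0 < Y"
      and le: "(\<integral>\<^sup>+s. ennreal (h s powr q') \<partial>M) \<le> ennreal (Y powr q')"
    have 1: "(\<integral>\<^sup>+t. \<integral>\<^sup>+s. ennreal (\<bar>w t - w s\<bar> powr - (1/2) * (h t / Y) * (h s / Y)) \<partial>M \<partial>M) \<le> ennreal (2 * C)"
    proof (rule unit)
      have "(\<integral>\<^sup>+s. ennreal ((h s / Y) powr q') \<partial>M) = (\<integral>\<^sup>+s. ennreal (Y powr - q') * ennreal (h s powr q') \<partial>M)"
        using h Y by (intro nn_integral_cong) (auto simp: powr_divide powr_minus_divide ennreal_mult'[symmetric])
      also have "\<dots> = ennreal (Y powr - q') * (\<integral>\<^sup>+s. ennreal (h s powr q') \<partial>M)"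
        by (rule nn_integral_cmult) measurable
      also have "\<dots> \<le> ennreal (Y powr - q') * ennreal (Y powr q')" by (intro mult_left_mono le) auto
      also have "\<dots> = 1" using Y by (simp add: ennreal_mult'[symmetric] powr_add[symmetric])
      finally show "(\<integral>\<^sup>+s. ennreal ((h s / Y) powr q') \<partial>M) \<le> 1" .
    qed (use h Y in auto)
    have "(\<integral>\<^sup>+t. \<integral>\<^sup>+s. ennreal (\<bar>w t - w s\<bar> powr - (1/2) * h t * h s) \<partial>M \<partial>M)
       = (\<integral>\<^sup>+t. \<integral>\<^sup>+s. ennreal (Y\<^sup>2) * ennreal (\<bar>w t - w s\<bar> powr - (1/2) * (h t / Y) * (h s / Y)) \<partial>M \<partial>M)"
      using Y by (intro nn_integral_cong) (auto simp: ennreal_mult'[symmetric] power2_eq_square)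
    also have "\<dots> = ennreal (Y\<^sup>2) * (\<integral>\<^sup>+t. \<integral>\<^sup>+s. ennreal (\<bar>w t - w s\<bar> powr - (1/2) * (h t / Y) * (h s / Y)) \<partial>M \<partial>M)"
      by (simp add: nn_integral_cmult)
    also have "\<dots> \<le> ennreal (Y\<^sup>2) * ennreal (2 * C)" by (intro mult_left_mono 1) auto
    finally show "(\<integral>\<^sup>+t. \<integral>\<^sup>+s. ennreal (\<bar>w t - w s\<bar> powr - (1/2) * h t * h s) \<partial>M \<partial>M) \<le> ennreal (2 * C * Y\<^sup>2)"
      using C by (simp add: ennreal_mult'[symmetric] mult.commute)
  qed
qed


section \<open>The abstract \<open>TT*\<close> argument\<close>

text \<open>Replaces a maximum over finitely many indices by evaluation at one measurable index, so
  that a bilinear argument can be applied to it. New indices are compared one at a time with the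
  current best.\<close>

lemma measurable_selection_max:
  fixes v :: "nat \<Rightarrow> 'a \<Rightarrow> real"
  assumes [measurable]: "\<And>j. v j \<in> borel_measurable M"
  shows "\<exists>J \<in> measurable M (count_space UNIV). \<forall>t. J t \<le> N \<and> (\<forall>j\<le>N. \<bar>v j t\<bar> \<le> \<bar>v (J t) t\<bar>)"
proof (induction N)
  case 0
  show ?case by (intro bexI[of _ "\<lambda>_. 0"]) auto
next
  case (Suc N)
  then obtain J where [measurable]: "J \<in> measurable M (count_space UNIV)"
    and J: "\<And>t. J t \<le> N" "\<And>t j. j \<le> N \<Longrightarrow> \<bar>v j t\<bar> \<le> \<bar>v (J t) t\<bar>" by blast
  define J' where "J' t = (if \<bar>v (J t) t\<bar> < \<bar>v (Suc N) t\<bar> then Suc N else J t)" for t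
  have [measurable]: "(\<lambda>t. v (J t) t) \<in> borel_measurable M"
    by (rule measurable_compose_countable) auto
  have "J' \<in> measurable M (count_space UNIV)" unfolding J'_def by measurable
  moreover have "J' t \<le> Suc N \<and> (\<forall>j\<le>Suc N. \<bar>v j t\<bar> \<le> \<bar>v (J' t) t\<bar>)" for t
  proof -
    have "\<bar>v j t\<bar> \<le> \<bar>v (J' t) t\<bar>" if "j \<le> Suc N" for j
      using that J(2)[of j t] by (cases "j = Suc N") (auto simp: J'_def)
    then show ?thesis using J(1)[of t] by (auto simp: J'_def)
  qed
  ultimately show ?case by blast
qed

text \<open>Squaring the integral as an inner product with itself turns control of the pairings of
  \<open>f\<close> at two times into control of the norm of its integral.\<close>

lemma norm_integral_sq_le:
  fixes f :: "'a \<Rightarrow> 'b :: {real_inner, banach, second_countable_topology}"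
  assumes f: "integrable M f"
  shows "ennreal ((norm (integral\<^sup>L M f))\<^sup>2) \<le> (\<integral>\<^sup>+t. \<integral>\<^sup>+s. ennreal \<bar>f t \<bullet> f s\<bar> \<partial>M \<partial>M)"
proof -
  have "ennreal ((norm (integral\<^sup>L M f))\<^sup>2) = ennreal (norm (integral\<^sup>L M f \<bullet> integral\<^sup>L M f))"
    by (simp add: power2_norm_eq_inner)
  also have "integral\<^sup>L M f \<bullet> integral\<^sup>L M f = (\<integral>t. f t \<bullet> integral\<^sup>L M f \<partial>M)"
    using f by (simp add: integral_inner_left)
  also have "ennreal (norm (\<integral>t. f t \<bullet> integral\<^sup>L M f \<partial>M)) \<le> (\<integral>\<^sup>+t. norm (f t \<bullet> integral\<^sup>L M f) \<partial>M)"
    using f by (intro integral_norm_bound_ennreal integrable_inner_left)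
  also have "\<dots> \<le> (\<integral>\<^sup>+t. \<integral>\<^sup>+s. ennreal \<bar>f t \<bullet> f s\<bar> \<partial>M \<partial>M)"
  proof (rule nn_integral_mono)
    fix t
    have "f t \<bullet> integral\<^sup>L M f = (\<integral>s. f t \<bullet> f s \<partial>M)" using f by (simp add: integral_inner_right)
    moreover have "ennreal (norm (\<integral>s. f t \<bullet> f s \<partial>M)) \<le> (\<integral>\<^sup>+s. norm (f t \<bullet> f s) \<partial>M)"
      using f by (intro integral_norm_bound_ennreal integrable_inner_right)
    ultimately show "ennreal (norm (f t \<bullet> integral\<^sup>L M f)) \<le> (\<integral>\<^sup>+s. ennreal \<bar>f t \<bullet> f s\<bar> \<partial>M)"
      by simp
  qed
  finally show ?thesis .
qed

lemma
  fixes \<phi> :: "real \<Rightarrow> 'b :: {banach, second_countable_topology}"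
  assumes M: "sigma_finite_measure M" and \<phi>: "integrable M \<phi>" and id [measurable]: "(\<lambda>x. x) \<in> borel_measurable M"
  shows integrable_running: "integrable M (\<lambda>s. indicator {..t} s *\<^sub>R \<phi> s)"
    and norm_running_le: "norm (LINT s|M. indicator {..t} s *\<^sub>R \<phi> s) \<le> (LINT s|M. norm (\<phi> s))"
    and running_measurable: "(\<lambda>t. LINT s|M. indicator {..t} s *\<^sub>R \<phi> s) \<in> borel_measurable M"
proof -
  have [measurable]: "\<phi> \<in> borel_measurable M" using \<phi> by simp
  have ind: "indicator {..t} s = (if s \<le> t then 1 else 0 :: real)" for s t :: real by (simp add: indicator_def)
  show i: "integrable M (\<lambda>s. indicator {..t} s *\<^sub>R \<phi> s)"
  proof (rule Bochner_Integration.integrable_bound[OF \<phi>])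
    show "(\<lambda>s. indicator {..t} s *\<^sub>R \<phi> s) \<in> borel_measurable M" unfolding ind by measurable
  qed (auto simp: indicator_def)
  have "norm (LINT s|M. indicator {..t} s *\<^sub>R \<phi> s) \<le> (LINT s|M. norm (indicator {..t} s *\<^sub>R \<phi> s))"
    by (rule integral_norm_bound)
  also have "\<dots> \<le> (LINT s|M. norm (\<phi> s))"
    by (intro integral_mono integrable_norm i \<phi>) (auto simp: indicator_def)
  finally show "norm (LINT s|M. indicator {..t} s *\<^sub>R \<phi> s) \<le> (LINT s|M. norm (\<phi> s))" .
  interpret sigma_finite_measure M by (rule M)
  show "(\<lambda>t. LINT s|M. indicator {..t} s *\<^sub>R \<phi> s) \<in> borel_measurable M"
    unfolding ind by measurable
qed

text \<open>The \<open>TT*\<close> argument: for the selected index \<open>J\<close>, the retarded pairing is tested against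
  \<open>h = \<bar>v\<bar> powr (q - 1) * sgn v\<close> with \<open>v t = e (J t) t \<bullet> G t\<close>.\<close>

proposition retarded_maximal_estimate:
  fixes e :: "nat \<Rightarrow> real \<Rightarrow> 'b :: {real_inner, banach, second_countable_topology}"
    and \<phi> :: "real \<Rightarrow> 'b" and K :: "real \<Rightarrow> real \<Rightarrow> real"
  assumes M: "finite_measure M" and id [measurable]: "(\<lambda>x. x) \<in> borel_measurable M"
    and e [measurable]: "\<And>j. e j \<in> borel_measurable M"
    and eB: "\<And>j t. norm (e j t) \<le> B j"
    and \<phi>: "integrable M \<phi>"
    and K0: "\<And>t s. 0 \<le> K t s"
    and K: "\<And>t. t \<in> space M \<Longrightarrow> AE s in M. \<forall>i j. \<bar>e i t \<bullet> e j s\<bar> \<le> K t s"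
    and q: "q > 1" "q' = q / (q - 1)" and C: "C > 0"
    and form: "\<And>h Y. h \<in> borel_measurable M \<Longrightarrow> (\<And>s. 0 \<le> h s) \<Longrightarrow> 0 < Y \<Longrightarrow>
      (\<integral>\<^sup>+s. ennreal (h s powr q') \<partial>M) \<le> ennreal (Y powr q') \<Longrightarrow>
      (\<integral>\<^sup>+t. \<integral>\<^sup>+s. ennreal (K t s * h t * h s) \<partial>M \<partial>M) \<le> ennreal (C * Y\<^sup>2)"
  defines "G \<equiv> (\<lambda>t. LINT s|M. indicator {..t} s *\<^sub>R \<phi> s)"
  shows "(\<integral>\<^sup>+t. (SUP j. ennreal (\<bar>e j t \<bullet> G t\<bar> powr q)) \<partial>M)
    \<le> ennreal ((sqrt C * (LINT s|M. norm (\<phi> s))) powr q)"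
proof -
  interpret finite_measure M by (rule M)
  interpret pair_sigma_finite M M ..
  define P where "P = (LINT s|M. norm (\<phi> s))"
  have P: "P \<ge> 0" unfolding P_def by (rule Bochner_Integration.integral_nonneg) auto
  have [measurable]: "\<phi> \<in> borel_measurable M" using \<phi> by auto
  have ind: "indicator {..t} s = (if s \<le> t then 1 else 0 :: real)" for s t :: real by (simp add: indicator_def)
  note run = integrable_running[OF finite_measure.axioms(1)[OF M] \<phi> id]
    norm_running_le[OF finite_measure.axioms(1)[OF M] \<phi> id]
    running_measurable[OF finite_measure.axioms(1)[OF M] \<phi> id]
  have [measurable]: "G \<in> borel_measurable M" unfolding G_def by (rule run(3))
  have GP: "norm (G t) \<le> P" for t unfolding G_def P_def by (rule run(2))
  define v where "v j t = e j t \<bullet> G t" for j t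
  have [measurable]: "v j \<in> borel_measurable M" for j unfolding v_def by measurable
  have fin: "(\<integral>\<^sup>+t. ennreal (\<bar>v (J t) t\<bar> powr q) \<partial>M) \<le> ennreal ((sqrt C * P) powr q)"
    if [measurable]: "J \<in> measurable M (count_space UNIV)" and J: "\<And>t. J t \<le> N" for J and N :: nat
  proof -
    \<comment> \<open>\<open>B'\<close> depends on \<open>N\<close>; it serves to make
      \<open>X\<close> finite and the exchange of integrals legitimate, and is absent from the final
      bound.\<close>
    define B' where "B' = Max (B ` {..N})"
    define E where "E t = e (J t) t" for t
    have [measurable]: "E \<in> borel_measurable M" unfolding E_def
      by (rule measurable_compose_countable) auto
    have EB: "norm (E t) \<le> B'" for t unfolding E_def B'_def
      using J[of t] by (intro order_trans[OF eB Max_ge]) auto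
    have B': "B' \<ge> 0" using EB[of 0] norm_ge_zero order_trans by blast
    define u where "u t = E t \<bullet> G t" for t
    have [measurable]: "u \<in> borel_measurable M" unfolding u_def by measurable
    have uv: "v (J t) t = u t" for t by (simp add: u_def v_def E_def)
    have uB: "\<bar>u t\<bar> \<le> B' * P" for t
      unfolding u_def by (intro order_trans[OF Cauchy_Schwarz_ineq2] mult_mono EB GP B') auto
    define g where "g t = \<bar>u t\<bar> powr (q - 1)" for t
    have [measurable]: "g \<in> borel_measurable M" unfolding g_def by measurable
    have g0: "0 \<le> g t" for t by (simp add: g_def)
    define g' where "g' = (B' * P) powr (q - 1)"
    have gB: "g t \<le> g'" for t unfolding g_def g'_def using q uB by (intro powr_mono2) auto
    have g'0: "0 \<le> g'" by (simp add: g'_def)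
    define X where "X = (LINT t|M. \<bar>u t\<bar> powr q)"
    have iX: "integrable M (\<lambda>t. \<bar>u t\<bar> powr q)"
    proof (rule integrable_const_bound[where B = "(B' * P) powr q"])
      show "AE t in M. norm (\<bar>u t\<bar> powr q) \<le> (B' * P) powr q"
        using q uB by (auto intro!: powr_mono2)
    qed measurable
    have X: "X \<ge> 0" unfolding X_def by (rule Bochner_Integration.integral_nonneg) auto
    \<comment> \<open>The retarded cutoff is moved from \<open>\<phi>\<close> to the test weight.
      The norm bound on \<open>Z s\<close> uses only \<open>\<bar>a s t\<bar> \<le> g t\<close>, so
      the form estimate for \<open>g\<close> covers every \<open>s\<close> at once.\<close>
    define a where "a s t = g t * sgn (u t) * indicator {..t} s" for s t
    have aM [measurable]: "(\<lambda>(s, t). a s t) \<in> borel_measurable (M \<Otimes>\<^sub>M M)"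
      unfolding a_def ind by measurable
    have aM' [measurable]: "a s \<in> borel_measurable M" for s
      unfolding a_def ind by measurable
    have ag: "\<bar>a s t\<bar> \<le> g t" for s t using g0[of t] by (auto simp: a_def abs_mult indicator_def sgn_if)
    have iaE: "integrable M (\<lambda>t. a s t *\<^sub>R E t)" for s
    proof (rule integrable_const_bound[where B = "g' * B'"])
      show "AE t in M. norm (a s t *\<^sub>R E t) \<le> g' * B'"
        using ag gB EB g'0 by (auto intro!: mult_mono order_trans[OF ag gB])
    qed measurable
    \<comment> \<open>The integral dual to \<open>G\<close>: it runs over \<open>t \<ge> s\<close>.
      Since \<open>\<phi>\<close> is merely integrable, it is paired with a bound on
      \<open>norm (Z s)\<close> that is uniform in \<open>s\<close>.\<close>
    define Z where "Z s = (LINT t|M. a s t *\<^sub>R E t)" for s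
    have [measurable]: "Z \<in> borel_measurable M" unfolding Z_def by measurable
    have pw: "\<bar>u t\<bar> powr q = g t * sgn (u t) * u t" for t
    proof (cases "u t = 0")
      case False
      then have "\<bar>u t\<bar> powr q = \<bar>u t\<bar> powr (q - 1) * \<bar>u t\<bar> powr 1" by (simp only: powr_add[symmetric]) simp
      moreover have "sgn (u t) * u t = \<bar>u t\<bar>" by (simp add: sgn_if)
      ultimately show ?thesis using False by (simp only: g_def mult.assoc) simp
    qed simp
    have "X = (LINT t|M. LINT s|M. a s t * (E t \<bullet> \<phi> s))"
      unfolding X_def
    proof (intro Bochner_Integration.integral_cong refl)
      fix t
      have "(LINT s|M. a s t * (E t \<bullet> \<phi> s)) = (LINT s|M. (g t * sgn (u t)) * (E t \<bullet> (indicator {..t} s *\<^sub>R \<phi> s)))"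
        by (simp add: a_def mult_ac)
      also have "\<dots> = g t * sgn (u t) * (E t \<bullet> G t)"
        unfolding G_def by (subst integral_inner_right[symmetric, OF run(1)]) simp
      finally show "\<bar>u t\<bar> powr q = (LINT s|M. a s t * (E t \<bullet> \<phi> s))"
        by (simp add: pw[unfolded u_def] u_def)
    qed
    also have "\<dots> = (LINT s|M. LINT t|M. a s t * (E t \<bullet> \<phi> s))"
    proof (rule Fubini_integral[of "\<lambda>s t. a s t * (E t \<bullet> \<phi> s)"])
      have bd: "norm (a s t * (E t \<bullet> \<phi> s)) \<le> g' * B' * norm (\<phi> s)" for s t
      proof -
        have "\<bar>E t \<bullet> \<phi> s\<bar> \<le> B' * norm (\<phi> s)"
          by (intro order_trans[OF Cauchy_Schwarz_ineq2] mult_right_mono EB) auto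
        then have "\<bar>a s t\<bar> * \<bar>E t \<bullet> \<phi> s\<bar> \<le> g' * (B' * norm (\<phi> s))"
          using order_trans[OF ag gB, of s t] g'0 by (intro mult_mono) auto
        then show ?thesis by (simp add: abs_mult mult.assoc)
      qed
      show "integrable (M \<Otimes>\<^sub>M M) (\<lambda>(s, t). a s t * (E t \<bullet> \<phi> s))"
      proof (rule Fubini_integrable)
        show "(\<lambda>(s, t). a s t * (E t \<bullet> \<phi> s)) \<in> borel_measurable (M \<Otimes>\<^sub>M M)" by measurable
        have it: "integrable M (\<lambda>t. a s t * (E t \<bullet> \<phi> s))" for s
          by (rule integrable_const_bound[where B = "g' * B' * norm (\<phi> s)"]) (use bd in auto)
        then show "AE s in M. integrable M (\<lambda>t. case (s, t) of (s, t) \<Rightarrow> a s t * (E t \<bullet> \<phi> s))" by simp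
        have "(LINT t|M. norm (a s t * (E t \<bullet> \<phi> s))) \<le> measure M (space M) * (g' * B') * norm (\<phi> s)" for s
        proof -
          have "(LINT t|M. norm (a s t * (E t \<bullet> \<phi> s))) \<le> (LINT t|M. g' * B' * norm (\<phi> s))"
            using it bd by (intro integral_mono) auto
          then show ?thesis by (simp add: mult.assoc)
        qed
        note bn0 = this
        have bn: "norm (LINT t|M. norm (a s t * (E t \<bullet> \<phi> s)))
            \<le> norm (measure M (space M) * (g' * B') * norm (\<phi> s))" for s
        proof -
          have "0 \<le> (LINT t|M. norm (a s t * (E t \<bullet> \<phi> s)))"
            by (rule Bochner_Integration.integral_nonneg) simp
          then show ?thesis using bn0[of s] abs_ge_self[of "measure M (space M) * (g' * B') * norm (\<phi> s)"]
            unfolding real_norm_def[of "LINT t|M. _ t"] real_norm_def[of "_ * _"] by linarith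
        qed
        show "integrable M (\<lambda>s. LINT t|M. norm (case (s, t) of (s, t) \<Rightarrow> a s t * (E t \<bullet> \<phi> s)))"
          unfolding prod.case
        proof (rule Bochner_Integration.integrable_bound)
          show "integrable M (\<lambda>s. measure M (space M) * (g' * B') * norm (\<phi> s))" using \<phi> by simp
        qed (use bn in auto)
      qed
    qed
    also have "\<dots> = (LINT s|M. Z s \<bullet> \<phi> s)"
      unfolding Z_def by (subst integral_inner_left[symmetric, OF iaE]) simp
    finally have XZ: "X = (LINT s|M. Z s \<bullet> \<phi> s)" .
    have "X \<le> (sqrt C * P) powr q"
    proof (cases "X = 0")
      case False
      then have X0: "X > 0" using X by simp
      \<comment> \<open>By \<open>(q - 1) * q' = q\<close>, this is exactly the
        \<open>q'\<close>-norm of \<open>g\<close>. The form estimate gives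
        \<open>X \<le> sqrt C * Y * P\<close>, and division by \<open>Y\<close> leaves
        \<open>X powr (1 / q)\<close> on the left.\<close>
      define Y where "Y = X powr (1 / q')"
      have Y: "Y > 0" using X0 by (simp add: Y_def)
      have q'0: "q' > 1" unfolding q(2) using q(1) by (simp add: divide_simps)
      have ZY: "norm (Z s) \<le> sqrt C * Y" for s
      proof -
        have "ennreal ((norm (Z s))\<^sup>2) \<le> (\<integral>\<^sup>+t. \<integral>\<^sup>+t'. ennreal \<bar>(a s t *\<^sub>R E t) \<bullet> (a s t' *\<^sub>R E t')\<bar> \<partial>M \<partial>M)"
          unfolding Z_def by (rule norm_integral_sq_le[OF iaE])
        also have "\<dots> \<le> (\<integral>\<^sup>+t. \<integral>\<^sup>+t'. ennreal (K t t' * g t * g t') \<partial>M \<partial>M)"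
        proof (rule nn_integral_mono, rule nn_integral_mono_AE)
          fix t assume t: "t \<in> space M"
          show "AE t' in M. ennreal \<bar>(a s t *\<^sub>R E t) \<bullet> (a s t' *\<^sub>R E t')\<bar> \<le> ennreal (K t t' * g t * g t')"
            using K[OF t]
          proof eventually_elim
            case (elim t')
            have "\<bar>a s t\<bar> * \<bar>a s t'\<bar> * \<bar>E t \<bullet> E t'\<bar> \<le> g t * g t' * K t t'"
              using elim by (intro mult_mono ag) (auto simp: E_def g0)
            then show ?case by (intro ennreal_leI) (simp add: abs_mult mult_ac)
          qed
        qed
        also have "\<dots> \<le> ennreal (C * Y\<^sup>2)"
        proof (rule form)
          have "g t powr q' = \<bar>u t\<bar> powr q" for t using q by (simp add: g_def powr_powr)
          then have "(\<integral>\<^sup>+t. ennreal (g t powr q') \<partial>M) = ennreal X"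
            unfolding X_def using iX by (simp add: nn_integral_eq_integral)
          also have "X = Y powr q'" using X0 q'0 by (simp add: Y_def powr_powr)
          finally show "(\<integral>\<^sup>+t. ennreal (g t powr q') \<partial>M) \<le> ennreal (Y powr q')" by simp
        qed (use g0 Y in auto)
        also have "C * Y\<^sup>2 = (sqrt C * Y)\<^sup>2" using C by (simp add: power_mult_distrib)
        finally show ?thesis by (rule ennreal_sq_le_D[rotated]) (use C Y in simp)
      qed
      have ZB: "\<bar>Z s \<bullet> \<phi> s\<bar> \<le> sqrt C * Y * norm (\<phi> s)" for s
        by (rule order_trans[OF Cauchy_Schwarz_ineq2 mult_right_mono[OF ZY]]) simp
      have iB: "integrable M (\<lambda>s. sqrt C * Y * norm (\<phi> s))" using \<phi> by simp
      have iZ: "integrable M (\<lambda>s. Z s \<bullet> \<phi> s)"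
      proof (rule Bochner_Integration.integrable_bound[OF iB])
        show "AE s in M. norm (Z s \<bullet> \<phi> s) \<le> norm (sqrt C * Y * norm (\<phi> s))"
          unfolding real_norm_def by (intro AE_I2 order_trans[OF ZB abs_ge_self])
      qed measurable
      have "X \<le> (LINT s|M. sqrt C * Y * norm (\<phi> s))"
        unfolding XZ by (intro integral_mono iZ iB abs_le_D1[OF ZB])
      then have "X \<le> sqrt C * Y * P" by (simp add: P_def)
      then have "Y * X powr (1 / q) \<le> Y * (sqrt C * P)"
      proof -
        have "1 / q' + 1 / q = 1" unfolding q(2) using q(1) by (simp add: divide_simps)
        then have "Y * X powr (1 / q) = X" using X0 by (simp add: Y_def powr_add[symmetric])
        then show ?thesis using \<open>X \<le> sqrt C * Y * P\<close> by (simp add: mult_ac)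
      qed
      then have "X powr (1 / q) \<le> sqrt C * P" using Y by simp
      then have "(X powr (1 / q)) powr q \<le> (sqrt C * P) powr q"
        using q by (intro powr_mono2) auto
      then show ?thesis using q X0 by (simp add: powr_powr)
    qed simp
    then show ?thesis
      using iX by (simp add: uv X_def nn_integral_eq_integral ennreal_leI)
  qed
  \<comment> \<open>Finite maxima increase to the supremum, and the bound obtained for them does not
    depend on \<open>N\<close>.\<close>
  define m where "m N t = (SUP j\<in>{..N}. ennreal (\<bar>v j t\<bar> powr q))" for N :: nat and t
  have "(SUP j. ennreal (\<bar>v j t\<bar> powr q)) = (SUP N. m N t)" for t
  proof (rule antisym)
    show "(SUP j. ennreal (\<bar>v j t\<bar> powr q)) \<le> (SUP N. m N t)"
    proof (rule SUP_least)
      fix j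
      have "ennreal (\<bar>v j t\<bar> powr q) \<le> m j t" unfolding m_def by (rule SUP_upper) simp
      also have "\<dots> \<le> (SUP N. m N t)" by (rule SUP_upper) simp
      finally show "ennreal (\<bar>v j t\<bar> powr q) \<le> (SUP N. m N t)" .
    qed
    show "(SUP N. m N t) \<le> (SUP j. ennreal (\<bar>v j t\<bar> powr q))"
      unfolding m_def by (intro SUP_least SUP_upper) simp
  qed
  moreover have "(\<integral>\<^sup>+t. (SUP N. m N t) \<partial>M) = (SUP N. \<integral>\<^sup>+t. m N t \<partial>M)"
  proof (rule nn_integral_monotone_convergence_SUP)
    show "incseq m" unfolding m_def incseq_def le_fun_def by (auto intro!: SUP_subset_mono)
    show "m N \<in> borel_measurable M" for N unfolding m_def by measurable
  qed
  moreover have "(\<integral>\<^sup>+t. m N t \<partial>M) \<le> ennreal ((sqrt C * P) powr q)" for N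
  proof -
    obtain J where J: "J \<in> measurable M (count_space UNIV)" "\<And>t. J t \<le> N"
      "\<And>t j. j \<le> N \<Longrightarrow> \<bar>v j t\<bar> \<le> \<bar>v (J t) t\<bar>"
      using measurable_selection_max[of v M N] by auto
    have "(\<integral>\<^sup>+t. m N t \<partial>M) \<le> (\<integral>\<^sup>+t. ennreal (\<bar>v (J t) t\<bar> powr q) \<partial>M)"
      unfolding m_def using q by (intro nn_integral_mono SUP_least ennreal_leI powr_mono2 J) auto
    also have "\<dots> \<le> ennreal ((sqrt C * P) powr q)" by (rule fin[OF J(1,2)])
    finally show ?thesis .
  qed
  ultimately show ?thesis by (simp add: v_def P_def SUP_least)
qed


section \<open>Translations in \<open>L\<^sup>2\<close>\<close>

lemma in_L2_mono:
  assumes f: "in_Lq 2 f" and h: "h \<in> borel_measurable borel" and le: "\<And>x. cmod (h x) \<le> cmod (f x)"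
  shows "in_Lq 2 h"
proof (rule in_L2_dominated[OF f f h, where C = 1])
  show "(cmod (h x))\<^sup>2 \<le> 1 * ((cmod (f x))\<^sup>2 + (cmod (f x))\<^sup>2)" for x
    by (rule order_trans[OF power_mono[OF le]]) auto
qed

lemma integrable_mult_L2:
  assumes f: "in_Lq 2 f" and g: "in_Lq 2 g"
  shows "integrable lborel (\<lambda>x. f x * g x)"
proof (rule Bochner_Integration.integrable_bound)
  show "integrable lborel (\<lambda>x. (cmod (f x))\<^sup>2 + (cmod (g x))\<^sup>2)" using f g by (simp add: in_L2_iff)
  have "a * b \<le> a\<^sup>2 + b\<^sup>2" if "0 \<le> a" "0 \<le> b" for a b :: real
    using sum_squares_bound[of a b] mult_nonneg_nonneg[OF that] by linarith
  then show "AE x in lborel. norm (f x * g x) \<le> norm ((cmod (f x))\<^sup>2 + (cmod (g x))\<^sup>2)"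
    by (simp add: norm_mult)
qed (use f g in \<open>auto simp: in_Lq_def\<close>)

lemma tendsto_one_over_Suc: "(\<lambda>n. 1 / (real n + 1)) \<longlonglongrightarrow> 0"
  using LIMSEQ_Suc[OF lim_1_over_n] by (simp add: add.commute)

text \<open>Truncation by nearest-point projection onto a disc instead of cutting to zero: the
  projection is 1-Lipschitz, so truncating is continuous and contracts L2 distances.\<close>

definition clip :: "real \<Rightarrow> complex \<Rightarrow> complex" where
  "clip c z = closest_point (cball 0 c) z"

lemma
  assumes c: "0 \<le> c"
  shows norm_clip: "cmod (clip c z) \<le> c"
    and clip_lipschitz: "cmod (clip c z - clip c z') \<le> cmod (z - z')"
    and continuous_on_clip: "continuous_on S (clip c)"
    and clip_measurable: "clip c \<in> borel_measurable borel"
    and clip_id: "cmod z \<le> c \<Longrightarrow> clip c z = z"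
    and norm_clip_le: "cmod (clip c z) \<le> cmod z"
proof -
  have ne: "closed (cball (0::complex) c)" "convex (cball (0::complex) c)" "cball (0::complex) c \<noteq> {}"
    using c by auto
  show "cmod (clip c z) \<le> c"
    using closest_point_in_set[OF ne(1,3), of z] by (simp add: clip_def)
  show L: "cmod (clip c z - clip c z') \<le> cmod (z - z')" for z z'
    using closest_point_lipschitz[OF ne(2,1,3), of z z'] by (simp add: clip_def dist_norm)
  show cont: "continuous_on S (clip c)" for S
    unfolding clip_def using ne by (intro continuous_on_closest_point) auto
  show "clip c \<in> borel_measurable borel"
    by (rule borel_measurable_continuous_onI[OF cont])
  show id: "clip c z = z" if "cmod z \<le> c" for z
    unfolding clip_def using that by (intro closest_point_self) simp
  show "cmod (clip c z) \<le> cmod z"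
    using L[of z 0] id[of 0] c by simp
qed

text \<open>After truncation in height and in space, \<open>f\<close> is an almost-everywhere limit
  of continuous functions; these are truncated in the same way, continuously, so that dominated
  convergence applies.\<close>

lemma L2_continuous_approx:
  assumes f: "in_Lq 2 f" and e: "e > 0"
  shows "\<exists>\<phi> B. continuous_on UNIV \<phi> \<and> (\<forall>x. cmod (\<phi> x) \<le> B) \<and> (\<forall>x. \<bar>x\<bar> > B \<longrightarrow> \<phi> x = 0) \<and>
    in_Lq 2 \<phi> \<and> (LBINT x. (cmod (f x - \<phi> x))\<^sup>2) < e"
proof -
  have [measurable]: "f \<in> borel_measurable borel" using f by (rule in_L2_measurable)
  have sq: "(cmod (a - b))\<^sup>2 \<le> 2 * ((cmod (a - c))\<^sup>2 + (cmod (c - b))\<^sup>2)" for a b c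
    using cmod_add_sq[of "a - c" "c - b"] by simp
  define F where "F k x = indicator {- real k..real k} x *\<^sub>R clip (real k) (f x)" for k x
  have [measurable]: "F k \<in> borel_measurable borel" for k
    unfolding F_def using clip_measurable[of "real k"] by measurable
  have Fle: "cmod (F k x) \<le> 1 * cmod (f x)" for k x
    using norm_clip_le[of "real k" "f x"] by (auto simp: F_def indicator_def)
  have Flim: "(\<lambda>k. F k x) \<longlonglongrightarrow> f x" for x
  proof (rule tendsto_eventually)
    obtain N :: nat where "max \<bar>x\<bar> (cmod (f x)) \<le> real N" using real_arch_simple by blast
    then show "\<forall>\<^sub>F k in sequentially. F k x = f x"
      by (intro eventually_sequentiallyI[of N]) (auto simp: F_def clip_id indicator_def)
  qed
  note L = l2_dominated_convergence[OF f _ Fle Flim]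
  have "(\<lambda>k. norm (abs_l2 (F k) - abs_l2 f)) \<longlonglongrightarrow> 0"
    by (rule tendsto_norm_zero) (use L(3) in \<open>simp add: LIM_zero_iff\<close>)
  then have "\<forall>\<^sub>F k in sequentially. norm (abs_l2 (F k) - abs_l2 f) < sqrt (e / 4)"
    using e by (intro order_tendstoD(2)) auto
  then obtain k where k: "norm (abs_l2 (F k) - abs_l2 f) < sqrt (e / 4)"
    by (auto simp: eventually_sequentially)
  have Fk: "in_Lq 2 (F k)" by (rule L(1)) simp
  have "norm (abs_l2 (F k) - abs_l2 f) = sqrt (LBINT x. (cmod (F k x - f x))\<^sup>2)"
    using norm_abs_l2[OF in_L2_diff[OF Fk f]] by (simp add: abs_l2_diff Fk f)
  then have k': "(LBINT x. (cmod (f x - F k x))\<^sup>2) < e / 4" using k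
    by (simp add: norm_minus_commute)
  have "F k \<in> borel_measurable lebesgue"
    by (rule measurable_completion) simp
  then have "F k measurable_on UNIV"
    by (intro lebesgue_measurable_imp_measurable_on) auto
  then obtain N g where N: "negligible N" and g: "\<And>n. continuous_on UNIV (g n)"
    and glim: "\<And>x. x \<notin> N \<Longrightarrow> (\<lambda>n. g n x) \<longlonglongrightarrow> F k x"
    unfolding measurable_on_def by auto
  have AEN: "AE x in lborel. x \<notin> N"
  proof -
    have "AE x in lebesgue. x \<notin> N" using N by (simp add: AE_not_in negligible_iff_null_sets)
    then show ?thesis by (simp add: AE_completion_iff)
  qed
  \<comment> \<open>A trapezoid equal to 1 on \<open>{- real k..real k}\<close>, off which
    \<open>F k\<close> vanishes, and to 0 beyond \<open>real k + 1\<close>; it enforces compact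
    support without changing the limit.\<close>
  define \<eta> where "\<eta> x = max 0 (min 1 (real k + 1 - \<bar>x\<bar>))" for x :: real
  define h where "h n x = \<eta> x *\<^sub>R clip (real k) (g n x)" for n x
  have hc: "continuous_on UNIV (h n)" for n
    unfolding h_def \<eta>_def
    by (intro continuous_intros continuous_on_compose2[OF continuous_on_clip[of "real k" UNIV] g]) auto
  have [measurable]: "h n \<in> borel_measurable borel" for n by (rule borel_measurable_continuous_onI[OF hc])
  have h0: "h n x = 0" if "\<bar>x\<bar> > real k + 1" for n x using that by (simp add: h_def \<eta>_def)
  have hk: "cmod (h n x) \<le> real k" for n x
  proof -
    have "\<bar>\<eta> x\<bar> * cmod (clip (real k) (g n x)) \<le> 1 * real k"
      by (intro mult_mono norm_clip) (auto simp: \<eta>_def)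
    then show ?thesis by (simp add: h_def)
  qed
  have Fk2: "cmod (F k x) \<le> real k" for x
    using norm_clip[of "real k" "f x"] by (auto simp: F_def indicator_def)
  define W where "W x = (2 * real k)\<^sup>2 * indicator {- (real k + 1)..real k + 1} x" for x :: real
  have iW: "integrable lborel W" unfolding W_def
    by (intro integrable_mult_right integrable_real_indicator) (auto simp: emeasure_lborel_Icc_eq)
  have dW: "(cmod (F k x - h n x))\<^sup>2 \<le> W x" for n x
  proof (cases "\<bar>x\<bar> > real k + 1")
    case True
    then show ?thesis using h0[OF True, of n] by (auto simp: F_def W_def indicator_def)
  next
    case False
    have "cmod (F k x - h n x) \<le> 2 * real k"
      using norm_triangle_ineq4[of "F k x" "h n x"] Fk2[of x] hk[of n x] by linarith
    then have "(cmod (F k x - h n x))\<^sup>2 \<le> (2 * real k)\<^sup>2" by (intro power_mono) auto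
    moreover have "x \<in> {- (real k + 1)..real k + 1}" using False by auto
    ultimately show ?thesis by (simp add: W_def)
  qed
  have "(\<lambda>n. LBINT x. (cmod (F k x - h n x))\<^sup>2) \<longlonglongrightarrow> (LINT x|(lborel :: real measure). 0)"
  proof (rule integral_dominated_convergence[OF _ _ iW])
    show "AE x in lborel. (\<lambda>n. (cmod (F k x - h n x))\<^sup>2) \<longlonglongrightarrow> 0"
      using AEN
    proof eventually_elim
      case (elim x)
      have "(\<lambda>n. clip (real k) (g n x)) \<longlonglongrightarrow> clip (real k) (F k x)"
        by (rule continuous_on_tendsto_compose[OF continuous_on_clip[of "real k" UNIV] glim[OF elim]]) auto
      then have "(\<lambda>n. h n x) \<longlonglongrightarrow> \<eta> x *\<^sub>R F k x" unfolding h_def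
        using clip_id[of "real k" "F k x"] Fk2[of x] by (auto intro!: tendsto_intros)
      also have "\<eta> x *\<^sub>R F k x = F k x" by (auto simp: F_def \<eta>_def indicator_def)
      finally have "(\<lambda>n. (cmod (F k x - h n x))\<^sup>2) \<longlonglongrightarrow> (cmod (F k x - F k x))\<^sup>2"
        by (intro tendsto_intros)
      then show ?case by simp
    qed
    show "AE x in lborel. norm ((cmod (F k x - h n x))\<^sup>2) \<le> W x" for n using dW by simp
  qed auto
  then have "\<forall>\<^sub>F n in sequentially. (LBINT x. (cmod (F k x - h n x))\<^sup>2) < e / 4"
    using e by (intro order_tendstoD(2)) auto
  then obtain n where n: "(LBINT x. (cmod (F k x - h n x))\<^sup>2) < e / 4"
    by (auto simp: eventually_sequentially)
  have Lh: "in_Lq 2 (h n)"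
  proof (rule in_L2_dominated[of "\<lambda>x. F k x - h n x" "F k" "h n" 2])
    have "integrable lborel (\<lambda>x. (cmod (F k x - h n x))\<^sup>2)"
      by (rule Bochner_Integration.integrable_bound[OF iW]) (use dW in \<open>auto intro: order_trans[OF _ abs_ge_self]\<close>)
    then show "in_Lq 2 (\<lambda>x. F k x - h n x)" by (simp add: in_L2_iff)
    show "(cmod (h n x))\<^sup>2 \<le> 2 * ((cmod (F k x - h n x))\<^sup>2 + (cmod (F k x))\<^sup>2)" for x
      using sq[of "h n x" 0 "F k x"] by (simp add: norm_minus_commute)
  qed (use Fk in auto)
  have "(LBINT x. (cmod (f x - h n x))\<^sup>2)
      \<le> (LBINT x. 2 * ((cmod (f x - F k x))\<^sup>2 + (cmod (F k x - h n x))\<^sup>2))"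
    using in_L2_diff[OF f Lh] in_L2_diff[OF f Fk] in_L2_diff[OF Fk Lh]
    by (intro integral_mono sq) (auto simp: in_L2_iff)
  also have "\<dots> = 2 * ((LBINT x. (cmod (f x - F k x))\<^sup>2) + (LBINT x. (cmod (F k x - h n x))\<^sup>2))"
    using in_L2_diff[OF f Fk] in_L2_diff[OF Fk Lh] by (simp add: in_L2_iff)
  also have "\<dots> < e"
  proof -
    have "2 * (a + b) < e" if "a < e / 4" "b < e / 4" for a b :: real using that by simp
    then show ?thesis using k' n by blast
  qed
  finally have "(LBINT x. (cmod (f x - h n x))\<^sup>2) < e" .
  moreover have "cmod (h n x) \<le> real k + 1" for x using hk[of n x] by linarith
  ultimately show ?thesis using hc[of n] h0 Lh
    by (intro exI[of _ "h n"] exI[of _ "real k + 1"]) auto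
qed

lemma in_L2_shift: "in_Lq 2 f \<Longrightarrow> in_Lq 2 (\<lambda>x. f (x + u))"
  using lborel_integrable_real_affine[of "\<lambda>x. (cmod (f x))\<^sup>2" 1 u]
  by (auto simp: in_L2_iff add.commute)

lemma L2_shift_continuous:
  assumes f: "in_Lq 2 f" and u: "u \<longlonglongrightarrow> 0"
  shows "(\<lambda>n. LBINT x. (cmod (f (x + u n) - f x))\<^sup>2) \<longlonglongrightarrow> 0"
proof (rule LIMSEQ_I)
  fix e :: real assume e: "e > 0"
  \<comment> \<open>Budget: the error \<open>f - \<phi>\<close> enters twice with factor 4 and the
    shift of \<open>\<phi>\<close> once with factor 2, in all at most 10/16 of
    \<open>e\<close>.\<close>
  obtain \<phi> B where \<phi>: "continuous_on UNIV \<phi>" "\<And>x. cmod (\<phi> x) \<le> B" "\<And>x. \<bar>x\<bar> > B \<Longrightarrow> \<phi> x = 0"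
    "in_Lq 2 \<phi>" "(LBINT x. (cmod (f x - \<phi> x))\<^sup>2) < e / 16"
    using L2_continuous_approx[OF f, of "e / 16"] e by auto
  have [measurable]: "\<phi> \<in> borel_measurable borel" by (rule borel_measurable_continuous_onI[OF \<phi>(1)])
  obtain b where b: "\<And>n. \<bar>u n\<bar> \<le> b"
    using convergent_imp_Bseq[of u] u by (auto simp: convergent_def Bseq_def)
  define W where "W x = (2 * B)\<^sup>2 * indicator {- (B + b)..B + b} x" for x :: real
  have iW: "integrable lborel W" unfolding W_def
    by (intro integrable_mult_right integrable_real_indicator) (auto simp: emeasure_lborel_Icc_eq)
  have "(\<lambda>n. LBINT x. (cmod (\<phi> (x + u n) - \<phi> x))\<^sup>2) \<longlonglongrightarrow> (LINT x|(lborel :: real measure). 0)"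
  proof (rule integral_dominated_convergence[OF _ _ iW])
    have "(\<lambda>n. (cmod (\<phi> (x + u n) - \<phi> x))\<^sup>2) \<longlonglongrightarrow> 0" for x
    proof -
      have "(\<lambda>n. x + u n) \<longlonglongrightarrow> x + 0" by (intro tendsto_intros u)
      then have "(\<lambda>n. \<phi> (x + u n)) \<longlonglongrightarrow> \<phi> x"
        by (intro continuous_on_tendsto_compose[OF \<phi>(1)]) auto
      then have "(\<lambda>n. (cmod (\<phi> (x + u n) - \<phi> x))\<^sup>2) \<longlonglongrightarrow> (cmod (\<phi> x - \<phi> x))\<^sup>2"
        by (intro tendsto_intros)
      then show ?thesis by simp
    qed
    then show "AE x in lborel. (\<lambda>n. (cmod (\<phi> (x + u n) - \<phi> x))\<^sup>2) \<longlonglongrightarrow> 0" by simp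
    have "(cmod (\<phi> (x + u n) - \<phi> x))\<^sup>2 \<le> W x" for n x
    proof (cases "\<bar>x\<bar> > B + b")
      case True
      have "\<bar>x\<bar> > B" "\<bar>x + u n\<bar> > B" using True b[of n] by linarith+
      then show ?thesis using \<phi>(3) by (simp add: W_def)
    next
      case False
      have "cmod (\<phi> (x + u n) - \<phi> x) \<le> 2 * B"
        using norm_triangle_ineq4[of "\<phi> (x + u n)" "\<phi> x"] \<phi>(2)[of x] \<phi>(2)[of "x + u n"] by linarith
      then have "(cmod (\<phi> (x + u n) - \<phi> x))\<^sup>2 \<le> (2 * B)\<^sup>2" by (intro power_mono) auto
      moreover have "x \<in> {- (B + b)..B + b}" using False by auto
      ultimately show ?thesis by (simp add: W_def)
    qed
    then show "AE x in lborel. norm ((cmod (\<phi> (x + u n) - \<phi> x))\<^sup>2) \<le> W x" for n by simp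
  qed auto
  then have "\<forall>\<^sub>F n in sequentially. (LBINT x. (cmod (\<phi> (x + u n) - \<phi> x))\<^sup>2) < e / 16"
    using e by (intro order_tendstoD(2)) auto
  then obtain no where no: "\<And>n. n \<ge> no \<Longrightarrow> (LBINT x. (cmod (\<phi> (x + u n) - \<phi> x))\<^sup>2) < e / 16"
    by (auto simp: eventually_sequentially)
  have "norm ((LBINT x. (cmod (f (x + u n) - f x))\<^sup>2) - 0) < e" if n: "n \<ge> no" for n
  proof -
    define r where "r x = f x - \<phi> x" for x
    have r: "in_Lq 2 r" unfolding r_def by (intro in_L2_diff f \<phi>)
    have r2: "in_Lq 2 (\<lambda>x. r (x + u n))" by (rule in_L2_shift[OF r])
    have p2: "in_Lq 2 (\<lambda>x. \<phi> (x + u n) - \<phi> x)" by (intro in_L2_diff in_L2_shift \<phi>)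
    have f2: "in_Lq 2 (\<lambda>x. f (x + u n) - f x)" by (intro in_L2_diff in_L2_shift f)
    have "(LBINT x. (cmod (f (x + u n) - f x))\<^sup>2)
       \<le> (LBINT x. 4 * (cmod (r (x + u n)))\<^sup>2 + 4 * (cmod (r x))\<^sup>2 + 2 * (cmod (\<phi> (x + u n) - \<phi> x))\<^sup>2)"
    proof (rule integral_mono)
      fix x
      have "f (x + u n) - f x = (r (x + u n) - r x) + (\<phi> (x + u n) - \<phi> x)" by (simp add: r_def)
      then show "(cmod (f (x + u n) - f x))\<^sup>2
        \<le> 4 * (cmod (r (x + u n)))\<^sup>2 + 4 * (cmod (r x))\<^sup>2 + 2 * (cmod (\<phi> (x + u n) - \<phi> x))\<^sup>2"
        using cmod_add_sq[of "r (x + u n) - r x" "\<phi> (x + u n) - \<phi> x"] cmod_add_sq[of "r (x + u n)" "- r x"]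
        by simp
    qed (use r r2 p2 f2 in \<open>auto simp: in_L2_iff\<close>)
    also have "\<dots> = 4 * (LBINT x. (cmod (r (x + u n)))\<^sup>2) + 4 * (LBINT x. (cmod (r x))\<^sup>2)
        + 2 * (LBINT x. (cmod (\<phi> (x + u n) - \<phi> x))\<^sup>2)"
      using r r2 p2 by (simp add: in_L2_iff)
    also have "(LBINT x. (cmod (r (x + u n)))\<^sup>2) = (LBINT x. (cmod (r x))\<^sup>2)"
      by (rule integral_shift)
    also have "4 * (LBINT x. (cmod (r x))\<^sup>2) + 4 * (LBINT x. (cmod (r x))\<^sup>2)
        + 2 * (LBINT x. (cmod (\<phi> (x + u n) - \<phi> x))\<^sup>2) < e"
      using \<phi>(5) no[OF n] e unfolding r_def by linarith
    finally have "(LBINT x. (cmod (f (x + u n) - f x))\<^sup>2) < e" .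
    moreover have "0 \<le> (LBINT x. (cmod (f (x + u n) - f x))\<^sup>2)" by simp
    ultimately show ?thesis by simp
  qed
  then show "\<exists>no. \<forall>n\<ge>no. norm ((LBINT x. (cmod (f (x + u n) - f x))\<^sup>2) - 0) < e" by blast
qed


section \<open>Plancherel identity\<close>

lemma borel_measurable_cnj [measurable (raw)]:
  "f \<in> borel_measurable M \<Longrightarrow> (\<lambda>x. cnj (f x)) \<in> borel_measurable M"
  by (rule borel_measurable_continuous_on[OF continuous_on_cnj[OF continuous_on_id]])

lemma in_L2_cnj: "in_Lq 2 f \<Longrightarrow> in_Lq 2 (\<lambda>x. cnj (f x))"
  by (auto simp: in_L2_iff intro: borel_measurable_cnj)

definition ft :: "(real \<Rightarrow> complex) \<Rightarrow> real \<Rightarrow> complex" where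
  "ft f \<xi> = (LBINT x. cis (- (x * \<xi>)) * f x)"

lemma ft_integrable: "integrable lborel f \<Longrightarrow> integrable lborel (\<lambda>x. cis (- (x * \<xi>)) * f x)"
  by (rule Bochner_Integration.integrable_bound[of lborel f]) (auto simp: norm_mult)

lemma ft_measurable [measurable (raw)]:
  assumes [measurable]: "f \<in> borel_measurable borel"
  shows "ft f \<in> borel_measurable borel"
  unfolding ft_def[abs_def] by measurable

lemma norm_ft_le: "integrable lborel f \<Longrightarrow> cmod (ft f \<xi>) \<le> (LBINT x. cmod (f x))"
  unfolding ft_def by (rule order_trans[OF integral_norm_bound]) (simp add: norm_mult)

text \<open>Justifies exchanging integrals in the presence of an oscillating factor: the modulus is
  at most that of a product of integrable functions.\<close>

lemma integrable_prod_kernel: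
  fixes f g :: "real \<Rightarrow> complex"
  assumes f: "integrable lborel f" and g: "integrable lborel g"
    and k: "k \<in> borel_measurable (lborel \<Otimes>\<^sub>M lborel)" "\<And>z. cmod (k z) \<le> 1"
  shows "integrable (lborel \<Otimes>\<^sub>M lborel) (\<lambda>(x, u). k (x, u) * (f x * g u))"
proof (rule lborel_pair.Fubini_integrable)
  have [measurable]: "f \<in> borel_measurable borel" "g \<in> borel_measurable borel"
    "k \<in> borel_measurable (lborel \<Otimes>\<^sub>M lborel)"
    using f g k by auto
  show "(\<lambda>(x, u). k (x, u) * (f x * g u)) \<in> borel_measurable (lborel \<Otimes>\<^sub>M lborel)" by measurable
  have i: "integrable lborel (\<lambda>u. k (x, u) * (f x * g u))" for x
  proof (rule Bochner_Integration.integrable_bound)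
    show "integrable lborel (\<lambda>u. f x * g u)" using g by simp
    show "AE u in lborel. norm (k (x, u) * (f x * g u)) \<le> norm (f x * g u)"
      using k(2) by (auto simp: norm_mult intro!: mult_left_le_one_le)
  qed measurable
  then show "AE x in lborel. integrable lborel (\<lambda>u. case (x, u) of (x, u) \<Rightarrow> k (x, u) * (f x * g u))" by simp
  have bd: "(LBINT u. norm (k (x, u) * (f x * g u))) \<le> cmod (f x) * (LBINT u. cmod (g u))" for x
  proof -
    have "(LBINT u. norm (k (x, u) * (f x * g u))) \<le> (LBINT u. cmod (f x) * cmod (g u))"
    proof (rule integral_mono[OF integrable_norm[OF i]])
      show "integrable lborel (\<lambda>u. cmod (f x) * cmod (g u))" using g by simp
      show "norm (k (x, u) * (f x * g u)) \<le> cmod (f x) * cmod (g u)" for u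
        using k(2) by (auto simp: norm_mult intro!: mult_left_le_one_le)
    qed
    then show ?thesis by simp
  qed
  have nn: "0 \<le> (LBINT u. norm (k (x, u) * (f x * g u)))" for x
    by (rule Bochner_Integration.integral_nonneg) simp
  show "integrable lborel (\<lambda>x. LBINT u. norm (case (x, u) of (x, u) \<Rightarrow> k (x, u) * (f x * g u)))"
    unfolding prod.case
  proof (rule Bochner_Integration.integrable_bound)
    show "integrable lborel (\<lambda>x. cmod (f x) * (LBINT u. cmod (g u)))" using f by simp
    show "AE x in lborel. norm (LBINT u. norm (k (x, u) * (f x * g u)))
        \<le> norm (cmod (f x) * (LBINT u. cmod (g u)))"
    proof (intro AE_I2)
      fix x
      show "norm (LBINT u. norm (k (x, u) * (f x * g u))) \<le> norm (cmod (f x) * (LBINT u. cmod (g u)))"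
        unfolding real_norm_def abs_of_nonneg[OF nn] by (rule order_trans[OF bd abs_ge_self])
    qed
  qed measurable
qed

lemma ft_multiplication:
  assumes f: "integrable lborel f" and g: "integrable lborel g"
  shows "(LBINT \<xi>. ft f \<xi> * g \<xi>) = (LBINT x. f x * ft g x)"
proof -
  have "(LBINT \<xi>. ft f \<xi> * g \<xi>) = (LBINT \<xi>. LBINT x. cis (- (x * \<xi>)) * (f x * g \<xi>))"
  proof (intro Bochner_Integration.integral_cong refl)
    fix \<xi>
    show "ft f \<xi> * g \<xi> = (LBINT x. cis (- (x * \<xi>)) * (f x * g \<xi>))"
      using ft_integrable[OF f, of \<xi>] by (simp add: ft_def mult.assoc[symmetric])
  qed
  also have "\<dots> = (LBINT x. LBINT \<xi>. cis (- (x * \<xi>)) * (f x * g \<xi>))"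
  proof (rule lborel_pair.Fubini_integral)
    show "integrable (lborel \<Otimes>\<^sub>M lborel) (\<lambda>(x, \<xi>). cis (- (x * \<xi>)) * (f x * g \<xi>))"
      using integrable_prod_kernel[OF f g, of "\<lambda>(x, \<xi>). cis (- (x * \<xi>))"] by (auto simp: case_prod_beta)
  qed
  also have "\<dots> = (LBINT x. f x * ft g x)"
  proof (intro Bochner_Integration.integral_cong refl)
    fix x
    have "(LBINT \<xi>. cis (- (x * \<xi>)) * (f x * g \<xi>)) = (LBINT \<xi>. f x * (cis (- (\<xi> * x)) * g \<xi>))"
      by (simp add: mult_ac)
    then show "(LBINT \<xi>. cis (- (x * \<xi>)) * (f x * g \<xi>)) = f x * ft g x"
      using ft_integrable[OF g, of x] by (simp add: ft_def)
  qed
  finally show ?thesis .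
qed

lemma cnj_ft: "cnj (ft f \<xi>) = (LBINT x. cis (x * \<xi>) * cnj (f x))"
  unfolding ft_def by (subst Bochner_Integration.integral_cnj[symmetric]) (simp add: cis_cnj)

text \<open>Polarisation. It expresses the autocorrelation through the L2 modulus of continuity, so
  that its continuity at \<open>u = 0\<close> becomes that of translations.\<close>

lemma autocorrelation:
  assumes f: "in_Lq 2 f"
  shows "(LBINT x. f x \<bullet> f (x + u))
    = (LBINT x. (cmod (f x))\<^sup>2) - (LBINT x. (cmod (f (x + u) - f x))\<^sup>2) / 2"
proof -
  have s: "in_Lq 2 (\<lambda>x. f (x + u))" by (rule in_L2_shift[OF f])
  have "(cmod (f (x + u) - f x))\<^sup>2 = (cmod (f (x + u)))\<^sup>2 + (cmod (f x))\<^sup>2 - 2 * (f x \<bullet> f (x + u))" for x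
    by (simp add: power2_norm_eq_inner inner_diff_left inner_diff_right inner_commute)
  then have "(LBINT x. (cmod (f (x + u) - f x))\<^sup>2)
     = (LBINT x. (cmod (f (x + u)))\<^sup>2) + (LBINT x. (cmod (f x))\<^sup>2) - 2 * (LBINT x. f x \<bullet> f (x + u))"
    using f s integrable_inner_L2[OF f s] by (simp add: in_L2_iff)
  also have "(LBINT x. (cmod (f (x + u)))\<^sup>2) = (LBINT x. (cmod (f x))\<^sup>2)" by (rule integral_shift)
  finally show ?thesis by linarith
qed

text \<open>The Gaussian weight makes the square of the transform integrable before Plancherel is
  available. The multiplication formula turns the weight into a Gaussian in \<open>u\<close>, tested
  against the autocorrelation of \<open>f\<close>.\<close>

lemma ft_gauss_regularized:
  assumes f: "integrable lborel f" "in_Lq 2 f" and e: "e > 0"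
  shows "integrable lborel (\<lambda>\<xi>. (cmod (ft f \<xi>))\<^sup>2 * exp (- e * \<xi>\<^sup>2))"
    and "(LBINT \<xi>. (cmod (ft f \<xi>))\<^sup>2 * exp (- e * \<xi>\<^sup>2))
      = (LBINT u. sqrt (pi / e) * exp (- u\<^sup>2 / (4 * e)) * (LBINT x. f x \<bullet> f (x + u)))"
proof -
  have [measurable]: "f \<in> borel_measurable borel" using f by auto
  define g where "g \<xi> = complex_of_real (exp (- e * \<xi>\<^sup>2))" for \<xi> :: real
  have g: "integrable lborel (\<lambda>\<xi>. exp (- e * \<xi>\<^sup>2))"
    using gauss_integral[OF e] by (simp add: has_bochner_integral_iff)
  define B where "B = (LBINT x. cmod (f x))"
  have B: "cmod (ft f \<xi>) \<le> B" for \<xi> unfolding B_def by (rule norm_ft_le[OF f(1)])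
  define k where "k \<xi> = g \<xi> * ft f \<xi>" for \<xi>
  have k: "integrable lborel k"
  proof (rule Bochner_Integration.integrable_bound)
    show "integrable lborel (\<lambda>\<xi>. exp (- e * \<xi>\<^sup>2) * B)" using g by (rule integrable_mult_left)
    show "AE \<xi> in lborel. norm (k \<xi>) \<le> norm (exp (- e * \<xi>\<^sup>2) * B)"
      using B by (auto simp: k_def g_def norm_mult abs_mult intro!: order_trans[OF _ abs_ge_self] mult_left_mono)
  qed (simp add: k_def[abs_def] g_def)
  have "integrable lborel (\<lambda>\<xi>. cmod (k \<xi>) * B)" using k by simp
  then show int: "integrable lborel (\<lambda>\<xi>. (cmod (ft f \<xi>))\<^sup>2 * exp (- e * \<xi>\<^sup>2))"
  proof (rule Bochner_Integration.integrable_bound)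
    have "(cmod (ft f \<xi>))\<^sup>2 * exp (- e * \<xi>\<^sup>2) \<le> \<bar>cmod (k \<xi>) * B\<bar>" for \<xi>
    proof -
      have "cmod (ft f \<xi>) * (exp (- e * \<xi>\<^sup>2) * cmod (ft f \<xi>)) \<le> B * (exp (- e * \<xi>\<^sup>2) * cmod (ft f \<xi>))"
        by (intro mult_right_mono B) auto
      also have "\<dots> = cmod (k \<xi>) * B" by (simp add: k_def g_def norm_mult)
      also have "\<dots> \<le> \<bar>cmod (k \<xi>) * B\<bar>" by (rule abs_ge_self)
      finally show ?thesis by (simp add: power2_eq_square mult_ac)
    qed
    then show "AE \<xi> in lborel. norm ((cmod (ft f \<xi>))\<^sup>2 * exp (- e * \<xi>\<^sup>2)) \<le> norm (cmod (k \<xi>) * B)" by simp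
  qed measurable
  \<comment> \<open>The Fourier transform of the weight \<open>g\<close>. Its integral is
    \<open>2 * pi\<close> for every \<open>e\<close>, which is the origin of the constant in
    Plancherel's identity.\<close>
  define G where "G u = sqrt (pi / e) * exp (- u\<^sup>2 / (4 * e))" for u
  have ift: "cnj (ft (\<lambda>\<xi>. cnj (k \<xi>)) x) = (LBINT u. complex_of_real (G u) * f (x + u))" for x
  proof -
    have h: "integrable lborel (\<lambda>\<xi>. g \<xi> * cis (x * \<xi>))"
      using gauss_fourier[OF e, of x] by (simp add: has_bochner_integral_iff g_def)
    have fth: "ft (\<lambda>\<xi>. g \<xi> * cis (x * \<xi>)) y = complex_of_real (G (y - x))" for y
    proof -
      have "ft (\<lambda>\<xi>. g \<xi> * cis (x * \<xi>)) y = (LBINT \<xi>. g \<xi> * cis ((x - y) * \<xi>))"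
        unfolding ft_def by (intro Bochner_Integration.integral_cong refl)
          (simp add: mult.left_commute cis_mult algebra_simps)
      also have "\<dots> = complex_of_real (G (x - y))"
        using gauss_fourier[OF e, of "x - y"] by (simp add: has_bochner_integral_iff g_def G_def)
      finally show ?thesis by (simp add: G_def power2_commute)
    qed
    have "cnj (ft (\<lambda>\<xi>. cnj (k \<xi>)) x) = (LBINT \<xi>. ft f \<xi> * (g \<xi> * cis (x * \<xi>)))"
      unfolding ft_def[of "\<lambda>\<xi>. cnj (k \<xi>)"]
      by (subst Bochner_Integration.integral_cnj[symmetric]) (simp add: cis_cnj k_def mult_ac)
    also have "\<dots> = (LBINT y. f y * complex_of_real (G (y - x)))"
      unfolding ft_multiplication[OF f(1) h] fth ..
    also have "\<dots> = (LBINT u. f (u + x) * complex_of_real (G (u + x - x)))"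
      by (rule integral_shift[symmetric])
    finally show ?thesis by (simp add: add.commute mult.commute)
  qed
  have GB: "0 \<le> G u" "G u \<le> sqrt (pi / e)" for u using e by (auto simp: G_def mult_left_le)
  have [measurable]: "G \<in> borel_measurable borel" unfolding G_def by measurable
  have P: "integrable (lborel \<Otimes>\<^sub>M lborel) (\<lambda>(x, u). complex_of_real (G u) * (f (x + u) * cnj (f x)))"
  proof (rule Bochner_Integration.integrable_bound)
    show "integrable (lborel \<Otimes>\<^sub>M lborel) (\<lambda>z. sqrt (pi / e) *\<^sub>R (case z of (x, u) \<Rightarrow> f (x + u) * cnj (f x)))"
      using f by (intro integrable_scaleR_right integrable_prod_shift) auto
    show "AE z in lborel \<Otimes>\<^sub>M lborel. norm (case z of (x, u) \<Rightarrow> complex_of_real (G u) * (f (x + u) * cnj (f x)))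
        \<le> norm (sqrt (pi / e) *\<^sub>R (case z of (x, u) \<Rightarrow> f (x + u) * cnj (f x)))"
      using GB e by (intro AE_I2) (auto simp: norm_mult split: prod.split intro!: mult_right_mono)
  qed measurable
  have "complex_of_real (LBINT \<xi>. (cmod (ft f \<xi>))\<^sup>2 * exp (- e * \<xi>\<^sup>2))
      = (LBINT \<xi>. cnj (ft f \<xi> * cnj (k \<xi>)))"
    unfolding integral_complex_of_real[symmetric]
    by (intro Bochner_Integration.integral_cong refl)
      (simp add: k_def g_def complex_norm_square mult_ac flip: of_real_power)
  also have "\<dots> = cnj (LBINT x. f x * ft (\<lambda>\<xi>. cnj (k \<xi>)) x)"
  proof -
    have "(LBINT \<xi>. ft f \<xi> * cnj (k \<xi>)) = (LBINT x. f x * ft (\<lambda>\<xi>. cnj (k \<xi>)) x)"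
      using k by (intro ft_multiplication f(1)) auto
    then show ?thesis by (simp only: Bochner_Integration.integral_cnj)
  qed
  also have "\<dots> = (LBINT x. cnj (f x) * cnj (ft (\<lambda>\<xi>. cnj (k \<xi>)) x))"
    by (simp only: Bochner_Integration.integral_cnj[symmetric] complex_cnj_mult)
  also have "\<dots> = (LBINT x. LBINT u. complex_of_real (G u) * (f (x + u) * cnj (f x)))"
    unfolding ift by (intro Bochner_Integration.integral_cong refl) (simp add: mult_ac flip: integral_mult_right_zero)
  also have "\<dots> = (LBINT u. LBINT x. complex_of_real (G u) * (f (x + u) * cnj (f x)))"
    by (rule lborel_pair.Fubini_integral[symmetric, OF P])
  finally have eq: "complex_of_real (LBINT \<xi>. (cmod (ft f \<xi>))\<^sup>2 * exp (- e * \<xi>\<^sup>2))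
      = (LBINT u. LBINT x. complex_of_real (G u) * (f (x + u) * cnj (f x)))" .
  have "(LBINT \<xi>. (cmod (ft f \<xi>))\<^sup>2 * exp (- e * \<xi>\<^sup>2))
      = Re (LBINT u. LBINT x. complex_of_real (G u) * (f (x + u) * cnj (f x)))"
    unfolding eq[symmetric] by simp
  also have "\<dots> = (LBINT u. Re (LBINT x. complex_of_real (G u) * (f (x + u) * cnj (f x))))"
    by (rule Bochner_Integration.integral_Re[symmetric, OF lborel_pair.integrable_snd[OF P]])
  also have "\<dots> = (LBINT u. G u * (LBINT x. f x \<bullet> f (x + u)))"
  proof (intro Bochner_Integration.integral_cong refl)
    fix u
    have fi: "integrable lborel (\<lambda>x. f (x + u) * cnj (f x))"
      by (intro integrable_mult_L2 in_L2_shift in_L2_cnj f)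
    have "Re (LBINT x. complex_of_real (G u) * (f (x + u) * cnj (f x)))
        = G u * Re (LBINT x. f (x + u) * cnj (f x))" by simp
    also have "Re (LBINT x. f (x + u) * cnj (f x)) = (LBINT x. Re (f (x + u) * cnj (f x)))"
      by (rule Bochner_Integration.integral_Re[symmetric, OF fi])
    also have "\<dots> = (LBINT x. f x \<bullet> f (x + u))"
      by (intro Bochner_Integration.integral_cong refl) (simp add: inner_complex_def)
    finally show "Re (LBINT x. complex_of_real (G u) * (f (x + u) * cnj (f x)))
        = G u * (LBINT x. f x \<bullet> f (x + u))" .
  qed
  finally show "(LBINT \<xi>. (cmod (ft f \<xi>))\<^sup>2 * exp (- e * \<xi>\<^sup>2))
      = (LBINT u. sqrt (pi / e) * exp (- u\<^sup>2 / (4 * e)) * (LBINT x. f x \<bullet> f (x + u)))"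
    by (simp add: G_def)
qed

text \<open>The Gaussian weight tends to 1. The weighted integrals increase, so their limit gives
  both the integrability of \<open>(cmod (ft f \<xi>))\<^sup>2\<close> and its integral, while the
  side with the autocorrelation concentrates at \<open>u = 0\<close> by continuity of
  translations.\<close>

lemma plancherel_L1_L2:
  assumes f: "integrable lborel f" "in_Lq 2 f"
  shows "in_Lq 2 (ft f)"
    and "(LBINT \<xi>. (cmod (ft f \<xi>))\<^sup>2) = 2 * pi * (LBINT x. (cmod (f x))\<^sup>2)"
proof -
  have [measurable]: "f \<in> borel_measurable borel" using f by auto
  define N where "N = (LBINT x. (cmod (f x))\<^sup>2)"
  have N: "N \<ge> 0" by (simp add: N_def)
  define D where "D u = (LBINT x. (cmod (f (x + u) - f x))\<^sup>2)" for u
  have [measurable]: "D \<in> borel_measurable borel" unfolding D_def by measurable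
  have D0: "0 \<le> D u" for u by (simp add: D_def)
  have D4: "D u \<le> 4 * N" for u
  proof -
    have s: "in_Lq 2 (\<lambda>x. f (x + u))" by (rule in_L2_shift[OF f(2)])
    have "(cmod (f (x + u) - f x))\<^sup>2 \<le> 2 * ((cmod (f (x + u)))\<^sup>2 + (cmod (f x))\<^sup>2)" for x
      using cmod_add_sq[of "f (x + u)" "- f x"] by simp
    then have "D u \<le> (LBINT x. 2 * ((cmod (f (x + u)))\<^sup>2 + (cmod (f x))\<^sup>2))" unfolding D_def
      using f s in_L2_diff[OF s f(2)] by (intro integral_mono) (auto simp: in_L2_iff)
    also have "\<dots> = 2 * ((LBINT x. (cmod (f (x + u)))\<^sup>2) + N)"
      using f s by (simp add: in_L2_iff N_def)
    also have "(LBINT x. (cmod (f (x + u)))\<^sup>2) = N" unfolding N_def by (rule integral_shift)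
    finally show ?thesis by simp
  qed
  define e where "e n = 1 / (real n + 1)" for n
  have e: "e n > 0" for n by (simp add: e_def)
  define R where "R n = (LBINT \<xi>. (cmod (ft f \<xi>))\<^sup>2 * exp (- e n * \<xi>\<^sup>2))" for n
  \<comment> \<open>Substituting \<open>u = 2 * sqrt (e n) * z\<close> moves the dependence on
    \<open>n\<close> into the argument of \<open>D\<close> and leaves a fixed Gaussian as dominating
    function.\<close>
  have R_eq: "R n = (LBINT z. 2 * sqrt pi * exp (- 1 * z\<^sup>2) * (N - D (0 + 2 * sqrt (e n) * z) / 2))" for n
  proof -
    have "R n = (LBINT u. sqrt (pi / e n) * exp (- u\<^sup>2 / (4 * e n)) * (N - D u / 2))"
      unfolding R_def ft_gauss_regularized(2)[OF f e] autocorrelation[OF f(2)] N_def D_def ..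
    also have "\<dots> = 2 * sqrt (e n) * (LBINT z. sqrt (pi / e n) * exp (- (0 + 2 * sqrt (e n) * z)\<^sup>2 / (4 * e n)) * (N - D (0 + 2 * sqrt (e n) * z) / 2))"
      using e[of n] by (subst lborel_integral_real_affine[where c = "2 * sqrt (e n)" and t = 0]) auto
    also have "\<dots> = (LBINT z. 2 * sqrt (e n) * (sqrt (pi / e n) * exp (- (0 + 2 * sqrt (e n) * z)\<^sup>2 / (4 * e n)) * (N - D (0 + 2 * sqrt (e n) * z) / 2)))"
      by simp
    also have "\<dots> = (LBINT z. 2 * sqrt pi * exp (- 1 * z\<^sup>2) * (N - D (0 + 2 * sqrt (e n) * z) / 2))"
      using e[of n] by (intro Bochner_Integration.integral_cong refl) (simp add: power_mult_distrib real_sqrt_divide)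
    finally show ?thesis .
  qed
  have g: "has_bochner_integral lborel (\<lambda>z. exp (- 1 * z\<^sup>2)) (sqrt (pi / 1))" by (rule gauss_integral) simp
  have "R \<longlonglongrightarrow> (LBINT z. 2 * sqrt pi * exp (- 1 * z\<^sup>2) * (N - 0 / 2))"
    unfolding R_eq[abs_def]
  proof (rule integral_dominated_convergence)
    show "integrable lborel (\<lambda>z. 2 * sqrt pi * exp (- 1 * z\<^sup>2) * N)"
      using g by (intro integrable_mult_left integrable_mult_right) (simp add: has_bochner_integral_iff)
    have "(\<lambda>n. 2 * sqrt (e n) * z) \<longlonglongrightarrow> 2 * sqrt 0 * z" for z
      unfolding e_def by (intro tendsto_intros tendsto_one_over_Suc)
    then have "(\<lambda>n. D (0 + 2 * sqrt (e n) * z)) \<longlonglongrightarrow> 0" for z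
      unfolding D_def by (intro L2_shift_continuous[OF f(2)]) simp
    then have "(\<lambda>n. 2 * sqrt pi * exp (- 1 * z\<^sup>2) * (N - D (0 + 2 * sqrt (e n) * z) / 2))
        \<longlonglongrightarrow> 2 * sqrt pi * exp (- 1 * z\<^sup>2) * (N - 0 / 2)" for z
      by (intro tendsto_intros) auto
    then show "AE z in lborel. (\<lambda>n. 2 * sqrt pi * exp (- 1 * z\<^sup>2) * (N - D (0 + 2 * sqrt (e n) * z) / 2))
        \<longlonglongrightarrow> 2 * sqrt pi * exp (- 1 * z\<^sup>2) * (N - 0 / 2)" by simp
    have "\<bar>N - D u / 2\<bar> \<le> N" for u using D0[of u] D4[of u] by linarith
    then show "AE z in lborel. norm (2 * sqrt pi * exp (- 1 * z\<^sup>2) * (N - D (0 + 2 * sqrt (e n) * z) / 2))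
        \<le> 2 * sqrt pi * exp (- 1 * z\<^sup>2) * N" for n
      by (intro AE_I2) (auto simp: abs_mult intro!: mult_left_mono)
  qed measurable
  also have "(LBINT z. 2 * sqrt pi * exp (- 1 * z\<^sup>2) * (N - 0 / 2)) = 2 * sqrt pi * sqrt pi * N"
    using g by (simp add: has_bochner_integral_iff)
  also have "\<dots> = 2 * pi * N" by simp
  finally have Rlim: "R \<longlonglongrightarrow> 2 * pi * N" .
  define F where "F n \<xi> = ennreal ((cmod (ft f \<xi>))\<^sup>2 * exp (- e n * \<xi>\<^sup>2))" for n \<xi>
  have F_inc: "incseq F"
    unfolding F_def incseq_def le_fun_def e_def
    by (intro allI impI ennreal_leI mult_left_mono) (auto intro!: mult_right_mono simp: field_simps)
  have "(\<lambda>n. integral\<^sup>N lborel (F n)) \<longlonglongrightarrow> (\<integral>\<^sup>+\<xi>. ennreal ((cmod (ft f \<xi>))\<^sup>2) \<partial>lborel)"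
  proof (rule nn_integral_LIMSEQ[OF F_inc])
    show "F n \<in> borel_measurable lborel" for n unfolding F_def by measurable
    have "(\<lambda>n. exp (- e n * \<xi>\<^sup>2)) \<longlonglongrightarrow> exp (- 0 * \<xi>\<^sup>2)" for \<xi>
      unfolding e_def by (intro tendsto_intros tendsto_one_over_Suc)
    from tendsto_ennrealI[OF tendsto_mult[OF tendsto_const this]]
    show "(\<lambda>n. F n \<xi>) \<longlonglongrightarrow> ennreal ((cmod (ft f \<xi>))\<^sup>2)" for \<xi>
      unfolding F_def by simp
  qed
  moreover have "integral\<^sup>N lborel (F n) = ennreal (R n)" for n
    unfolding F_def R_def by (intro nn_integral_eq_integral ft_gauss_regularized(1)[OF f e]) auto
  moreover have "(\<lambda>n. ennreal (R n)) \<longlonglongrightarrow> ennreal (2 * pi * N)"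
    using Rlim by (rule tendsto_ennrealI)
  ultimately have nn: "(\<integral>\<^sup>+\<xi>. ennreal ((cmod (ft f \<xi>))\<^sup>2) \<partial>lborel) = ennreal (2 * pi * N)"
    by (simp add: LIMSEQ_unique)
  show "in_Lq 2 (ft f)"
    unfolding in_L2_iff using nn by (auto intro!: integrableI_bounded)
  show "(LBINT \<xi>. (cmod (ft f \<xi>))\<^sup>2) = 2 * pi * (LBINT x. (cmod (f x))\<^sup>2)"
    using nn N by (subst integral_eq_nn_integral) (auto simp: N_def)
qed


section \<open>The Fourier transform on \<open>L\<^sup>2\<close>\<close>

lemma ft_cong_AE:
  assumes "f \<in> borel_measurable borel" "g \<in> borel_measurable borel" "AE x in lborel. f x = g x"
  shows "ft f = ft g"
proof
  fix \<xi>
  show "ft f \<xi> = ft g \<xi>"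
    unfolding ft_def by (rule integral_cong_AE) (use assms in auto)
qed

lemma ft_diff:
  assumes "integrable lborel f" "integrable lborel g"
  shows "ft (\<lambda>x. f x - g x) = (\<lambda>\<xi>. ft f \<xi> - ft g \<xi>)"
proof
  fix \<xi>
  show "ft (\<lambda>x. f x - g x) \<xi> = ft f \<xi> - ft g \<xi>"
    unfolding ft_def using ft_integrable[OF assms(1), of \<xi>] ft_integrable[OF assms(2), of \<xi>]
    by (simp add: right_diff_distrib)
qed

lemma ft_add:
  assumes "integrable lborel f" "integrable lborel g"
  shows "ft (\<lambda>x. f x + g x) = (\<lambda>\<xi>. ft f \<xi> + ft g \<xi>)"
proof
  fix \<xi>
  show "ft (\<lambda>x. f x + g x) \<xi> = ft f \<xi> + ft g \<xi>"
    unfolding ft_def using ft_integrable[OF assms(1), of \<xi>] ft_integrable[OF assms(2), of \<xi>]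
    by (simp add: distrib_left)
qed

lemma ft_scaleR: "ft (\<lambda>x. r *\<^sub>R f x) = (\<lambda>\<xi>. r *\<^sub>R ft f \<xi>)"
  unfolding ft_def by (intro ext) (simp only: mult_scaleR_right integral_scaleR_right)

lemma rep_l2_add: "AE x in lborel. rep_l2 (u + v) x = rep_l2 u x + rep_l2 v x"
  using rep_abs_l2[OF in_L2_add[OF in_L2_rep[of u] in_L2_rep[of v]]]
  by (simp add: abs_l2_add in_L2_rep abs_rep_l2)

lemma rep_l2_scaleR: "AE x in lborel. rep_l2 (r *\<^sub>R u) x = r *\<^sub>R rep_l2 u x"
  using rep_abs_l2[OF in_L2_scaleR[OF in_L2_rep[of u], of r]]
  by (simp only: abs_l2_scaleR[OF in_L2_rep] abs_rep_l2)

lemma rep_l2_measurable [measurable]: "rep_l2 u \<in> borel_measurable borel"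
  by (rule in_L2_measurable[OF in_L2_rep])

lemma inner_abs_l2:
  assumes "in_Lq 2 f" "in_Lq 2 g"
  shows "abs_l2 f \<bullet> abs_l2 g = (LBINT x. f x \<bullet> g x)"
  using assms by (simp add: inner_l2.abs_eq L2_rel_refl)

lemma norm_ft_diff:
  assumes f: "integrable lborel f" "in_Lq 2 f" and g: "integrable lborel g" "in_Lq 2 g"
  shows "norm (abs_l2 (ft f) - abs_l2 (ft g)) = sqrt (2 * pi) * norm (abs_l2 f - abs_l2 g)"
proof -
  have d: "integrable lborel (\<lambda>x. f x - g x)" "in_Lq 2 (\<lambda>x. f x - g x)"
    using f g by (auto intro: in_L2_diff)
  have "norm (abs_l2 (ft f) - abs_l2 (ft g)) = norm (abs_l2 (ft (\<lambda>x. f x - g x)))"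
    by (simp add: ft_diff f g abs_l2_diff plancherel_L1_L2)
  also have "\<dots> = sqrt (2 * pi) * norm (abs_l2 (\<lambda>x. f x - g x))"
    by (simp only: norm_abs_l2[OF plancherel_L1_L2(1)[OF d]] norm_abs_l2[OF d(2)]
        plancherel_L1_L2(2)[OF d] real_sqrt_mult)
  finally show ?thesis by (simp only: abs_l2_diff[OF f(2) g(2)])
qed

section \<open>Truncations and the limit in mean\<close>

definition cutoff :: "real \<Rightarrow> l2 \<Rightarrow> real \<Rightarrow> complex" where
  "cutoff R u x = indicator {- R..R} x *\<^sub>R rep_l2 u x"

lemma cutoff_measurable [measurable]: "cutoff R u \<in> borel_measurable borel"
  unfolding cutoff_def[abs_def] by measurable

lemma in_L2_cutoff: "in_Lq 2 (cutoff R u)"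
  by (rule in_L2_mono[OF in_L2_rep[of u]]) (auto simp: cutoff_def indicator_def)

lemma integrable_cutoff: "integrable lborel (cutoff R u)"
proof (rule Bochner_Integration.integrable_bound)
  show "integrable lborel (\<lambda>x. indicator {- R..R} x + (cmod (rep_l2 u x))\<^sup>2)"
    using in_L2_rep[of u]
    by (intro Bochner_Integration.integrable_add integrable_real_indicator)
      (auto simp: in_L2_iff emeasure_lborel_Icc_eq)
  have "cmod (rep_l2 u x) \<le> 1 + (cmod (rep_l2 u x))\<^sup>2" for x
  proof -
    have "2 * cmod (rep_l2 u x) \<le> 1 + (cmod (rep_l2 u x))\<^sup>2"
      using sum_squares_bound[of 1 "cmod (rep_l2 u x)"] by simp
    then show ?thesis using norm_ge_zero[of "rep_l2 u x"] by linarith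
  qed
  then show "AE x in lborel. norm (cutoff R u x) \<le> norm (indicator {- R..R} x + (cmod (rep_l2 u x))\<^sup>2)"
    by (auto simp: cutoff_def indicator_def)
qed simp

lemma cutoff_tendsto: "((\<lambda>R. abs_l2 (cutoff R u)) \<longlongrightarrow> u) at_top"
proof (rule tendsto_at_topI_sequentially)
  fix X :: "nat \<Rightarrow> real" assume X: "filterlim X at_top sequentially"
  have "(\<lambda>n. abs_l2 (cutoff (X n) u)) \<longlonglongrightarrow> abs_l2 (rep_l2 u)"
  proof (rule l2_dominated_convergence(3)[OF in_L2_rep[of u], where C = 1])
    fix x
    have "\<forall>\<^sub>F n in sequentially. \<bar>x\<bar> \<le> X n" using X by (simp add: filterlim_at_top)
    then have "\<forall>\<^sub>F n in sequentially. cutoff (X n) u x = rep_l2 u x"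
      by (rule eventually_mono) (auto simp: cutoff_def indicator_def)
    then show "(\<lambda>n. cutoff (X n) u x) \<longlonglongrightarrow> rep_l2 u x" by (rule tendsto_eventually)
  qed (auto simp: cutoff_def indicator_def)
  then show "(\<lambda>n. abs_l2 (cutoff (X n) u)) \<longlonglongrightarrow> u" by (simp add: abs_rep_l2)
qed

lemma fourier_cutoff_eq: "fourier_cutoff R u = ft (cutoff R u)"
  by (auto simp: fourier_cutoff_def ft_def cutoff_def set_lebesgue_integral_def cis_conv_exp
      intro!: Bochner_Integration.integral_cong)

lemma nn_integral_sq_abs_l2:
  assumes h: "in_Lq 2 h"
  shows "(\<integral>\<^sup>+\<xi>. ennreal ((cmod (h \<xi> - rep_l2 g \<xi>))\<^sup>2) \<partial>lborel) = ennreal ((norm (abs_l2 h - g))\<^sup>2)"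
  unfolding nn_integral_sq_l2[symmetric]
  by (rule nn_integral_cong_AE) (use rep_abs_l2[OF h] in eventually_elim, simp)

abbreviation "ft_cutoff R f \<equiv> abs_l2 (ft (cutoff R f))"

text \<open>Plancherel puts the transform of a truncation in L2, so the nonnegative integral in the
  definition is a squared distance, and the limit in mean is convergence in the Hilbert
  space.\<close>

lemma is_fourier_iff: "is_fourier f g \<longleftrightarrow> ((\<lambda>R. ft_cutoff R f) \<longlongrightarrow> g) at_top"
proof -
  have "is_fourier f g \<longleftrightarrow> ((\<lambda>R. ennreal ((norm (ft_cutoff R f - g))\<^sup>2)) \<longlongrightarrow> ennreal 0) at_top"
    unfolding is_fourier_def fourier_cutoff_eq
    by (simp add: nn_integral_sq_abs_l2 plancherel_L1_L2 integrable_cutoff in_L2_cutoff)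
  also have "\<dots> \<longleftrightarrow> ((\<lambda>R. (norm (ft_cutoff R f - g))\<^sup>2) \<longlongrightarrow> 0) at_top"
  proof
    assume "((\<lambda>R. ennreal ((norm (ft_cutoff R f - g))\<^sup>2)) \<longlongrightarrow> ennreal 0) at_top"
    from tendsto_enn2real[OF this] show "((\<lambda>R. (norm (ft_cutoff R f - g))\<^sup>2) \<longlongrightarrow> 0) at_top" by simp
  qed (rule tendsto_ennrealI)
  also have "\<dots> \<longleftrightarrow> ((\<lambda>R. norm (ft_cutoff R f - g)) \<longlongrightarrow> 0) at_top"
  proof
    assume "((\<lambda>R. (norm (ft_cutoff R f - g))\<^sup>2) \<longlongrightarrow> 0) at_top"
    from tendsto_real_sqrt[OF this] show "((\<lambda>R. norm (ft_cutoff R f - g)) \<longlongrightarrow> 0) at_top" by simp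
  next
    assume "((\<lambda>R. norm (ft_cutoff R f - g)) \<longlongrightarrow> 0) at_top"
    from tendsto_power[OF this, of 2] show "((\<lambda>R. (norm (ft_cutoff R f - g))\<^sup>2) \<longlongrightarrow> 0) at_top" by simp
  qed
  finally show ?thesis by (simp only: tendsto_norm_zero_iff LIM_zero_iff)
qed

lemma is_fourier_exists: "\<exists>g. is_fourier f g"
proof -
  have iso: "norm (ft_cutoff R f - ft_cutoff R' f) = sqrt (2 * pi) * norm (abs_l2 (cutoff R f) - abs_l2 (cutoff R' f))" for R R'
    by (intro norm_ft_diff integrable_cutoff in_L2_cutoff)
  have cn: "(\<lambda>n. abs_l2 (cutoff (real n) f)) \<longlonglongrightarrow> f"
    by (rule filterlim_compose[OF cutoff_tendsto filterlim_real_sequentially])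
  have "Cauchy (\<lambda>n. ft_cutoff (real n) f)"
  proof (rule CauchyI)
    fix e :: real assume e: "0 < e"
    have "Cauchy (\<lambda>n. abs_l2 (cutoff (real n) f))" by (rule LIMSEQ_imp_Cauchy[OF cn])
    from CauchyD[OF this, of "e / sqrt (2 * pi)"] e
    obtain M where "\<And>m n. m \<ge> M \<Longrightarrow> n \<ge> M \<Longrightarrow>
        norm (abs_l2 (cutoff (real m) f) - abs_l2 (cutoff (real n) f)) < e / sqrt (2 * pi)" by auto
    then show "\<exists>M. \<forall>m\<ge>M. \<forall>n\<ge>M. norm (ft_cutoff (real m) f - ft_cutoff (real n) f) < e"
      unfolding iso by (intro exI[of _ M]) (auto simp: field_simps)
  qed
  then obtain g where g: "(\<lambda>n. ft_cutoff (real n) f) \<longlonglongrightarrow> g"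
    using Cauchy_convergent unfolding convergent_def by blast
  \<comment> \<open>The isometry passes to the limit in \<open>n\<close>; this upgrades convergence
    along the integers to convergence along all real \<open>R\<close>.\<close>
  have "norm (ft_cutoff R f - g) = sqrt (2 * pi) * norm (abs_l2 (cutoff R f) - f)" for R
  proof (rule LIMSEQ_unique)
    show "(\<lambda>n. norm (ft_cutoff R f - ft_cutoff (real n) f)) \<longlonglongrightarrow> norm (ft_cutoff R f - g)"
      by (intro tendsto_intros g)
    show "(\<lambda>n. norm (ft_cutoff R f - ft_cutoff (real n) f)) \<longlonglongrightarrow> sqrt (2 * pi) * norm (abs_l2 (cutoff R f) - f)"
      unfolding iso by (intro tendsto_intros cn)
  qed
  moreover have "((\<lambda>R. sqrt (2 * pi) * norm (abs_l2 (cutoff R f) - f)) \<longlongrightarrow> sqrt (2 * pi) * norm (f - f)) at_top"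
    by (intro tendsto_intros cutoff_tendsto)
  ultimately have "((\<lambda>R. norm (ft_cutoff R f - g)) \<longlongrightarrow> 0) at_top" by simp
  then show ?thesis by (auto simp: is_fourier_iff tendsto_norm_zero_iff LIM_zero_iff)
qed

lemma fourier_tendsto: "((\<lambda>R. ft_cutoff R f) \<longlongrightarrow> fourier f) at_top"
proof -
  have "\<exists>!g. is_fourier f g"
    using is_fourier_exists[of f] by (auto simp: is_fourier_iff intro: tendsto_unique[OF trivial_limit_at_top_linorder])
  then have "is_fourier f (fourier f)" unfolding fourier_def by (rule theI')
  then show ?thesis by (simp add: is_fourier_iff)
qed

lemma fourier_eqI: "((\<lambda>R. ft_cutoff R f) \<longlongrightarrow> g) at_top \<Longrightarrow> fourier f = g"
  by (rule tendsto_unique[OF trivial_limit_at_top_linorder fourier_tendsto])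

lemma norm_fourier: "norm (fourier f) = sqrt (2 * pi) * norm f"
proof (rule tendsto_unique[OF trivial_limit_at_top_linorder])
  show "((\<lambda>R. norm (ft_cutoff R f)) \<longlongrightarrow> norm (fourier f)) at_top" by (intro tendsto_intros fourier_tendsto)
  have "norm (ft_cutoff R f) = sqrt (2 * pi) * norm (abs_l2 (cutoff R f))" for R
    by (simp only: norm_abs_l2[OF plancherel_L1_L2(1)[OF integrable_cutoff in_L2_cutoff]] norm_abs_l2[OF in_L2_cutoff]
        plancherel_L1_L2(2)[OF integrable_cutoff in_L2_cutoff] real_sqrt_mult)
  then show "((\<lambda>R. norm (ft_cutoff R f)) \<longlongrightarrow> sqrt (2 * pi) * norm f) at_top"
    by (auto intro!: tendsto_intros cutoff_tendsto)
qed

lemma bounded_linear_fourier: "bounded_linear fourier"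
proof (rule bounded_linear_intro[where K = "sqrt (2 * pi)"])
  fix f g :: l2 and r :: real
  have "ft (cutoff R (f + g)) = ft (\<lambda>x. cutoff R f x + cutoff R g x)" for R
    by (rule ft_cong_AE) (use rep_l2_add[of f g] in \<open>auto elim!: eventually_mono simp: cutoff_def scaleR_add_right\<close>)
  then have "ft_cutoff R (f + g) = ft_cutoff R f + ft_cutoff R g" for R
    by (simp add: ft_add integrable_cutoff abs_l2_add plancherel_L1_L2 in_L2_cutoff)
  then show "fourier (f + g) = fourier f + fourier g"
    by (intro fourier_eqI) (auto intro!: tendsto_intros fourier_tendsto)
  have "ft (cutoff R (r *\<^sub>R f)) = ft (\<lambda>x. r *\<^sub>R cutoff R f x)" for R
    by (rule ft_cong_AE) (use rep_l2_scaleR[of r f] in \<open>auto elim!: eventually_mono simp: cutoff_def\<close>)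
  then have "ft_cutoff R (r *\<^sub>R f) = r *\<^sub>R ft_cutoff R f" for R
    by (simp only: ft_scaleR abs_l2_scaleR plancherel_L1_L2 in_L2_cutoff integrable_cutoff)
  then show "fourier (r *\<^sub>R f) = r *\<^sub>R fourier f"
    by (intro fourier_eqI) (auto intro!: tendsto_intros fourier_tendsto)
  show "norm (fourier f) \<le> norm f * sqrt (2 * pi)" by (simp add: norm_fourier)
qed

lemma fourier_abs_l2:
  assumes h: "integrable lborel h" "in_Lq 2 h"
  shows "fourier (abs_l2 h) = abs_l2 (ft h)"
proof (rule fourier_eqI)
  have "norm (ft_cutoff R (abs_l2 h) - abs_l2 (ft h)) = sqrt (2 * pi) * norm (abs_l2 (cutoff R (abs_l2 h)) - abs_l2 h)" for R
    by (intro norm_ft_diff integrable_cutoff in_L2_cutoff h)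
  moreover have "((\<lambda>R. sqrt (2 * pi) * norm (abs_l2 (cutoff R (abs_l2 h)) - abs_l2 h)) \<longlongrightarrow>
      sqrt (2 * pi) * norm (abs_l2 h - abs_l2 h)) at_top"
    by (intro tendsto_intros cutoff_tendsto)
  ultimately have "((\<lambda>R. norm (ft_cutoff R (abs_l2 h) - abs_l2 (ft h))) \<longlongrightarrow> 0) at_top" by simp
  then show "((\<lambda>R. ft_cutoff R (abs_l2 h)) \<longlongrightarrow> abs_l2 (ft h)) at_top"
    by (simp add: tendsto_norm_zero_iff LIM_zero_iff)
qed

section \<open>Inversion by means of complex conjugation\<close>

definition conj_l2 :: "l2 \<Rightarrow> l2" where
  "conj_l2 u = abs_l2 (\<lambda>x. cnj (rep_l2 u x))"

lemma conj_abs_l2: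
  assumes f: "in_Lq 2 f"
  shows "conj_l2 (abs_l2 f) = abs_l2 (\<lambda>x. cnj (f x))"
  unfolding conj_l2_def using rep_abs_l2[OF f]
  by (subst l2_abs_eq_iff) (auto intro!: in_L2_cnj in_L2_rep f elim!: eventually_mono)

lemma conj_conj_l2 [simp]: "conj_l2 (conj_l2 u) = u"
  by (simp add: conj_l2_def[of u] conj_abs_l2 in_L2_cnj in_L2_rep abs_rep_l2)

lemma norm_conj_l2 [simp]: "norm (conj_l2 u) = norm u"
proof -
  have "norm (conj_l2 u) = norm (abs_l2 (rep_l2 u))"
    by (simp add: conj_l2_def norm_abs_l2 in_L2_cnj in_L2_rep)
  then show ?thesis by (simp add: abs_rep_l2)
qed

lemma bounded_linear_conj_l2: "bounded_linear conj_l2"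
proof (rule bounded_linear_intro[where K = 1])
  fix u v :: l2 and r :: real
  have "conj_l2 (abs_l2 (\<lambda>x. rep_l2 u x + rep_l2 v x)) = abs_l2 (\<lambda>x. cnj (rep_l2 u x) + cnj (rep_l2 v x))"
    by (simp add: conj_abs_l2 in_L2_add in_L2_rep)
  also have "\<dots> = conj_l2 u + conj_l2 v"
    by (simp add: abs_l2_add in_L2_cnj in_L2_rep conj_l2_def)
  finally show "conj_l2 (u + v) = conj_l2 u + conj_l2 v"
    by (simp add: abs_l2_add in_L2_rep abs_rep_l2)
  have "conj_l2 (abs_l2 (\<lambda>x. r *\<^sub>R rep_l2 u x)) = abs_l2 (\<lambda>x. r *\<^sub>R cnj (rep_l2 u x))"
    by (simp only: conj_abs_l2 in_L2_scaleR in_L2_rep complex_cnj_scaleR)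
  also have "\<dots> = r *\<^sub>R conj_l2 u"
    by (simp only: abs_l2_scaleR in_L2_cnj in_L2_rep conj_l2_def)
  finally show "conj_l2 (r *\<^sub>R u) = r *\<^sub>R conj_l2 u"
    by (simp only: abs_l2_scaleR in_L2_rep abs_rep_l2)
qed simp

text \<open>The conjugate of the Fourier transform is symmetric for the real inner product, and isometric
  up to \<open>sqrt (2 pi)\<close>; so its square is \<open>2 pi\<close>, which inverts the Fourier transform.\<close>

lemma conj_fourier_symmetric: "conj_l2 (fourier f) \<bullet> g = f \<bullet> conj_l2 (fourier g)"
proof (rule tendsto_unique[OF trivial_limit_at_top_linorder])
  note tt = bounded_linear.tendsto[OF bounded_linear_conj_l2]
  show "((\<lambda>R. conj_l2 (ft_cutoff R f) \<bullet> abs_l2 (cutoff R g)) \<longlongrightarrow> conj_l2 (fourier f) \<bullet> g) at_top"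
    by (intro tendsto_intros tt fourier_tendsto cutoff_tendsto)
  have "conj_l2 (ft_cutoff R f) \<bullet> abs_l2 (cutoff R g) = abs_l2 (cutoff R f) \<bullet> conj_l2 (ft_cutoff R g)" for R
  proof -
    have L: "in_Lq 2 (ft (cutoff R u))" for u by (intro plancherel_L1_L2 integrable_cutoff in_L2_cutoff)
    have B: "(LBINT x. cnj (ft (cutoff R u) x) \<bullet> cutoff R v x) = Re (LBINT x. ft (cutoff R u) x * cutoff R v x)" for u v
    proof -
      have "integrable lborel (\<lambda>x. ft (cutoff R u) x * cutoff R v x)"
        by (intro integrable_mult_L2 L in_L2_cutoff)
      then have "Re (LBINT x. ft (cutoff R u) x * cutoff R v x) = (LBINT x. Re (ft (cutoff R u) x * cutoff R v x))"
        by (rule Bochner_Integration.integral_Re[symmetric])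
      then show ?thesis by (simp add: inner_complex_def)
    qed
    have "conj_l2 (ft_cutoff R f) \<bullet> abs_l2 (cutoff R g) = (LBINT x. cnj (ft (cutoff R f) x) \<bullet> cutoff R g x)"
      by (simp add: conj_abs_l2 L inner_abs_l2 in_L2_cnj in_L2_cutoff)
    also have "\<dots> = Re (LBINT x. ft (cutoff R f) x * cutoff R g x)" by (rule B)
    also have "(LBINT x. ft (cutoff R f) x * cutoff R g x) = (LBINT x. cutoff R f x * ft (cutoff R g) x)"
      by (rule ft_multiplication[OF integrable_cutoff integrable_cutoff])
    also have "\<dots> = (LBINT x. ft (cutoff R g) x * cutoff R f x)" by (simp only: mult.commute)
    also have "Re \<dots> = (LBINT x. cnj (ft (cutoff R g) x) \<bullet> cutoff R f x)" by (rule B[symmetric])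
    also have "\<dots> = (LBINT x. cutoff R f x \<bullet> cnj (ft (cutoff R g) x))" by (simp only: inner_commute)
    also have "\<dots> = abs_l2 (cutoff R f) \<bullet> conj_l2 (ft_cutoff R g)"
      by (simp add: conj_abs_l2 L inner_abs_l2 in_L2_cnj in_L2_cutoff)
    finally show ?thesis .
  qed
  then show "((\<lambda>R. conj_l2 (ft_cutoff R f) \<bullet> abs_l2 (cutoff R g)) \<longlongrightarrow> f \<bullet> conj_l2 (fourier g)) at_top"
    by (auto intro!: tendsto_intros tt fourier_tendsto cutoff_tendsto)
qed

text \<open>For \<open>K\<close> the conjugate of the transform, isometry gives
  \<open>norm (K (K f)) = 2 * pi * norm f\<close>, and symmetry with isometry gives
  \<open>K (K f) \<bullet> f = 2 * pi * (norm f)\<^sup>2\<close>. This is the equality case of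
  Cauchy-Schwarz, so the square of the difference expands to 0.\<close>

lemma conj_fourier_square: "conj_l2 (fourier (conj_l2 (fourier f))) = (2 * pi) *\<^sub>R f"
proof -
  define K where "K u = conj_l2 (fourier u)" for u
  have n: "(norm (K u))\<^sup>2 = 2 * pi * (norm u)\<^sup>2" for u
    by (simp add: K_def norm_fourier power_mult_distrib)
  have i: "K (K f) \<bullet> f = 2 * pi * (norm f)\<^sup>2"
    using conj_fourier_symmetric[of "K f" f] n[of f] unfolding K_def[symmetric] power2_norm_eq_inner by simp
  have "(norm (K (K f) - (2 * pi) *\<^sub>R f))\<^sup>2
      = (norm (K (K f)))\<^sup>2 - 2 * (2 * pi) * (K (K f) \<bullet> f) + (2 * pi)\<^sup>2 * (norm f)\<^sup>2"
  proof -
    have "(norm (a - c *\<^sub>R b))\<^sup>2 = (norm a)\<^sup>2 - 2 * c * (a \<bullet> b) + c\<^sup>2 * (norm b)\<^sup>2" for a b :: l2 and c :: real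
      unfolding power2_norm_eq_inner inner_diff_left inner_diff_right inner_scaleR_left inner_scaleR_right
        inner_commute[of b a] by (simp add: power2_eq_square algebra_simps)
    then show ?thesis by simp
  qed
  also have "\<dots> = 0" unfolding i n by (simp add: power2_eq_square)
  finally show ?thesis by (simp add: K_def)
qed

text \<open>The conjugate of the transform is its own inverse up to \<open>2 * pi\<close>; undoing
  the conjugation gives this formula, which inverts on both sides.\<close>

definition inv_fourier :: "l2 \<Rightarrow> l2" where
  "inv_fourier g = (1 / (2 * pi)) *\<^sub>R conj_l2 (fourier (conj_l2 g))"

lemma inv_fourier_fourier [simp]: "inv_fourier (fourier f) = f"
  by (simp add: inv_fourier_def conj_fourier_square)

lemma fourier_inv_fourier [simp]: "fourier (inv_fourier g) = g"
proof -
  have "conj_l2 (fourier (inv_fourier g)) = (1 / (2 * pi)) *\<^sub>R conj_l2 (fourier (conj_l2 (fourier (conj_l2 g))))"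
    unfolding inv_fourier_def
    by (simp only: linear_cmul[OF bounded_linear.linear[OF bounded_linear_fourier]]
        linear_cmul[OF bounded_linear.linear[OF bounded_linear_conj_l2]])
  also have "\<dots> = conj_l2 g" by (simp add: conj_fourier_square)
  finally show ?thesis by (metis conj_conj_l2)
qed

lemma bounded_linear_inv_fourier: "bounded_linear inv_fourier"
  unfolding inv_fourier_def[abs_def]
  by (intro bounded_linear_const_scaleR bounded_linear_compose[OF bounded_linear_conj_l2]
      bounded_linear_compose[OF bounded_linear_fourier] bounded_linear_conj_l2)

lemma norm_inv_fourier: "norm (inv_fourier g) = norm g / sqrt (2 * pi)"
  using norm_fourier[of "inv_fourier g"] by (simp add: field_simps)

lemma inv_fourier_abs_l2:
  assumes h: "integrable lborel h" "in_Lq 2 h"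
  shows "AE x in lborel. rep_l2 (inv_fourier (abs_l2 h)) x
    = (1 / (2 * pi)) *\<^sub>R (LBINT \<xi>. cis (\<xi> * x) * h \<xi>)"
proof -
  have c: "integrable lborel (\<lambda>x. cnj (h x))" "in_Lq 2 (\<lambda>x. cnj (h x))"
    using h by (auto intro: in_L2_cnj)
  have L: "in_Lq 2 (\<lambda>x. cnj (ft (\<lambda>x. cnj (h x)) x))" by (intro in_L2_cnj plancherel_L1_L2 c)
  have "inv_fourier (abs_l2 h) = abs_l2 (\<lambda>x. (1 / (2 * pi)) *\<^sub>R cnj (ft (\<lambda>x. cnj (h x)) x))"
    unfolding inv_fourier_def conj_abs_l2[OF h(2)] fourier_abs_l2[OF c]
      conj_abs_l2[OF plancherel_L1_L2(1)[OF c]] abs_l2_scaleR[OF L] ..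
  then show ?thesis
    using rep_abs_l2[OF in_L2_scaleR[OF L, of "1 / (2 * pi)"]] by (simp add: cnj_ft)
qed


section \<open>Occupation measure of an irregular path\<close>

text \<open>An instance of the shell estimate away from the singularity: balls of Lebesgue measure
  have growth exponent 1, the distance is \<open>1 + \<bar>a\<bar>\<close>, and the radius 1
  excludes no point.\<close>

lemma integrable_one_plus_abs_powr:
  assumes "\<delta> > 0"
  shows "integrable lborel (\<lambda>a::real. (1 + \<bar>a\<bar>) powr - (1 + \<delta>))"
proof (rule integrableI_bounded)
  have "(\<integral>\<^sup>+a. ennreal (if 1 \<le> 1 + \<bar>a\<bar> then (1 + \<bar>a\<bar>) powr - (1 + \<delta>) else 0) \<partial>lborel)
      \<le> ennreal (2 * 2 powr 1 / (1 - 2 powr (1 - (1 + \<delta>))) * 1 powr (1 - (1 + \<delta>)))"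
  proof (rule nn_integral_powr_far)
    fix r :: real assume r: "r > 0"
    have "{a \<in> space lborel. 1 + \<bar>a\<bar> < r} \<subseteq> {- r..r}" by auto
    then have "emeasure lborel {a \<in> space lborel. 1 + \<bar>a\<bar> < r} \<le> emeasure lborel {- r..r}"
      by (intro emeasure_mono) auto
    also have "\<dots> = ennreal (2 * r powr 1)" using r by simp
    finally show "emeasure lborel {a \<in> space lborel. 1 + \<bar>a\<bar> < r} \<le> ennreal (2 * r powr 1)" .
  qed (use assms in auto)
  then show "(\<integral>\<^sup>+a. ennreal (norm ((1 + \<bar>a\<bar>) powr - (1 + \<delta>))) \<partial>lborel) < \<infinity>"
    using le_less_trans[OF _ ennreal_less_top] by simp
qed measurable

text \<open>Trades the Gaussian for a power of \<open>1 + z\<close>; with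
  \<open>z = r * \<bar>a\<bar>\<close> a factor \<open>r powr (\<sigma> - 1)\<close> can then be
  split off from a function of \<open>a\<close> alone.\<close>

lemma gaussian_le_powr:
  fixes z :: real
  assumes z: "0 \<le> z" and \<sigma>: "0 < \<sigma>" "\<sigma> \<le> 1"
  shows "exp (- z\<^sup>2 / 2) \<le> 2 * (1 + z) powr (\<sigma> - 1)"
proof -
  have "1 + z \<le> 2 * (1 + z\<^sup>2 / 2)" using sum_squares_bound[of 1 z] z by simp
  also have "\<dots> \<le> 2 * exp (z\<^sup>2 / 2)" using exp_ge_add_one_self[of "z\<^sup>2 / 2"] by (intro mult_left_mono) auto
  finally have "exp (- z\<^sup>2 / 2) * (1 + z) \<le> exp (- z\<^sup>2 / 2) * (2 * exp (z\<^sup>2 / 2))"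
    by (intro mult_left_mono) auto
  also have "\<dots> = 2" by (simp add: exp_minus)
  finally have "exp (- z\<^sup>2 / 2) \<le> 2 / (1 + z)" using z by (simp add: field_simps)
  also have "\<dots> = 2 * (1 + z) powr - 1" using z by (simp add: powr_minus divide_inverse)
  also have "\<dots> \<le> 2 * (1 + z) powr (\<sigma> - 1)"
    using z \<sigma> by (intro mult_left_mono powr_mono) auto
  finally show ?thesis .
qed

text \<open>\<open>Phi w T\<close> is the Fourier transform of the occupation measure of
  \<open>w\<close> on \<open>{0..T}\<close>. The irregularity norm is evaluated on the increment
  from 0 to \<open>T\<close>, and \<open>T powr \<gamma>\<close> goes into \<open>N\<close>.\<close>

lemma irregular_decay:
  assumes T: "T > 0" and irr: "irregular \<rho> \<gamma> T w"
  shows "\<exists>N\<ge>0. \<forall>a. cmod (Phi w T a) \<le> N * (1 + \<bar>a\<bar>) powr - \<rho>"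
proof -
  obtain W where W: "W \<ge> 0" "W_norm \<rho> \<gamma> T w = ennreal W"
    using irr unfolding irregular_def by (cases "W_norm \<rho> \<gamma> T w") auto
  have Phi0: "Phi w 0 a = 0" for a
  proof -
    have "AE r in lborel. r \<noteq> (0::real)" by (rule AE_lborel_singleton)
    then show ?thesis unfolding Phi_def set_lebesgue_integral_def
      by (intro integral_eq_zero_AE) (auto elim!: eventually_mono)
  qed
  have "cmod (Phi w T a) \<le> W * T powr \<gamma> * (1 + \<bar>a\<bar>) powr - \<rho>" for a
  proof -
    have "ennreal ((1 + \<bar>a\<bar>) powr \<rho> * (cmod (Phi w T a - Phi w 0 a) / \<bar>T - 0\<bar> powr \<gamma>)) \<le> W_norm \<rho> \<gamma> T w"
      unfolding W_norm_def using T
      by (intro SUP_upper2[where i = a] SUP_upper2[where i = "(0, T)"]) auto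
    then have "(1 + \<bar>a\<bar>) powr \<rho> * (cmod (Phi w T a) / T powr \<gamma>) \<le> W"
      using W T by (simp add: Phi0)
    then have "(1 + \<bar>a\<bar>) powr - \<rho> * ((1 + \<bar>a\<bar>) powr \<rho> * cmod (Phi w T a)) \<le> (1 + \<bar>a\<bar>) powr - \<rho> * (W * T powr \<gamma>)"
      using T by (intro mult_left_mono) (auto simp: field_simps)
    moreover have "1 + \<bar>a\<bar> \<noteq> 0" using abs_ge_zero[of a] by linarith
    ultimately show ?thesis by (simp add: powr_minus field_simps)
  qed
  then show ?thesis using W by (intro exI[of _ "W * T powr \<gamma>"]) auto
qed

text \<open>Integrating a Gaussian of width \<open>r\<close> around \<open>x\<close> along the path
  amounts, by Fubini, to integrating \<open>Phi w T\<close> against a Gaussian of width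
  \<open>1 / r\<close>. The decay with exponent \<rho> bounds this by a multiple of
  \<open>r powr (\<sigma> - 1)\<close>, and the normalisation of the Gaussian contributes the
  remaining factor \<open>r\<close>.\<close>

proposition irregular_ball_bound:
  assumes T: "T > 0" and irr: "irregular \<rho> \<gamma> T w" and w: "continuous_on {0..T} w"
    and \<sigma>: "0 < \<sigma>" "\<sigma> \<le> 1" "\<sigma> < \<rho>"
  shows "\<exists>A\<ge>0. \<forall>x r. r > 0 \<longrightarrow>
    emeasure (lebesgue_on {0..T}) {s\<in>{0..T}. \<bar>x - w s\<bar> < r} \<le> ennreal (A * r powr \<sigma>)"
proof -
  obtain N where N: "N \<ge> 0" "\<And>a. cmod (Phi w T a) \<le> N * (1 + \<bar>a\<bar>) powr - \<rho>"
    using irregular_decay[OF T irr] by blast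
  \<comment> \<open>Extension by zero gives a Borel function on the whole line; its values off
    \<open>{0..T}\<close> are always cut away by an indicator.\<close>
  define v where "v s = indicator {0..T} s *\<^sub>R w s" for s
  have [measurable]: "v \<in> borel_measurable borel"
    unfolding v_def by (rule borel_measurable_continuous_on_indicator[OF _ w]) simp
  define J where "J = (LBINT a. (1 + \<bar>a\<bar>) powr - (1 + (\<rho> - \<sigma>)))"
  have J: "J \<ge> 0" unfolding J_def by (rule Bochner_Integration.integral_nonneg) simp
  \<comment> \<open>The summand \<open>T\<close> covers radii above 1, where the length of the time
    interval is enough; the other summand is what the Gaussian comparison gives for
    \<open>r \<le> 1\<close>.\<close>
  define A where "A = T + exp (1/2) * (1 / sqrt (2 * pi) * (2 * N * J))"
  have A: "A \<ge> 0" using T N J by (simp add: A_def)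
  define S where "S x r = {s\<in>{0..T}. \<bar>x - w s\<bar> < r}" for x r
  have S_eq: "S x r = {0..T} \<inter> {s. \<bar>x - v s\<bar> < r}" for x r by (auto simp: S_def v_def)
  have S [measurable]: "S x r \<in> sets borel" for x r unfolding S_eq by measurable
  have emS: "emeasure (lebesgue_on {0..T}) (S x r) = emeasure lborel (S x r)" for x r
  proof -
    have "emeasure (lebesgue_on {0..T}) (S x r) = emeasure lebesgue (S x r)"
      by (rule emeasure_restrict_space) (auto simp: S_eq)
    then show ?thesis using S by simp
  qed
  have main: "emeasure lborel (S x r) \<le> ennreal (A * r powr \<sigma>)" if r: "0 < r" "r \<le> 1" for x r
  proof -
    \<comment> \<open>With this \<open>b\<close> the transformed weight is
      \<open>exp (- y\<^sup>2 / (2 * r\<^sup>2))\<close>, at least \<open>exp (- 1/2)\<close> for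
      \<open>\<bar>y\<bar> < r\<close>; hence the factor \<open>exp (1/2)\<close> in
      \<open>A\<close>.\<close>
    define b where "b = r\<^sup>2 / 2"
    have b: "b > 0" using r by (simp add: b_def)
    define f where "f s = complex_of_real (indicator {0..T} s)" for s
    define g where "g a = complex_of_real (exp (- b * a\<^sup>2)) * cis (- (x * a))" for a
    have f: "integrable lborel f"
      unfolding f_def by (simp add: emeasure_lborel_Icc_eq)
    have g: "integrable lborel g"
      using gauss_oscillatory_integrable[OF b, of 0 "- x"] by (simp add: g_def[abs_def])
    have P: "integrable (lborel \<Otimes>\<^sub>M lborel) (\<lambda>(s, a). cis (v s * a) * (f s * g a))"
      using integrable_prod_kernel[OF f g, of "\<lambda>(s, a). cis (v s * a)"] by (auto simp: case_prod_beta)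
    have inner: "(LBINT a. cis (v s * a) * (f s * g a))
        = complex_of_real (sqrt (pi / b) * (indicator {0..T} s * exp (- (v s - x)\<^sup>2 / (4 * b))))" for s
    proof -
      have "(LBINT a. cis (v s * a) * (f s * g a))
         = (LBINT a. f s * (complex_of_real (exp (- b * a\<^sup>2)) * cis ((v s - x) * a)))"
        by (intro Bochner_Integration.integral_cong refl)
          (simp add: g_def mult.left_commute cis_mult algebra_simps)
      also have "\<dots> = f s * complex_of_real (sqrt (pi / b) * exp (- (v s - x)\<^sup>2 / (4 * b)))"
        using gauss_fourier[OF b, of "v s - x"] by (simp add: has_bochner_integral_iff)
      finally show ?thesis by (simp add: f_def)
    qed
    have outer: "(LBINT s. cis (v s * a) * (f s * g a)) = g a * Phi w T a" for a
    proof -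
      have "(LBINT s. cis (v s * a) * (f s * g a)) = (LBINT s. g a * (indicator {0..T} s *\<^sub>R exp (\<i> * of_real (a * w s))))"
        by (intro Bochner_Integration.integral_cong refl)
          (auto simp: f_def v_def cis_conv_exp indicator_def mult_ac)
      then show ?thesis by (simp only: Phi_def set_lebesgue_integral_def integral_mult_right_zero)
    qed
    define h where "h s = indicator {0..T} s * exp (- (v s - x)\<^sup>2 / (4 * b))" for s
    have [measurable]: "h \<in> borel_measurable borel" unfolding h_def by measurable
    have h: "integrable lborel h"
    proof (rule Bochner_Integration.integrable_bound)
      show "integrable lborel (indicat_real {0..T})" by (simp add: emeasure_lborel_Icc_eq)
    qed (auto simp: h_def indicator_def b less_imp_le)
    have "complex_of_real (sqrt (pi / b) * (LBINT s. h s)) = (LBINT s. LBINT a. cis (v s * a) * (f s * g a))"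
      unfolding inner h_def[symmetric] by (simp del: of_real_mult)
    also have "\<dots> = (LBINT a. LBINT s. cis (v s * a) * (f s * g a))"
      by (rule lborel_pair.Fubini_integral[symmetric, OF P])
    also have "\<dots> = (LBINT a. g a * Phi w T a)" unfolding outer ..
    finally have eq: "complex_of_real (sqrt (pi / b) * (LBINT s. h s)) = (LBINT a. g a * Phi w T a)" .
    have h0: "0 \<le> (LBINT s. h s)" by (rule Bochner_Integration.integral_nonneg) (simp add: h_def)
    have ig: "integrable lborel (\<lambda>a. g a * Phi w T a)"
      using lborel_pair.integrable_snd[OF P] by (simp only: outer)
    have bnd: "cmod (g a * Phi w T a) \<le> 2 * N * r powr (\<sigma> - 1) * (1 + \<bar>a\<bar>) powr - (1 + (\<rho> - \<sigma>))" for a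
    proof -
      have "exp (- b * a\<^sup>2) = exp (- (r * \<bar>a\<bar>)\<^sup>2 / 2)" by (simp add: b_def power_mult_distrib)
      also have "\<dots> \<le> 2 * (1 + r * \<bar>a\<bar>) powr (\<sigma> - 1)"
        using r \<sigma> by (intro gaussian_le_powr) auto
      \<comment> \<open>For \<open>r \<le> 1\<close> one has
        \<open>r * (1 + \<bar>a\<bar>) \<le> 1 + r * \<bar>a\<bar>\<close>, and the exponent
        \<open>\<sigma> - 1\<close> is not positive.\<close>
      also have "\<dots> \<le> 2 * (r * (1 + \<bar>a\<bar>)) powr (\<sigma> - 1)"
        using r \<sigma> by (intro mult_left_mono powr_mono2') (auto simp: distrib_left intro!: mult_pos_pos add_pos_nonneg)
      also have "\<dots> = 2 * (r powr (\<sigma> - 1) * (1 + \<bar>a\<bar>) powr (\<sigma> - 1))" using r by (simp add: powr_mult)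
      finally have 1: "exp (- b * a\<^sup>2) \<le> 2 * (r powr (\<sigma> - 1) * (1 + \<bar>a\<bar>) powr (\<sigma> - 1))" .
      have "cmod (g a * Phi w T a) = exp (- b * a\<^sup>2) * cmod (Phi w T a)" by (simp add: g_def norm_mult)
      also have "\<dots> \<le> 2 * (r powr (\<sigma> - 1) * (1 + \<bar>a\<bar>) powr (\<sigma> - 1)) * (N * (1 + \<bar>a\<bar>) powr - \<rho>)"
        by (intro mult_mono 1 N) auto
      also have "\<dots> = 2 * N * r powr (\<sigma> - 1) * ((1 + \<bar>a\<bar>) powr (\<sigma> - 1) * (1 + \<bar>a\<bar>) powr - \<rho>)"
        by (simp only: mult_ac)
      also have "(1 + \<bar>a\<bar>) powr (\<sigma> - 1) * (1 + \<bar>a\<bar>) powr - \<rho> = (1 + \<bar>a\<bar>) powr - (1 + (\<rho> - \<sigma>))"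
        by (simp add: powr_add[symmetric] algebra_simps)
      finally show ?thesis .
    qed
    have "sqrt (pi / b) * (LBINT s. h s) = cmod (complex_of_real (sqrt (pi / b) * (LBINT s. h s)))"
      using h0 b by (simp add: norm_mult)
    also have "\<dots> \<le> (LBINT a. cmod (g a * Phi w T a))" unfolding eq by (rule integral_norm_bound)
    also have "\<dots> \<le> (LBINT a. 2 * N * r powr (\<sigma> - 1) * (1 + \<bar>a\<bar>) powr - (1 + (\<rho> - \<sigma>)))"
      using \<sigma> by (intro integral_mono integrable_norm ig bnd integrable_mult_right integrable_one_plus_abs_powr) auto
    also have "\<dots> = 2 * N * r powr (\<sigma> - 1) * J" by (simp add: J_def)
    finally have 1: "sqrt (pi / b) * (LBINT s. h s) \<le> 2 * N * r powr (\<sigma> - 1) * J" .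
    have s: "sqrt (pi / b) = sqrt (2 * pi) / r" using r by (simp add: b_def real_sqrt_divide)
    have "(LBINT s. h s) = r / sqrt (2 * pi) * (sqrt (pi / b) * (LBINT s. h s))"
      unfolding s using r by simp
    also have "\<dots> \<le> r / sqrt (2 * pi) * (2 * N * r powr (\<sigma> - 1) * J)"
      using r by (intro mult_left_mono 1) auto
    also have "\<dots> = 1 / sqrt (2 * pi) * (2 * N * J) * (r * r powr (\<sigma> - 1))" by simp
    also have "r * r powr (\<sigma> - 1) = r powr \<sigma>" using r by (simp add: powr_mult_base)
    finally have 2: "(LBINT s. h s) \<le> 1 / sqrt (2 * pi) * (2 * N * J) * r powr \<sigma>" .
    have "emeasure lborel (S x r) = (\<integral>\<^sup>+s. indicator (S x r) s \<partial>lborel)" by simp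
    also have "\<dots> \<le> (\<integral>\<^sup>+s. ennreal (exp (1/2) * h s) \<partial>lborel)"
    proof (rule nn_integral_mono)
      fix s
      show "indicator (S x r) s \<le> ennreal (exp (1/2) * h s)"
      proof (cases "s \<in> S x r")
        case True
        then have s: "s \<in> {0..T}" "\<bar>x - v s\<bar> < r" by (auto simp: S_eq)
        have "\<bar>v s - x\<bar>\<^sup>2 \<le> r\<^sup>2" using s by (intro power_mono) auto
        then have "(v s - x)\<^sup>2 / (4 * b) \<le> 1 / 2" using r by (simp add: b_def)
        then have "1 \<le> exp (1/2 + - (v s - x)\<^sup>2 / (4 * b))" by simp
        then have "1 \<le> exp (1/2) * h s" using s by (simp add: h_def exp_add[symmetric])
        then show ?thesis using True by simp
      qed simp
    qed
    also have "\<dots> = ennreal (LBINT s. exp (1/2) * h s)"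
    proof (rule nn_integral_eq_integral)
      show "integrable lborel (\<lambda>s. exp (1/2) * h s)" using h by simp
    qed (simp add: h_def)
    also have "\<dots> \<le> ennreal (A * r powr \<sigma>)"
    proof (rule ennreal_leI)
      have "exp (1/2) * (LBINT s. h s) \<le> exp (1/2) * (1 / sqrt (2 * pi) * (2 * N * J) * r powr \<sigma>)"
        by (intro mult_left_mono 2) auto
      also have "\<dots> = exp (1/2) * (1 / sqrt (2 * pi) * (2 * N * J)) * r powr \<sigma>" by (simp only: mult.assoc)
      also have "\<dots> \<le> A * r powr \<sigma>" using T by (intro mult_right_mono) (auto simp: A_def)
      finally show "(LBINT s. exp (1/2) * h s) \<le> A * r powr \<sigma>" by simp
    qed
    finally show ?thesis .
  qed
  have "emeasure lborel (S x r) \<le> ennreal (A * r powr \<sigma>)" if r: "0 < r" for x r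
  proof (cases "r \<le> 1")
    case False
    have "emeasure lborel (S x r) \<le> emeasure lborel {0..T}" by (intro emeasure_mono) (auto simp: S_eq)
    also have "\<dots> = ennreal (T * 1)" using T by simp
    also have "\<dots> \<le> ennreal (A * r powr \<sigma>)"
    proof (intro ennreal_leI mult_mono)
      show "T \<le> A" using N J by (simp add: A_def)
      show "1 \<le> r powr \<sigma>" using False \<sigma> by (intro ge_one_powr_ge_zero) auto
    qed (use A in auto)
    finally show ?thesis .
  qed (use main r in auto)
  then show ?thesis using A emS unfolding S_def by (intro exI[of _ A]) auto
qed


section \<open>Multipliers and the propagator\<close>

lemma norm_abs_l2_mono:
  assumes "in_Lq 2 f" "in_Lq 2 g" "AE x in lborel. cmod (f x) \<le> cmod (g x)"
  shows "norm (abs_l2 f) \<le> norm (abs_l2 g)"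
  unfolding norm_abs_l2[OF assms(1)] norm_abs_l2[OF assms(2)]
  using assms by (intro real_sqrt_le_mono integral_mono_AE) (auto simp: in_L2_iff elim!: eventually_mono)

definition clip_l2 :: "real \<Rightarrow> l2 \<Rightarrow> l2" where
  "clip_l2 c u = abs_l2 (\<lambda>x. clip c (rep_l2 u x))"

lemma in_L2_clip:
  assumes c: "0 \<le> c" and f: "in_Lq 2 f"
  shows "in_Lq 2 (\<lambda>x. clip c (f x))"
  by (rule in_L2_mono[OF f measurable_compose[OF in_L2_measurable[OF f] clip_measurable[OF c]] norm_clip_le[OF c]])

lemma norm_clip_l2_diff:
  assumes c: "0 \<le> c"
  shows "norm (clip_l2 c u - clip_l2 c v) \<le> norm (u - v)"
proof -
  have "clip_l2 c u - clip_l2 c v = abs_l2 (\<lambda>x. clip c (rep_l2 u x) - clip c (rep_l2 v x))"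
    by (simp add: clip_l2_def abs_l2_diff in_L2_clip c in_L2_rep)
  also have "norm \<dots> \<le> norm (abs_l2 (\<lambda>x. rep_l2 u x - rep_l2 v x))"
    by (intro norm_abs_l2_mono in_L2_diff in_L2_clip c in_L2_rep AE_I2 clip_lipschitz)
  also have "abs_l2 (\<lambda>x. rep_l2 u x - rep_l2 v x) = u - v"
    by (simp add: abs_l2_diff in_L2_rep abs_rep_l2)
  finally show ?thesis .
qed

lemma clip_l2_id:
  assumes c: "0 \<le> c" and u: "AE x in lborel. cmod (rep_l2 u x) \<le> c"
  shows "clip_l2 c u = u"
proof -
  have "clip_l2 c u = abs_l2 (rep_l2 u)" unfolding clip_l2_def
    using u by (subst l2_abs_eq_iff)
      (auto intro!: in_L2_clip in_L2_rep c clip_id elim!: eventually_mono)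
  then show ?thesis by (simp add: abs_rep_l2)
qed

text \<open>Truncation at height \<open>c\<close> is nonexpansive and fixes every
  \<open>u n\<close>, hence it fixes the limit.\<close>

lemma AE_bounded_l2_limit:
  assumes c: "0 \<le> c" and u: "\<And>n. AE x in lborel. cmod (rep_l2 (u n) x) \<le> c" and lim: "u \<longlonglongrightarrow> v"
  shows "AE x in lborel. cmod (rep_l2 v x) \<le> c"
proof -
  have "(\<lambda>n. norm (u n - v)) \<longlonglongrightarrow> 0"
    using lim by (simp add: tendsto_norm_zero_iff LIM_zero_iff)
  then have "(\<lambda>n. u n - clip_l2 c v) \<longlonglongrightarrow> 0"
    by (rule Lim_null_comparison[rotated])
      (use norm_clip_l2_diff[OF c, of "u _" v] clip_l2_id[OF c u] in \<open>auto intro!: always_eventually\<close>)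
  then have "u \<longlonglongrightarrow> clip_l2 c v" by (simp add: LIM_zero_iff)
  then have "v = clip_l2 c v" by (rule LIMSEQ_unique[OF lim])
  then have "AE x in lborel. rep_l2 v x = clip c (rep_l2 v x)"
    using rep_abs_l2[OF in_L2_clip[OF c in_L2_rep[of v]]] by (metis clip_l2_def)
  then show ?thesis by eventually_elim (metis norm_clip[OF c])
qed

section \<open>Multiplication operators on the Fourier side\<close>

definition mult_l2 :: "(real \<Rightarrow> complex) \<Rightarrow> l2 \<Rightarrow> l2" where
  "mult_l2 m g = abs_l2 (\<lambda>\<xi>. m \<xi> * rep_l2 g \<xi>)"

definition multiplier :: "(real \<Rightarrow> complex) \<Rightarrow> bool" where
  "multiplier m \<longleftrightarrow> m \<in> borel_measurable borel \<and> (\<forall>\<xi>. cmod (m \<xi>) \<le> 1)"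

lemma in_L2_mult:
  assumes m: "multiplier m" and f: "in_Lq 2 f"
  shows "in_Lq 2 (\<lambda>\<xi>. m \<xi> * f \<xi>)"
  using m in_L2_measurable[OF f]
  by (intro in_L2_mono[OF f]) (auto simp: multiplier_def norm_mult intro!: mult_left_le_one_le)

lemma mult_abs_l2:
  assumes m: "multiplier m" and f: "in_Lq 2 f"
  shows "mult_l2 m (abs_l2 f) = abs_l2 (\<lambda>\<xi>. m \<xi> * f \<xi>)"
  unfolding mult_l2_def using rep_abs_l2[OF f]
  by (subst l2_abs_eq_iff) (auto intro!: in_L2_mult m f in_L2_rep elim!: eventually_mono)

lemma mult_mult_l2:
  assumes "multiplier m" "multiplier n"
  shows "mult_l2 m (mult_l2 n g) = mult_l2 (\<lambda>\<xi>. m \<xi> * n \<xi>) g"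
  using assms by (simp add: mult_l2_def[of n] mult_abs_l2 in_L2_mult in_L2_rep) (simp add: mult_l2_def mult.assoc)

lemma mult_l2_one: "mult_l2 (\<lambda>\<xi>. 1) g = g"
  by (simp add: mult_l2_def abs_rep_l2)

lemma norm_mult_l2_le:
  assumes m: "multiplier m"
  shows "norm (mult_l2 m g) \<le> norm g"
proof -
  have "norm (mult_l2 m g) \<le> norm (abs_l2 (rep_l2 g))"
    unfolding mult_l2_def using m
    by (intro norm_abs_l2_mono in_L2_mult in_L2_rep AE_I2)
      (auto simp: norm_mult multiplier_def intro!: mult_left_le_one_le)
  then show ?thesis by (simp add: abs_rep_l2)
qed

lemma bounded_linear_mult_l2:
  assumes m: "multiplier m"
  shows "bounded_linear (mult_l2 m)"
proof (rule bounded_linear_intro[where K = 1])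
  fix u v :: l2 and r :: real
  have "mult_l2 m (abs_l2 (\<lambda>x. rep_l2 u x + rep_l2 v x)) = abs_l2 (\<lambda>x. m x * rep_l2 u x + m x * rep_l2 v x)"
    by (simp add: mult_abs_l2 m in_L2_add in_L2_rep distrib_left)
  also have "\<dots> = mult_l2 m u + mult_l2 m v"
    by (simp add: abs_l2_add in_L2_mult m in_L2_rep mult_l2_def)
  finally show "mult_l2 m (u + v) = mult_l2 m u + mult_l2 m v"
    by (simp add: abs_l2_add in_L2_rep abs_rep_l2)
  have "mult_l2 m (abs_l2 (\<lambda>x. r *\<^sub>R rep_l2 u x)) = abs_l2 (\<lambda>x. r *\<^sub>R (m x * rep_l2 u x))"
    by (simp only: mult_abs_l2 m in_L2_scaleR in_L2_rep mult_scaleR_right)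
  also have "\<dots> = r *\<^sub>R mult_l2 m u"
    by (simp only: abs_l2_scaleR in_L2_mult m in_L2_rep mult_l2_def)
  finally show "mult_l2 m (r *\<^sub>R u) = r *\<^sub>R mult_l2 m u"
    by (simp only: abs_l2_scaleR in_L2_rep abs_rep_l2)
  show "norm (mult_l2 m u) \<le> norm u * 1" using norm_mult_l2_le[OF m] by simp
qed

text \<open>Dominated convergence gives convergence at a fixed argument, and the common bound 1 on
  the symbols lets the argument converge as well. For chirps this joint continuity later yields
  continuity and measurability in time.\<close>

lemma tendsto_mult_l2:
  assumes m: "\<And>n::nat. multiplier (m n)" "multiplier m'" "\<And>\<xi>. (\<lambda>n. m n \<xi>) \<longlonglongrightarrow> m' \<xi>"
    and g: "g \<longlonglongrightarrow> g'"
  shows "(\<lambda>n. mult_l2 (m n) (g n)) \<longlonglongrightarrow> mult_l2 m' g'"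
proof -
  have 1: "(\<lambda>n. mult_l2 (m n) g') \<longlonglongrightarrow> mult_l2 m' g'"
    unfolding mult_l2_def
  proof (rule l2_dominated_convergence(3)[OF in_L2_rep[of g'], where C = 1])
    show "(\<lambda>\<xi>. m k \<xi> * rep_l2 g' \<xi>) \<in> borel_measurable borel" for k
      by (rule in_L2_measurable[OF in_L2_mult[OF m(1) in_L2_rep]])
    show "cmod (m k \<xi> * rep_l2 g' \<xi>) \<le> 1 * cmod (rep_l2 g' \<xi>)" for k \<xi>
      using m(1)[of k] by (auto simp: norm_mult multiplier_def intro!: mult_left_le_one_le)
    show "(\<lambda>k. m k \<xi> * rep_l2 g' \<xi>) \<longlonglongrightarrow> m' \<xi> * rep_l2 g' \<xi>" for \<xi> by (intro tendsto_intros m)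
  qed
  have "(\<lambda>n. norm (g n - g')) \<longlonglongrightarrow> 0"
    using g by (simp add: tendsto_norm_zero_iff LIM_zero_iff)
  then have 2: "(\<lambda>n. mult_l2 (m n) (g n - g')) \<longlonglongrightarrow> 0"
    by (rule Lim_null_comparison[rotated]) (use norm_mult_l2_le[OF m(1)] in \<open>auto intro!: always_eventually\<close>)
  have "mult_l2 (m n) (g n - g') + mult_l2 (m n) g' = mult_l2 (m n) (g n)" for n
    using linear_add[OF bounded_linear.linear[OF bounded_linear_mult_l2[OF m(1)[of n]]], of "g n - g'" g'] by simp
  then show ?thesis using tendsto_add[OF 2 1] by simp
qed

section \<open>Chirps and the propagator\<close>

definition chirp :: "real \<Rightarrow> real \<Rightarrow> complex" where
  "chirp a \<xi> = cis (- (a * \<xi>\<^sup>2))"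

lemma multiplier_chirp: "multiplier (chirp a)"
  by (auto simp: multiplier_def chirp_def[abs_def])

lemma mult_chirp_chirp: "mult_l2 (chirp a) (mult_l2 (chirp b) g) = mult_l2 (chirp (a + b)) g"
proof -
  have "(\<lambda>\<xi>. chirp a \<xi> * chirp b \<xi>) = chirp (a + b)"
    by (simp add: fun_eq_iff chirp_def cis_mult distrib_right)
  then show ?thesis by (simp add: mult_mult_l2 multiplier_chirp)
qed

lemma mult_chirp_0: "mult_l2 (chirp 0) g = g"
  using mult_l2_one[of g] by (simp add: chirp_def[abs_def])

lemma mult_chirp_inverse: "mult_l2 (chirp (- a)) (mult_l2 (chirp a) g) = g"
  "mult_l2 (chirp a) (mult_l2 (chirp (- a)) g) = g"
  by (simp_all add: mult_chirp_chirp mult_chirp_0)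

lemma norm_mult_chirp: "norm (mult_l2 (chirp a) g) = norm g"
proof (rule antisym)
  show "norm g \<le> norm (mult_l2 (chirp a) g)"
    using norm_mult_l2_le[OF multiplier_chirp, of "- a" "mult_l2 (chirp a) g"] by (simp add: mult_chirp_inverse)
qed (rule norm_mult_l2_le[OF multiplier_chirp])

lemma tendsto_mult_chirp:
  fixes a :: "nat \<Rightarrow> real"
  assumes "a \<longlonglongrightarrow> a'" "g \<longlonglongrightarrow> g'"
  shows "(\<lambda>n. mult_l2 (chirp (a n)) (g n)) \<longlonglongrightarrow> mult_l2 (chirp a') g'"
  by (rule tendsto_mult_l2[OF multiplier_chirp multiplier_chirp _ assms(2)])
    (unfold chirp_def, intro tendsto_cis tendsto_intros assms)

text \<open>Bijectivity of \<open>fourier\<close> makes the description in the definition satisfied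
  by exactly one class; almost-everywhere equality of representatives is equality of
  classes.\<close>

lemma fourier_multiplier_eq:
  assumes m: "multiplier m"
  shows "fourier_multiplier m f = inv_fourier (mult_l2 m (fourier f))"
  unfolding fourier_multiplier_def
proof (rule the_equality)
  have *: "(AE \<xi> in lborel. rep_l2 (fourier g) \<xi> = m \<xi> * rep_l2 (fourier f) \<xi>) \<longleftrightarrow> fourier g = mult_l2 m (fourier f)" for g
    using l2_abs_eq_iff[OF in_L2_rep[of "fourier g"] in_L2_mult[OF m in_L2_rep[of "fourier f"]]]
    by (simp add: abs_rep_l2 mult_l2_def)
  show "AE \<xi> in lborel. rep_l2 (fourier (inv_fourier (mult_l2 m (fourier f)))) \<xi> = m \<xi> * rep_l2 (fourier f) \<xi>"
    by (subst *) (rule fourier_inv_fourier)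
  show "g = inv_fourier (mult_l2 m (fourier f))"
    if "AE \<xi> in lborel. rep_l2 (fourier g) \<xi> = m \<xi> * rep_l2 (fourier f) \<xi>" for g
    using that unfolding * by (metis inv_fourier_fourier)
qed

lemma U_eq: "U w t f = inv_fourier (mult_l2 (chirp (w t)) (fourier f))"
proof -
  have "(\<lambda>\<xi>. exp (- (\<i> * of_real (w t * \<xi>\<^sup>2)))) = chirp (w t)"
    by (auto simp: chirp_def cis_conv_exp)
  then show ?thesis unfolding U_def by (simp only: fourier_multiplier_eq[OF multiplier_chirp])
qed

text \<open>The opposite chirp is a two-sided inverse, which determines the function chosen by
  \<open>inv\<close>.\<close>

lemma inv_U: "inv (U w s) f = inv_fourier (mult_l2 (chirp (- w s)) (fourier f))"
proof -
  have "inv (U w s) = (\<lambda>f. inv_fourier (mult_l2 (chirp (- w s)) (fourier f)))"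
    by (rule inv_unique_comp) (auto simp: U_eq mult_chirp_inverse fun_eq_iff)
  then show ?thesis by simp
qed

text \<open>A damped plane wave on the Fourier side. In the real inner product, pairing with it for
  \<open>c = 1\<close> and \<open>c = \<i>\<close> gives the real and the imaginary part, at the
  point \<open>x\<close>, of \<open>2 * pi\<close> times the inverse transform of the propagated and
  damped profile. The damping \<open>\<epsilon>\<close> is what puts the wave in L2.\<close>

definition gauss_wave :: "complex \<Rightarrow> real \<Rightarrow> real \<Rightarrow> real \<Rightarrow> real \<Rightarrow> complex" where
  "gauss_wave c \<epsilon> x a \<xi> = c * (complex_of_real (exp (- \<epsilon> * \<xi>\<^sup>2)) * cis (a * \<xi>\<^sup>2 + - x * \<xi>))"

lemma gauss_wave_measurable [measurable]: "gauss_wave c \<epsilon> x a \<in> borel_measurable borel"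
  unfolding gauss_wave_def[abs_def] by measurable

lemma norm_gauss_wave: "cmod (gauss_wave c \<epsilon> x a \<xi>) = cmod c * exp (- \<epsilon> * \<xi>\<^sup>2)"
  by (simp add: gauss_wave_def norm_mult)

lemma in_L2_gauss_wave:
  assumes e: "\<epsilon> > 0"
  shows "in_Lq 2 (gauss_wave c \<epsilon> x a)"
proof -
  have "(\<lambda>\<xi>. (cmod (gauss_wave c \<epsilon> x a \<xi>))\<^sup>2) = (\<lambda>\<xi>. (cmod c)\<^sup>2 * exp (- (2 * \<epsilon>) * \<xi>\<^sup>2))"
    by (simp add: norm_gauss_wave power_mult_distrib exp_double[symmetric] mult.assoc)
  then show ?thesis
    using gauss_integral[of "2 * \<epsilon>"] e by (simp add: in_L2_iff has_bochner_integral_iff)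
qed

text \<open>The dispersive estimate in dual form: one wave times the conjugate of the other is a
  single damped wave with quadratic phase \<open>a - a'\<close>. The bound involves neither the
  positions nor the dampings.\<close>

lemma inner_gauss_wave_bound:
  assumes "\<epsilon> > 0" "\<epsilon>' > 0" "cmod c = 1" "cmod c' = 1" "a \<noteq> a'"
  shows "\<bar>abs_l2 (gauss_wave c \<epsilon> x a) \<bullet> abs_l2 (gauss_wave c' \<epsilon>' x' a')\<bar> \<le> sqrt (pi / \<bar>a - a'\<bar>)"
proof -
  define F where "F \<xi> = complex_of_real (exp (- (\<epsilon> + \<epsilon>') * \<xi>\<^sup>2)) * cis ((a - a') * \<xi>\<^sup>2 + (x' - x) * \<xi>)" for \<xi>
  have iF: "integrable lborel F"
    unfolding F_def using assms by (intro gauss_oscillatory_integrable) auto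
  have "gauss_wave c \<epsilon> x a \<xi> \<bullet> gauss_wave c' \<epsilon>' x' a' \<xi> = Re (c * cnj c' * F \<xi>)" for \<xi>
  proof -
    have "u \<bullet> v = Re (u * cnj v)" for u v :: complex by (simp add: inner_complex_def)
    moreover have "exp (- \<epsilon> * \<xi>\<^sup>2) * exp (- \<epsilon>' * \<xi>\<^sup>2) = exp (- (\<epsilon> + \<epsilon>') * \<xi>\<^sup>2)"
      by (simp add: exp_add[symmetric] algebra_simps)
    moreover have "cis (a * \<xi>\<^sup>2 + - x * \<xi>) * cis (- (a' * \<xi>\<^sup>2 + - x' * \<xi>)) = cis ((a - a') * \<xi>\<^sup>2 + (x' - x) * \<xi>)"
      by (simp add: cis_mult algebra_simps)
    moreover have "c * (complex_of_real p * A) * cnj (c' * (complex_of_real q * B))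
        = c * cnj c' * (complex_of_real (p * q) * (A * cnj B))" for p q A B by simp
    ultimately show ?thesis unfolding gauss_wave_def F_def by (simp only: cis_cnj)
  qed
  then have "abs_l2 (gauss_wave c \<epsilon> x a) \<bullet> abs_l2 (gauss_wave c' \<epsilon>' x' a') = (LBINT \<xi>. Re (c * cnj c' * F \<xi>))"
    using assms by (simp add: inner_abs_l2 in_L2_gauss_wave)
  also have "\<dots> = Re (LBINT \<xi>. c * cnj c' * F \<xi>)"
    using iF by (intro Bochner_Integration.integral_Re) simp
  also have "\<bar>\<dots>\<bar> \<le> cmod (LBINT \<xi>. c * cnj c' * F \<xi>)" by (rule abs_Re_le_cmod)
  also have "\<dots> = cmod (LBINT \<xi>. F \<xi>)" using assms by (simp add: norm_mult)
  also have "\<dots> \<le> sqrt (pi / \<bar>a - a'\<bar>)"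
    unfolding F_def using assms by (intro gauss_oscillatory_bound) auto
  finally show ?thesis .
qed

lemma tendsto_gauss_wave:
  assumes e: "\<epsilon> > 0" and x: "x \<longlonglongrightarrow> x'" and a: "a \<longlonglongrightarrow> a'"
  shows "(\<lambda>n. abs_l2 (gauss_wave c \<epsilon> (x n) (a n))) \<longlonglongrightarrow> abs_l2 (gauss_wave c \<epsilon> x' a')"
proof (rule l2_dominated_convergence(3)[OF in_L2_gauss_wave[OF e, of 1 0 0], where C = "cmod c"])
  show "(\<lambda>n. gauss_wave c \<epsilon> (x n) (a n) \<xi>) \<longlonglongrightarrow> gauss_wave c \<epsilon> x' a' \<xi>" for \<xi>
    unfolding gauss_wave_def by (intro tendsto_intros tendsto_cis x a)
qed (auto simp: norm_gauss_wave)

definition gauss_multiplier :: "real \<Rightarrow> real \<Rightarrow> complex" where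
  "gauss_multiplier \<epsilon> \<xi> = complex_of_real (exp (- \<epsilon> * \<xi>\<^sup>2))"

lemma multiplier_gauss: "\<epsilon> \<ge> 0 \<Longrightarrow> multiplier (gauss_multiplier \<epsilon>)"
  by (auto simp: multiplier_def gauss_multiplier_def[abs_def])

text \<open>The damped inverse transform is an absolutely convergent integral, evaluated at
  \<open>x\<close> by the two pairings. Continuity of the waves in \<open>x\<close> passes from
  rational to real points. Real and imaginary parts at most \<open>m\<close> give modulus at most
  \<open>2 * m\<close>, and the factor \<open>1 / (2 * pi)\<close> makes it
  \<open>m / pi\<close>.\<close>

lemma propagated_gauss_bound:
  assumes e: "\<epsilon> > 0"
    and bnd: "\<And>x c. x \<in> \<rat> \<Longrightarrow> c \<in> {1, \<i>} \<Longrightarrow> \<bar>abs_l2 (gauss_wave c \<epsilon> x a) \<bullet> H\<bar> \<le> m"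
  shows "AE x in lborel. cmod (rep_l2 (inv_fourier (mult_l2 (gauss_multiplier \<epsilon>) (mult_l2 (chirp a) H))) x) \<le> m / pi"
proof -
  have bnd': "\<bar>abs_l2 (gauss_wave c \<epsilon> x a) \<bullet> H\<bar> \<le> m" if c: "c \<in> {1, \<i>}" for x c
  proof -
    have "x \<in> closure \<rat>" by (simp add: Rats_closure_real)
    then obtain r where r: "\<And>n::nat. r n \<in> \<rat>" "r \<longlonglongrightarrow> x" unfolding closure_sequential by blast
    have "(\<lambda>n. \<bar>abs_l2 (gauss_wave c \<epsilon> (r n) a) \<bullet> H\<bar>) \<longlonglongrightarrow> \<bar>abs_l2 (gauss_wave c \<epsilon> x a) \<bullet> H\<bar>"
      by (intro tendsto_intros tendsto_gauss_wave e r)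
    then show ?thesis by (rule LIMSEQ_le_const2) (use bnd r c in auto)
  qed
  define h where "h \<xi> = gauss_multiplier \<epsilon> \<xi> * (chirp a \<xi> * rep_l2 H \<xi>)" for \<xi>
  have mg: "multiplier (gauss_multiplier \<epsilon>)" using e by (intro multiplier_gauss) simp
  have L: "in_Lq 2 h" unfolding h_def[abs_def] by (intro in_L2_mult mg multiplier_chirp in_L2_rep)
  have eq: "mult_l2 (gauss_multiplier \<epsilon>) (mult_l2 (chirp a) H) = abs_l2 h"
    unfolding h_def[abs_def] mult_l2_def[of "chirp a"] by (intro mult_abs_l2 mg in_L2_mult multiplier_chirp in_L2_rep)
  have key: "cis (\<xi> * x) * h \<xi> = cnj (gauss_wave 1 \<epsilon> x a \<xi>) * rep_l2 H \<xi>" for \<xi> x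
  proof -
    have "cis (\<xi> * x) * chirp a \<xi> = cis (- (a * \<xi>\<^sup>2 + - x * \<xi>))"
      by (simp add: chirp_def cis_mult algebra_simps)
    moreover have "A * (g * (B * r)) = cnj 1 * (g * (A * B)) * r" for A B g r :: complex by simp
    ultimately show ?thesis
      unfolding h_def gauss_wave_def gauss_multiplier_def complex_cnj_mult complex_cnj_complex_of_real cis_cnj
      by (simp only:)
  qed
  have iw: "integrable lborel (\<lambda>\<xi>. cnj (gauss_wave c \<epsilon> x a \<xi>) * rep_l2 H \<xi>)" for c x
    by (intro integrable_mult_L2 in_L2_cnj in_L2_gauss_wave e in_L2_rep)
  have ih: "integrable lborel h" using iw[of 1 0] by (simp add: key[symmetric])
  have inn: "abs_l2 (gauss_wave c \<epsilon> x a) \<bullet> H = Re (LBINT \<xi>. cnj (gauss_wave c \<epsilon> x a \<xi>) * rep_l2 H \<xi>)" for c x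
  proof -
    have "abs_l2 (gauss_wave c \<epsilon> x a) \<bullet> H = abs_l2 (gauss_wave c \<epsilon> x a) \<bullet> abs_l2 (rep_l2 H)" by (simp add: abs_rep_l2)
    also have "\<dots> = (LBINT \<xi>. gauss_wave c \<epsilon> x a \<xi> \<bullet> rep_l2 H \<xi>)"
      by (intro inner_abs_l2 in_L2_gauss_wave e in_L2_rep)
    also have "\<dots> = (LBINT \<xi>. Re (cnj (gauss_wave c \<epsilon> x a \<xi>) * rep_l2 H \<xi>))"
      by (simp add: inner_complex_def)
    also have "\<dots> = Re (LBINT \<xi>. cnj (gauss_wave c \<epsilon> x a \<xi>) * rep_l2 H \<xi>)"
      by (rule Bochner_Integration.integral_Re[OF iw])
    finally show ?thesis .
  qed
  have "cmod (LBINT \<xi>. cis (\<xi> * x) * h \<xi>) \<le> 2 * m" for x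
  proof -
    define u where "u = (LBINT \<xi>. cis (\<xi> * x) * h \<xi>)"
    have "Re u = abs_l2 (gauss_wave 1 \<epsilon> x a) \<bullet> H" by (simp add: inn u_def key)
    moreover have "Im u = abs_l2 (gauss_wave \<i> \<epsilon> x a) \<bullet> H"
    proof -
      have "(LBINT \<xi>. cnj (gauss_wave \<i> \<epsilon> x a \<xi>) * rep_l2 H \<xi>) = (LBINT \<xi>. - \<i> * (cis (\<xi> * x) * h \<xi>))"
        unfolding key by (simp add: gauss_wave_def mult.assoc)
      also have "\<dots> = - \<i> * u" unfolding u_def by (rule integral_mult_right_zero)
      finally show ?thesis by (simp add: inn)
    qed
    ultimately show ?thesis using bnd'[of 1 x] bnd'[of \<i> x] cmod_le[of u] unfolding u_def by simp
  qed
  then have "cmod ((1 / (2 * pi)) *\<^sub>R (LBINT \<xi>. cis (\<xi> * x) * h \<xi>)) \<le> m / pi" for x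
  proof -
    have "cmod ((1 / (2 * pi)) *\<^sub>R z) \<le> m / pi" if "cmod z \<le> 2 * m" for z
      using that by (simp add: field_simps)
    with \<open>\<And>x. cmod (LBINT \<xi>. cis (\<xi> * x) * h \<xi>) \<le> 2 * m\<close> show ?thesis by blast
  qed
  then show ?thesis unfolding eq using inv_fourier_abs_l2[OF ih L] by (auto elim!: eventually_mono)
qed

text \<open>The damping is removed along \<open>1 / (real n + 1)\<close>, since an almost-everywhere
  bound survives limits in L2.\<close>

lemma propagated_bound:
  assumes bnd: "\<And>n x c. x \<in> \<rat> \<Longrightarrow> c \<in> {1, \<i>} \<Longrightarrow> \<bar>abs_l2 (gauss_wave c (1 / (real n + 1)) x a) \<bullet> H\<bar> \<le> m"
  shows "AE x in lborel. cmod (rep_l2 (inv_fourier (mult_l2 (chirp a) H)) x) \<le> m / pi"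
proof (rule AE_bounded_l2_limit)
  have "0 \<le> m" using order_trans[OF abs_ge_zero bnd[of 0 1 0]] by simp
  then show "0 \<le> m / pi" by simp
  show "AE x in lborel. cmod (rep_l2 (inv_fourier (mult_l2 (gauss_multiplier (1 / (real n + 1))) (mult_l2 (chirp a) H))) x) \<le> m / pi" for n
    by (rule propagated_gauss_bound) (use bnd in auto)
  have "(\<lambda>n. mult_l2 (gauss_multiplier (1 / (real n + 1))) (mult_l2 (chirp a) H)) \<longlonglongrightarrow> mult_l2 (gauss_multiplier 0) (mult_l2 (chirp a) H)"
  proof (rule tendsto_mult_l2)
    show "(\<lambda>n. gauss_multiplier (1 / (real n + 1)) \<xi>) \<longlonglongrightarrow> gauss_multiplier 0 \<xi>" for \<xi>
      unfolding gauss_multiplier_def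
      by (intro tendsto_intros tendsto_one_over_Suc)
  qed (auto intro: multiplier_gauss)
  also have "mult_l2 (gauss_multiplier 0) (mult_l2 (chirp a) H) = mult_l2 (chirp a) H"
    using mult_l2_one by (simp add: gauss_multiplier_def[abs_def])
  finally show "(\<lambda>n. inv_fourier (mult_l2 (gauss_multiplier (1 / (real n + 1))) (mult_l2 (chirp a) H)))
      \<longlonglongrightarrow> inv_fourier (mult_l2 (chirp a) H)"
    by (rule bounded_linear.tendsto[OF bounded_linear_inv_fourier])
qed


section \<open>Passing from \<open>L\<^sup>2\<close> to \<open>L\<^sup>r\<close>\<close>

lemma in_Lq_of_L2:
  assumes f: "in_Lq 2 f" and c: "0 \<le> c" and b: "AE x in lborel. cmod (f x) \<le> c" and r: "2 \<le> r"
  shows "in_Lq r f"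
    and "(LBINT x. cmod (f x) powr r) \<le> c powr (r - 2) * (norm (abs_l2 f))\<^sup>2"
proof -
  have [measurable]: "f \<in> borel_measurable borel" by (rule in_L2_measurable[OF f])
  have le: "AE x in lborel. cmod (f x) powr r \<le> c powr (r - 2) * (cmod (f x))\<^sup>2"
    using b
  proof eventually_elim
    case (elim x)
    have "cmod (f x) powr (r - 2 + 2) = cmod (f x) powr (r - 2) * cmod (f x) powr 2" by (rule powr_add)
    then have "cmod (f x) powr r = cmod (f x) powr (r - 2) * (cmod (f x))\<^sup>2" by simp
    also have "\<dots> \<le> c powr (r - 2) * (cmod (f x))\<^sup>2"
      using elim r by (intro mult_right_mono powr_mono2) auto
    finally show ?case .
  qed
  have i: "integrable lborel (\<lambda>x. c powr (r - 2) * (cmod (f x))\<^sup>2)" using f by (simp add: in_L2_iff)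
  have i2: "integrable lborel (\<lambda>x. cmod (f x) powr r)"
    by (rule Bochner_Integration.integrable_bound[OF i]) (use le in \<open>auto elim!: eventually_mono\<close>)
  then show "in_Lq r f" by (simp add: in_Lq_def)
  have "(LBINT x. cmod (f x) powr r) \<le> (LBINT x. c powr (r - 2) * (cmod (f x))\<^sup>2)"
    by (rule integral_mono_AE[OF i2 i le])
  also have "\<dots> = c powr (r - 2) * (norm (abs_l2 f))\<^sup>2"
    by (simp add: norm_abs_l2[OF f])
  finally show "(LBINT x. cmod (f x) powr r) \<le> c powr (r - 2) * (norm (abs_l2 f))\<^sup>2" .
qed

lemma tendsto_l2_AE_subseq:
  assumes u: "u \<longlonglongrightarrow> v"
  shows "\<exists>r::nat\<Rightarrow>nat. strict_mono r \<and> (AE x in lborel. (\<lambda>n. rep_l2 (u (r n)) x) \<longlonglongrightarrow> rep_l2 v x)"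
proof -
  have L: "in_Lq 2 (\<lambda>x. rep_l2 (u n) x - rep_l2 v x)" for n by (intro in_L2_diff in_L2_rep)
  have "(LBINT x. norm ((cmod (rep_l2 (u n) x - rep_l2 v x))\<^sup>2)) = (norm (u n - v))\<^sup>2" for n
    using norm_abs_l2[OF L[of n]] by (simp add: abs_l2_diff in_L2_rep abs_rep_l2)
  moreover have "(\<lambda>n. (norm (u n - v))\<^sup>2) \<longlonglongrightarrow> (norm (v - v))\<^sup>2" by (intro tendsto_intros u)
  ultimately have "(\<lambda>n. LBINT x. norm ((cmod (rep_l2 (u n) x - rep_l2 v x))\<^sup>2)) \<longlonglongrightarrow> 0" by simp
  then obtain r :: "nat \<Rightarrow> nat" where r: "strict_mono r"
    "AE x in lborel. (\<lambda>n. (cmod (rep_l2 (u (r n)) x - rep_l2 v x))\<^sup>2) \<longlonglongrightarrow> 0"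
    using tendsto_L1_AE_subseq[of lborel "\<lambda>n x. (cmod (rep_l2 (u n) x - rep_l2 v x))\<^sup>2"] L
    by (auto simp: in_L2_iff)
  from r(2) have "AE x in lborel. (\<lambda>n. rep_l2 (u (r n)) x) \<longlonglongrightarrow> rep_l2 v x"
  proof eventually_elim
    case (elim x)
    from tendsto_real_sqrt[OF elim] have "(\<lambda>n. cmod (rep_l2 (u (r n)) x - rep_l2 v x)) \<longlonglongrightarrow> 0" by simp
    then show ?case by (simp only: tendsto_norm_zero_iff LIM_zero_iff)
  qed
  with r(1) show ?thesis by blast
qed

text \<open>The functional, which may take the value infinity, is lower semicontinuous on
  \<open>l2\<close>: along an almost-everywhere convergent subsequence Fatou's lemma shows that its
  sublevel sets are closed.\<close>

lemma Lq_integral_measurable: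
  assumes r: "r > 0"
  shows "(\<lambda>u. \<integral>\<^sup>+x. ennreal (cmod (rep_l2 u x) powr r) \<partial>lborel) \<in> borel_measurable borel"
proof (rule borel_measurableI_le)
  fix y :: ennreal
  have "closed {u. (\<integral>\<^sup>+x. ennreal (cmod (rep_l2 u x) powr r) \<partial>lborel) \<le> y}"
    unfolding closed_sequential_limits
  proof (intro allI impI, elim conjE)
    fix u v assume le: "\<forall>n. u n \<in> {u. (\<integral>\<^sup>+x. ennreal (cmod (rep_l2 u x) powr r) \<partial>lborel) \<le> y}" and lim: "u \<longlonglongrightarrow> v"
    obtain k :: "nat \<Rightarrow> nat" where k: "AE x in lborel. (\<lambda>n. rep_l2 (u (k n)) x) \<longlonglongrightarrow> rep_l2 v x"
      using tendsto_l2_AE_subseq[OF lim] by blast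
    have "(\<integral>\<^sup>+x. ennreal (cmod (rep_l2 v x) powr r) \<partial>lborel)
        = (\<integral>\<^sup>+x. liminf (\<lambda>n. ennreal (cmod (rep_l2 (u (k n)) x) powr r)) \<partial>lborel)"
    proof (rule nn_integral_cong_AE, use k in eventually_elim)
      case (elim x)
      have "(\<lambda>n. ennreal (cmod (rep_l2 (u (k n)) x) powr r)) \<longlonglongrightarrow> ennreal (cmod (rep_l2 v x) powr r)"
        using r by (intro tendsto_ennrealI tendsto_powr' tendsto_norm elim tendsto_const) auto
      then show ?case by (rule lim_imp_Liminf[OF trivial_limit_sequentially, symmetric])
    qed
    also have "\<dots> \<le> liminf (\<lambda>n. \<integral>\<^sup>+x. ennreal (cmod (rep_l2 (u (k n)) x) powr r) \<partial>lborel)"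
      by (rule nn_integral_liminf) measurable
    also have "\<dots> \<le> limsup (\<lambda>n. \<integral>\<^sup>+x. ennreal (cmod (rep_l2 (u (k n)) x) powr r) \<partial>lborel)"
      by (rule Liminf_le_Limsup) simp
    also have "\<dots> \<le> y" by (rule Limsup_bounded) (use le in auto)
    finally show "v \<in> {u. (\<integral>\<^sup>+x. ennreal (cmod (rep_l2 u x) powr r) \<partial>lborel) \<le> y}" by simp
  qed
  then show "{u \<in> space borel. (\<integral>\<^sup>+x. ennreal (cmod (rep_l2 u x) powr r) \<partial>lborel) \<le> y} \<in> sets borel" by simp
qed

lemma Lq_norm_measurable:
  assumes r: "r > 0"
  shows "(\<lambda>u. Lq_norm r (rep_l2 u)) \<in> borel_measurable borel"
proof -
  \<comment> \<open>Valid also where the integral diverges: both sides are then 0 by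
    convention.\<close>
  have "Lq_norm r (rep_l2 u) = enn2real (\<integral>\<^sup>+x. ennreal (cmod (rep_l2 u x) powr r) \<partial>lborel) powr (1 / r)" for u
    unfolding Lq_norm_def by (subst integral_eq_nn_integral) auto
  then show ?thesis using Lq_integral_measurable[OF r] by simp
qed

lemma borel_measurable_lebesgue_on_continuous:
  fixes f :: "real \<Rightarrow> 'b :: {second_countable_topology, real_normed_vector}"
  assumes "continuous_on S f" "S \<in> sets lebesgue"
  shows "f \<in> borel_measurable (lebesgue_on S)"
  using assms by (rule continuous_imp_measurable_on_sets_lebesgue)

text \<open>The simple functions come from sampling \<open>D\<close> on a grid and truncating the
  samples at height \<open>n\<close>. Closeness in L2 becomes closeness with exponent
  \<open>r\<close> by interpolation with the height, provided that the mesh is fine enough compared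
  with \<open>n\<close>.\<close>

lemma strongly_measurable_Lq_continuous:
  fixes D :: "real \<Rightarrow> l2"
  assumes T: "T > 0" and D: "continuous_on {0..T} D" and r: "2 \<le> r"
    and bd: "AE t in lebesgue_on {0..T}. \<exists>c\<ge>0. AE x in lborel. cmod (rep_l2 (D t) x) \<le> c"
  shows "strongly_measurable_Lq T r (\<lambda>t. rep_l2 (D t))"
proof -
  \<comment> \<open>Chosen so that \<open>\<delta> n\<close> times the interpolation factor
    \<open>(2 * real n + 1) powr (r - 2)\<close> is \<open>1 / (real n + 1)\<close>; the added 1
    keeps the base positive at \<open>n = 0\<close>.\<close>
  define \<delta> where "\<delta> n = 1 / ((real n + 1) * (2 * real n + 1) powr (r - 2))" for n
  have \<delta>: "\<delta> n > 0" for n by (simp add: \<delta>_def)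
  have "uniformly_continuous_on {0..T} D" using D by (intro compact_uniformly_continuous) auto
  then have "\<exists>d>0. \<forall>s\<in>{0..T}. \<forall>t\<in>{0..T}. dist s t < d \<longrightarrow> dist (D s) (D t) < sqrt (\<delta> n)" for n
    using \<delta>[of n] unfolding uniformly_continuous_on_def by (metis real_sqrt_gt_zero dist_commute)
  then obtain d where d: "\<And>n. d n > 0"
    "\<And>n s t. s \<in> {0..T} \<Longrightarrow> t \<in> {0..T} \<Longrightarrow> dist s t < d n \<Longrightarrow> dist (D s) (D t) < sqrt (\<delta> n)"
    by metis
  have "\<exists>k::nat. k > 0 \<and> 1 / real k < d n" for n
    using reals_Archimedean[OF d(1)[of n]] by (auto simp: divide_inverse)
  then obtain k :: "nat \<Rightarrow> nat" where k: "\<And>n. k n > 0" "\<And>n. 1 / real (k n) < d n" by metis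
  define \<tau> where "\<tau> n t = real_of_int \<lfloor>t * real (k n)\<rfloor> / real (k n)" for n t
  have \<tau>: "\<tau> n t \<in> {0..T}" "dist (\<tau> n t) t < d n" if t: "t \<in> {0..T}" for n t
  proof -
    have 1: "\<tau> n t \<le> t" using k(1)[of n] by (simp add: \<tau>_def divide_le_eq)
    have "0 \<le> \<tau> n t" using t by (simp add: \<tau>_def)
    with 1 t show "\<tau> n t \<in> {0..T}" by auto
    have "t * real (k n) < real_of_int \<lfloor>t * real (k n)\<rfloor> + 1" by linarith
    then have "t < \<tau> n t + 1 / real (k n)" using k(1)[of n] by (simp add: \<tau>_def field_simps)
    then show "dist (\<tau> n t) t < d n" using 1 k(2)[of n] by (simp add: dist_real_def)
  qed
  have \<tau>_simple: "simple_function (lebesgue_on {0..T}) (\<tau> n)" for n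
  proof (rule simple_function_borel_measurable)
    have "\<tau> n \<in> borel_measurable borel" unfolding \<tau>_def by measurable
    then have "\<tau> n \<in> borel_measurable lebesgue" by (intro measurable_completion) simp
    then show "\<tau> n \<in> borel_measurable (lebesgue_on {0..T})" by (rule measurable_restrict_space1)
    have "\<tau> n ` space (lebesgue_on {0..T}) \<subseteq> (\<lambda>i. real_of_int i / real (k n)) ` {0..\<lfloor>T * real (k n)\<rfloor>}"
      by (auto simp: \<tau>_def intro!: imageI floor_mono mult_right_mono)
    then show "finite (\<tau> n ` space (lebesgue_on {0..T}))" by (rule finite_subset) simp
  qed
  \<comment> \<open>A grid point may be one of the exceptional times at which \<open>D\<close> has
    no essential bound; truncation makes every sample integrable to the power
    \<open>r\<close>.\<close>
  define s where "s n t x = clip (real n) (rep_l2 (D (\<tau> n t)) x)" for n t x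
  have s2: "in_Lq 2 (s n t)" for n t unfolding s_def[abs_def] by (intro in_L2_clip in_L2_rep) simp
  have snB: "cmod (s n t x) \<le> real n" for n t x unfolding s_def by (rule norm_clip) simp
  have "simple_function (lebesgue_on {0..T}) (s n)" for n
  proof -
    have "s n = (\<lambda>v x. clip (real n) (rep_l2 (D v) x)) \<circ> \<tau> n" by (auto simp: s_def fun_eq_iff)
    then show ?thesis using simple_function_compose[OF \<tau>_simple] by metis
  qed
  moreover have "in_Lq r (s n t)" for n t
    using in_Lq_of_L2(1)[OF s2 _ _ r, of "real n"] snB by simp
  moreover have "AE t in lebesgue_on {0..T}. in_Lq r (rep_l2 (D t)) \<and>
        (\<lambda>n. Lq_norm r (\<lambda>x. s n t x - rep_l2 (D t) x)) \<longlonglongrightarrow> 0"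
    using bd AE_space
  proof eventually_elim
    case (elim t)
    then have t: "t \<in> {0..T}" by simp
    from elim obtain c where c: "c \<ge> 0" "AE x in lborel. cmod (rep_l2 (D t) x) \<le> c" by blast
    \<comment> \<open>Once \<open>real n\<close> reaches the essential bound of \<open>D t\<close>,
      truncation fixes \<open>D t\<close>, so it cannot move the sample away from it.\<close>
    have bound: "Lq_norm r (\<lambda>x. s n t x - rep_l2 (D t) x) \<le> (1 / (real n + 1)) powr (1 / r)" if n: "real n \<ge> c" for n
    proof -
      have eq: "AE x in lborel. clip (real n) (rep_l2 (D t) x) = rep_l2 (D t) x"
        using c(2) by eventually_elim (use n in \<open>auto intro!: clip_id\<close>)
      have L: "in_Lq 2 (\<lambda>x. s n t x - rep_l2 (D t) x)" by (intro in_L2_diff s2 in_L2_rep)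
      have "AE x in lborel. cmod (s n t x - rep_l2 (D t) x) \<le> 2 * real n"
        using c(2)
      proof eventually_elim
        case (elim x)
        then show ?case using norm_triangle_ineq4[of "s n t x" "rep_l2 (D t) x"] snB[of n t x] n by linarith
      qed
      from in_Lq_of_L2(2)[OF L _ this r]
      have le: "(LBINT x. cmod (s n t x - rep_l2 (D t) x) powr r)
          \<le> (2 * real n) powr (r - 2) * (norm (abs_l2 (\<lambda>x. s n t x - rep_l2 (D t) x)))\<^sup>2" by simp
      have "norm (abs_l2 (\<lambda>x. s n t x - rep_l2 (D t) x))
          \<le> norm (abs_l2 (\<lambda>x. rep_l2 (D (\<tau> n t)) x - rep_l2 (D t) x))"
      proof (rule norm_abs_l2_mono[OF L in_L2_diff[OF in_L2_rep in_L2_rep]])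
        show "AE x in lborel. cmod (s n t x - rep_l2 (D t) x) \<le> cmod (rep_l2 (D (\<tau> n t)) x - rep_l2 (D t) x)"
          using eq
        proof eventually_elim
          case (elim x)
          then show ?case
            using clip_lipschitz[of "real n" "rep_l2 (D (\<tau> n t)) x" "rep_l2 (D t) x"] by (simp add: s_def)
        qed
      qed
      also have "abs_l2 (\<lambda>x. rep_l2 (D (\<tau> n t)) x - rep_l2 (D t) x) = D (\<tau> n t) - D t"
        by (simp add: abs_l2_diff in_L2_rep abs_rep_l2)
      also have "norm (D (\<tau> n t) - D t) \<le> sqrt (\<delta> n)"
        using d(2)[OF \<tau>(1)[OF t] t \<tau>(2)[OF t], of n] by (simp add: dist_norm)
      finally have "(norm (abs_l2 (\<lambda>x. s n t x - rep_l2 (D t) x)))\<^sup>2 \<le> (sqrt (\<delta> n))\<^sup>2"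
        by (intro power_mono) auto
      also have "\<dots> = \<delta> n" using \<delta>[of n] by simp
      finally have "(2 * real n) powr (r - 2) * (norm (abs_l2 (\<lambda>x. s n t x - rep_l2 (D t) x)))\<^sup>2
          \<le> (2 * real n + 1) powr (r - 2) * \<delta> n"
        using r by (intro mult_mono powr_mono2) auto
      also have "\<dots> = 1 / (real n + 1)" by (simp add: \<delta>_def)
      finally have "(LBINT x. cmod (s n t x - rep_l2 (D t) x) powr r) \<le> 1 / (real n + 1)"
        using le by linarith
      then show ?thesis unfolding Lq_norm_def using r by (intro powr_mono2) auto
    qed
    have "(\<lambda>n. Lq_norm r (\<lambda>x. s n t x - rep_l2 (D t) x)) \<longlonglongrightarrow> 0"
    proof (rule Lim_null_comparison)
      obtain n0 :: nat where n0: "c \<le> real n0" using real_arch_simple by blast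
      show "\<forall>\<^sub>F n in sequentially. norm (Lq_norm r (\<lambda>x. s n t x - rep_l2 (D t) x)) \<le> (1 / (real n + 1)) powr (1 / r)"
      proof (rule eventually_sequentiallyI[of n0])
        fix n assume "n0 \<le> n"
        then have "c \<le> real n" using n0 by linarith
        from bound[OF this] show "norm (Lq_norm r (\<lambda>x. s n t x - rep_l2 (D t) x)) \<le> (1 / (real n + 1)) powr (1 / r)"
          by (simp add: Lq_norm_def)
      qed
      have "(\<lambda>n. 1 / (real n + 1)) \<longlonglongrightarrow> 0"
        by (rule tendsto_one_over_Suc)
      then show "(\<lambda>n. (1 / (real n + 1)) powr (1 / r)) \<longlonglongrightarrow> 0"
        using r by (intro tendsto_zero_powrI[where b = "1 / r"]) auto
    qed
    moreover have "in_Lq r (rep_l2 (D t))"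
      by (rule in_Lq_of_L2(1)[OF in_L2_rep c r])
    ultimately show ?case by blast
  qed
  ultimately show ?thesis unfolding strongly_measurable_Lq_def by (intro exI[of _ s]) auto
qed


section \<open>The Strichartz estimate\<close>

text \<open>The cutoff is an indicator over the fixed measure on \<open>{0..T}\<close>, so that all
  times share one measure space, as the duality argument requires.\<close>

definition running_integral :: "real \<Rightarrow> (real \<Rightarrow> l2) \<Rightarrow> real \<Rightarrow> l2" where
  "running_integral T \<phi> t = (LINT s|lebesgue_on {0..T}. indicator {..t} s *\<^sub>R \<phi> s)"

lemma finite_measure_lebesgue_on_Icc: "finite_measure (lebesgue_on {a..b::real})"
  by (rule finite_measureI) (simp add: emeasure_restrict_space space_restrict_space emeasure_lborel_Icc_eq)

lemma id_measurable_lebesgue_on: "(\<lambda>x. x) \<in> borel_measurable (lebesgue_on {a..b::real})"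
  by (rule borel_measurable_lebesgue_on_continuous) auto

text \<open>The function \<open>m\<close> stands for the \<open>q\<close>-th power of the spatial
  supremum of the solution: it is a countable supremum of pairings, hence measurable, and a bound on
  it at a time bounds the solution almost everywhere in space. This form hides the family of test
  functions from later use.\<close>

lemma maximal_estimate:
  fixes w :: "real \<Rightarrow> real"
  assumes w: "continuous_on {0..T} w" and A: "A \<ge> 0" and \<sigma>: "1/2 < \<sigma>" and q: "q = 4 * \<sigma>"
    and ball: "\<And>x r. r > 0 \<Longrightarrow> emeasure (lebesgue_on {0..T}) {s\<in>{0..T}. \<bar>x - w s\<bar> < r} \<le> ennreal (A * r powr \<sigma>)"
  shows "\<exists>C>0. \<forall>\<phi>. integrable (lebesgue_on {0..T}) \<phi> \<longrightarrow>
    (\<exists>m \<in> borel_measurable (lebesgue_on {0..T}).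
      (\<integral>\<^sup>+t. m t \<partial>lebesgue_on {0..T}) \<le> ennreal ((C * (LINT s|lebesgue_on {0..T}. norm (\<phi> s))) powr q) \<and>
      (\<forall>t\<in>{0..T}. \<forall>c\<ge>0. m t \<le> ennreal (c powr q) \<longrightarrow>
        (AE x in lborel. cmod (rep_l2 (inv_fourier (mult_l2 (chirp (w t)) (running_integral T \<phi> t))) x) \<le> c)))"
proof -
  define M where "M = lebesgue_on {0..T}"
  have space: "space M = {0..T}" by (simp add: M_def space_restrict_space)
  have fm: "finite_measure M" unfolding M_def by (rule finite_measure_lebesgue_on_Icc)
  interpret finite_measure M by (rule fm)
  have wM [measurable]: "w \<in> borel_measurable M" unfolding M_def
    by (rule borel_measurable_lebesgue_on_continuous[OF w]) simp
  define q' where "q' = q / (q - 1)"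
  have ball': "emeasure M {s\<in>space M. \<bar>x - w s\<bar> < r} \<le> ennreal (A * r powr \<sigma>)" if "r > 0" for x r
    using ball[OF that, of x] unfolding M_def by (simp add: space_restrict_space)
  obtain C0 where C0: "C0 > 0" "\<And>h Y. h \<in> borel_measurable M \<Longrightarrow> (\<And>s. 0 \<le> h s) \<Longrightarrow> 0 < Y \<Longrightarrow>
    (\<integral>\<^sup>+s. ennreal (h s powr q') \<partial>M) \<le> ennreal (Y powr q') \<Longrightarrow>
    (\<integral>\<^sup>+t. \<integral>\<^sup>+s. ennreal (\<bar>w t - w s\<bar> powr - (1/2) * h t * h s) \<partial>M \<partial>M) \<le> ennreal (C0 * Y\<^sup>2)"
    using fractional_integral_form[OF sigma_finite_measure_axioms wM ball' A \<sigma> q q'_def] by blast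
  \<comment> \<open>Positions, the two phases for real and imaginary part, and the damping index: a
    countable set, so the test functions can be enumerated.\<close>
  define I where "I = (\<rat> :: real set) \<times> {1, \<i>} \<times> (UNIV :: nat set)"
  have I: "countable I" "I \<noteq> {}"
    unfolding I_def by (auto intro!: countable_SIGMA countable_rat)
  define e where "e j t = (case from_nat_into I j of (x, c, n) \<Rightarrow> abs_l2 (gauss_wave c (1 / (real n + 1)) x (w t)))" for j t
  have e_index: "\<exists>x c n. c \<in> {1, \<i>} \<and> (\<forall>t. e j t = abs_l2 (gauss_wave c (1 / (real n + 1)) x (w t)))" for j
  proof -
    obtain x c n where j: "from_nat_into I j = (x, c, n)" by (cases "from_nat_into I j") auto
    moreover have "from_nat_into I j \<in> I" by (rule from_nat_into[OF I(2)])
    ultimately have "c \<in> {1, \<i>}" by (auto simp: I_def)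
    then show ?thesis using j by (intro exI[of _ x] exI[of _ c] exI[of _ n]) (simp add: e_def)
  qed
  have e_surj: "\<exists>j. \<forall>t. e j t = abs_l2 (gauss_wave c (1 / (real n + 1)) x (w t))" if "x \<in> \<rat>" "c \<in> {1, \<i>}" for x c n
  proof -
    have "(x, c, n) \<in> I" using that by (simp add: I_def)
    then obtain j where "from_nat_into I j = (x, c, n)" using from_nat_into_surj[OF I(1)] by blast
    then show ?thesis by (intro exI[of _ j]) (simp add: e_def)
  qed
  have eM: "e j \<in> borel_measurable M" for j
  proof -
    obtain x c n where j: "\<And>t. e j t = abs_l2 (gauss_wave c (1 / (real n + 1)) x (w t))" using e_index[of j] by blast
    have "continuous_on UNIV (\<lambda>a. abs_l2 (gauss_wave c (1 / (real n + 1)) x a))"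
      unfolding continuous_on_sequentially comp_def by (auto intro!: tendsto_gauss_wave)
    from borel_measurable_continuous_on[OF this wM] show ?thesis
      unfolding j[abs_def] .
  qed
  define B where "B j = norm (e j 0)" for j
  have eB: "norm (e j t) \<le> B j" for j t
  proof -
    obtain x c n where j: "\<And>t. e j t = abs_l2 (gauss_wave c (1 / (real n + 1)) x (w t))" using e_index[of j] by blast
    show ?thesis unfolding B_def j by (intro norm_abs_l2_mono in_L2_gauss_wave AE_I2) (auto simp: norm_gauss_wave)
  qed
  define K where "K t s = sqrt pi * \<bar>w t - w s\<bar> powr - (1/2)" for t s
  have K: "AE s in M. \<forall>i j. \<bar>e i t \<bullet> e j s\<bar> \<le> K t s" if t: "t \<in> space M" for t
  proof -
    \<comment> \<open>Where \<open>w t = w s\<close> the value of \<open>K\<close> is 0, because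
      \<open>0 powr x = 0\<close>, and the dispersive bound says nothing. Balls with radius tending
      to 0 show that these \<open>s\<close> form a null set.\<close>
    have "AE s in M. w t \<noteq> w s"
    proof (rule AE_I)
      show "{s \<in> space M. \<not> w t \<noteq> w s} \<subseteq> {s \<in> space M. w t = w s}" by auto
      show "{s \<in> space M. w t = w s} \<in> sets M" by measurable
      have le: "emeasure M {s \<in> space M. w t = w s} \<le> ennreal (A * r powr \<sigma>)" if "r > 0" for r
      proof (rule order_trans[OF emeasure_mono ball'[OF that, of "w t"]])
        show "{s \<in> space M. w t = w s} \<subseteq> {s \<in> space M. \<bar>w t - w s\<bar> < r}" using that by auto
        show "{s \<in> space M. \<bar>w t - w s\<bar> < r} \<in> sets M" by measurable
      qed
      have "(\<lambda>n. 1 / (real n + 1)) \<longlonglongrightarrow> 0"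
        by (rule tendsto_one_over_Suc)
      then have "(\<lambda>n. (1 / (real n + 1)) powr \<sigma>) \<longlonglongrightarrow> 0"
        using \<sigma> by (intro tendsto_zero_powrI[where b = \<sigma>]) auto
      then have "(\<lambda>n. ennreal (A * (1 / (real n + 1)) powr \<sigma>)) \<longlonglongrightarrow> ennreal (A * 0)"
        by (intro tendsto_ennrealI tendsto_intros)
      then have "emeasure M {s \<in> space M. w t = w s} \<le> ennreal (A * 0)"
        by (rule LIMSEQ_le_const) (auto intro!: le)
      then show "emeasure M {s \<in> space M. w t = w s} = 0" by simp
    qed
    then show ?thesis
    proof eventually_elim
      case (elim s)
      show ?case
      proof (intro allI)
        fix i j
        obtain x c n where i: "c \<in> {1, \<i>}" "\<And>t. e i t = abs_l2 (gauss_wave c (1 / (real n + 1)) x (w t))" using e_index[of i] by blast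
        obtain x' c' n' where j: "c' \<in> {1, \<i>}" "\<And>t. e j t = abs_l2 (gauss_wave c' (1 / (real n' + 1)) x' (w t))" using e_index[of j] by blast
        have "\<bar>e i t \<bullet> e j s\<bar> \<le> sqrt (pi / \<bar>w t - w s\<bar>)"
          unfolding i(2) j(2) using i(1) j(1) elim by (intro inner_gauss_wave_bound) auto
        also have "\<dots> = K t s"
        proof -
          have "\<bar>w t - w s\<bar> powr - (1/2) = 1 / sqrt \<bar>w t - w s\<bar>"
            unfolding powr_minus_divide powr_half_sqrt[OF abs_ge_zero] ..
          then show ?thesis by (simp add: K_def real_sqrt_divide)
        qed
        finally show "\<bar>e i t \<bullet> e j s\<bar> \<le> K t s" .
      qed
    qed
  qed
  have form: "(\<integral>\<^sup>+t. \<integral>\<^sup>+s. ennreal (K t s * h t * h s) \<partial>M \<partial>M) \<le> ennreal (sqrt pi * C0 * Y\<^sup>2)"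
    if [measurable]: "h \<in> borel_measurable M" and h: "\<And>s. 0 \<le> h s" "0 < Y"
      "(\<integral>\<^sup>+s. ennreal (h s powr q') \<partial>M) \<le> ennreal (Y powr q')" for h Y
  proof -
    have "(\<integral>\<^sup>+t. \<integral>\<^sup>+s. ennreal (K t s * h t * h s) \<partial>M \<partial>M)
        = (\<integral>\<^sup>+t. \<integral>\<^sup>+s. ennreal (sqrt pi) * ennreal (\<bar>w t - w s\<bar> powr - (1/2) * h t * h s) \<partial>M \<partial>M)"
      by (intro nn_integral_cong) (simp add: K_def ennreal_mult'[symmetric] mult.assoc)
    also have "\<dots> = ennreal (sqrt pi) * (\<integral>\<^sup>+t. \<integral>\<^sup>+s. ennreal (\<bar>w t - w s\<bar> powr - (1/2) * h t * h s) \<partial>M \<partial>M)"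
      by (simp add: nn_integral_cmult)
    also have "\<dots> \<le> ennreal (sqrt pi) * ennreal (C0 * Y\<^sup>2)"
      by (intro mult_left_mono C0(2) h) auto
    finally show ?thesis by (simp add: ennreal_mult'[symmetric] mult.assoc)
  qed
  \<comment> \<open>The constant of the form, with \<open>sqrt pi\<close> from the dispersive
    estimate, bounds a squared norm; hence the outer root.\<close>
  define C where "C = sqrt (sqrt pi * C0)"
  have C: "C > 0" using C0(1) by (simp add: C_def)
  have "\<exists>m \<in> borel_measurable M.
      (\<integral>\<^sup>+t. m t \<partial>M) \<le> ennreal ((C * (LINT s|M. norm (\<phi> s))) powr q) \<and>
      (\<forall>t\<in>{0..T}. \<forall>c\<ge>0. m t \<le> ennreal (c powr q) \<longrightarrow>
        (AE x in lborel. cmod (rep_l2 (inv_fourier (mult_l2 (chirp (w t)) (running_integral T \<phi> t))) x) \<le> c))"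
    if \<phi>: "integrable M \<phi>" for \<phi>
  proof (intro bexI[of _ "\<lambda>t. SUP j. ennreal (\<bar>e j t \<bullet> running_integral T \<phi> t\<bar> powr q)"] conjI ballI allI impI)
    have "q > 1" using \<sigma> q by simp
    have idM [measurable]: "(\<lambda>x. x) \<in> borel_measurable M" unfolding M_def by (rule id_measurable_lebesgue_on)
    have K0: "0 \<le> K t s" for t s by (simp add: K_def)
    have C1: "0 < sqrt pi * C0" using C0(1) by simp
    show "(\<integral>\<^sup>+t. (SUP j. ennreal (\<bar>e j t \<bullet> running_integral T \<phi> t\<bar> powr q)) \<partial>M) \<le> ennreal ((C * (LINT s|M. norm (\<phi> s))) powr q)"
      unfolding C_def running_integral_def M_def[symmetric]
      by (rule retarded_maximal_estimate[OF fm idM eM eB \<phi> K0 K \<open>q > 1\<close> q'_def C1 form])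
    have [measurable]: "running_integral T \<phi> \<in> borel_measurable M"
      unfolding running_integral_def[abs_def] M_def[symmetric]
      by (rule running_measurable[OF sigma_finite_measure_axioms \<phi> idM])
    show "(\<lambda>t. SUP j. ennreal (\<bar>e j t \<bullet> running_integral T \<phi> t\<bar> powr q)) \<in> borel_measurable M"
      using eM by measurable
    fix t c :: real
    assume t: "t \<in> {0..T}" and c: "0 \<le> c" and le: "(SUP j. ennreal (\<bar>e j t \<bullet> running_integral T \<phi> t\<bar> powr q)) \<le> ennreal (c powr q)"
    have "\<bar>e j t \<bullet> running_integral T \<phi> t\<bar> \<le> c" for j
    proof -
      have "ennreal (\<bar>e j t \<bullet> running_integral T \<phi> t\<bar> powr q) \<le> ennreal (c powr q)"
        by (rule order_trans[OF SUP_upper le]) simp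
      then have "\<bar>e j t \<bullet> running_integral T \<phi> t\<bar> powr q \<le> c powr q" by simp
      then show ?thesis using \<open>q > 1\<close> c by (metis abs_ge_zero not_less powr_less_mono2 less_trans zero_less_one)
    qed
    then have "\<bar>abs_l2 (gauss_wave d (1 / (real n + 1)) x (w t)) \<bullet> running_integral T \<phi> t\<bar> \<le> c"
      if "x \<in> \<rat>" "d \<in> {1, \<i>}" for x d n
      using e_surj[OF that, of n] by metis
    from propagated_bound[OF this]
    have "AE x in lborel. cmod (rep_l2 (inv_fourier (mult_l2 (chirp (w t)) (running_integral T \<phi> t))) x) \<le> c / pi" by simp
    moreover have "c / pi \<le> c" using c pi_ge_two mult_left_mono[of 1 pi c] by (simp add: divide_le_eq)
    ultimately show "AE x in lborel. cmod (rep_l2 (inv_fourier (mult_l2 (chirp (w t)) (running_integral T \<phi> t))) x) \<le> c"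
      by (auto elim!: eventually_mono)
  qed
  then show ?thesis using C unfolding M_def by blast
qed

lemma continuous_on_running_integral:
  assumes \<phi>: "integrable (lebesgue_on {0..T}) \<phi>"
  shows "continuous_on {0..T} (running_integral T \<phi>)"
  unfolding continuous_on_sequentially comp_def
proof (intro allI ballI impI, elim conjE)
  fix u t assume "t \<in> {0..T}" and u: "u \<longlonglongrightarrow> t"
  define M where "M = lebesgue_on {0..T}"
  have \<phi>M: "integrable M \<phi>" using \<phi> by (simp add: M_def)
  have m: "(\<lambda>s. indicator {..t} s *\<^sub>R \<phi> s) \<in> borel_measurable M" for t
    unfolding M_def by (rule borel_measurable_integrable[OF integrable_running[OF
      finite_measure.axioms(1)[OF finite_measure_lebesgue_on_Icc] \<phi> id_measurable_lebesgue_on]])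
  have "(\<lambda>n. LINT s|M. indicator {..u n} s *\<^sub>R \<phi> s) \<longlonglongrightarrow> (LINT s|M. indicator {..t} s *\<^sub>R \<phi> s)"
  proof (rule integral_dominated_convergence)
    show "integrable M (\<lambda>s. norm (\<phi> s))" using \<phi>M by simp
    show "AE s in M. norm (indicator {..u n} s *\<^sub>R \<phi> s) \<le> norm (\<phi> s)" for n
      by (auto simp: indicator_def)
    have "AE s in lebesgue. s \<noteq> t" by (rule AE_completion[OF AE_lborel_singleton])
    then have "AE s in M. s \<noteq> t" unfolding M_def by (subst AE_restrict_space_iff) auto
    then show "AE s in M. (\<lambda>n. indicator {..u n} s *\<^sub>R \<phi> s) \<longlonglongrightarrow> indicator {..t} s *\<^sub>R \<phi> s"
    proof eventually_elim
      case (elim s)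
      have "\<forall>\<^sub>F n in sequentially. indicator {..u n} s = (indicator {..t} s :: real)"
      proof (cases "s < t")
        case True
        from order_tendstoD(1)[OF u this] show ?thesis by eventually_elim (use True in auto)
      next
        case False
        then have "t < s" using elim by simp
        from order_tendstoD(2)[OF u this] show ?thesis by eventually_elim (use \<open>t < s\<close> in auto)
      qed
      then have "\<forall>\<^sub>F n in sequentially. indicator {..u n} s *\<^sub>R \<phi> s = indicator {..t} s *\<^sub>R \<phi> s"
        by eventually_elim simp
      then show ?case by (rule tendsto_eventually)
    qed
  qed (rule m)+
  then show "(\<lambda>n. running_integral T \<phi> (u n)) \<longlonglongrightarrow> running_integral T \<phi> t" by (simp add: running_integral_def M_def)
qed

lemma norm_running_integral_le:
  assumes \<phi>: "integrable (lebesgue_on {0..T}) \<phi>"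
  shows "norm (running_integral T \<phi> t) \<le> (LINT s|lebesgue_on {0..T}. norm (\<phi> s))"
  unfolding running_integral_def
  by (rule norm_running_le[OF finite_measure.axioms(1)[OF finite_measure_lebesgue_on_Icc] \<phi> id_measurable_lebesgue_on])

text \<open>The Fourier side of \<open>inv (U w s) (\<psi> s)\<close>. In these variables the
  Duhamel integral is a running integral followed by one chirp at the final time.\<close>

definition profile :: "(real \<Rightarrow> real) \<Rightarrow> (real \<Rightarrow> l2) \<Rightarrow> real \<Rightarrow> l2" where
  "profile w \<psi> s = mult_l2 (chirp (- w s)) (fourier (\<psi> s))"

lemma norm_profile: "norm (profile w \<psi> s) = sqrt (2 * pi) * norm (\<psi> s)"
  by (simp add: profile_def norm_mult_chirp norm_fourier)

lemma integrable_profile: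
  assumes w: "continuous_on {0..T} w" and \<psi>: "integrable (lebesgue_on {0..T}) \<psi>"
  shows "integrable (lebesgue_on {0..T}) (profile w \<psi>)"
proof -
  have wM: "w \<in> borel_measurable (lebesgue_on {0..T})"
    by (rule borel_measurable_lebesgue_on_continuous[OF w]) simp
  \<comment> \<open>Measurability in \<open>s\<close> comes from composing the measurable pair
    \<open>(w s, \<psi> s)\<close> with this jointly continuous map.\<close>
  have "continuous_on UNIV (\<lambda>z :: real \<times> l2. mult_l2 (chirp (- fst z)) (fourier (snd z)))"
    unfolding continuous_on_sequentially comp_def
    by (auto intro!: tendsto_mult_chirp bounded_linear.tendsto[OF bounded_linear_fourier] tendsto_minus
        dest: tendsto_fst tendsto_snd)
  from borel_measurable_continuous_Pair[OF wM borel_measurable_integrable[OF \<psi>] this]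
  have m: "profile w \<psi> \<in> borel_measurable (lebesgue_on {0..T})" by (simp add: profile_def[abs_def])
  have "integrable (lebesgue_on {0..T}) (\<lambda>s. sqrt (2 * pi) *\<^sub>R \<psi> s)" using \<psi> by (rule integrable_scaleR_right)
  then show ?thesis by (rule Bochner_Integration.integrable_bound[OF _ m]) (simp add: norm_profile)
qed

lemma duhamel_eq:
  assumes w: "continuous_on {0..T} w" and \<psi>: "integrable (lebesgue_on {0..T}) \<psi>" and t: "t \<in> {0..T}"
  shows "duhamel w \<psi> t = inv_fourier (mult_l2 (chirp (w t)) (running_integral T (profile w \<psi>) t))"
proof -
  let ?L = "\<lambda>g. inv_fourier (mult_l2 (chirp (w t)) g)"
  have L: "bounded_linear ?L"
    by (intro bounded_linear_compose[OF bounded_linear_inv_fourier] bounded_linear_mult_l2 multiplier_chirp)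
  have \<phi>: "integrable (lebesgue_on {0..T}) (profile w \<psi>)" by (rule integrable_profile[OF w \<psi>])
  have i: "integrable (lebesgue_on {0..t}) (profile w \<psi>)"
  proof -
    have "integrable lebesgue (\<lambda>s. indicator {0..T} s *\<^sub>R profile w \<psi> s)"
      using \<phi> by (subst (asm) integrable_restrict_space) auto
    then have "integrable lebesgue (\<lambda>s. indicator {0..t} s *\<^sub>R (indicator {0..T} s *\<^sub>R profile w \<psi> s))"
      by (rule integrable_mult_indicator[rotated]) simp
    also have "(\<lambda>s. indicator {0..t} s *\<^sub>R (indicator {0..T} s *\<^sub>R profile w \<psi> s)) = (\<lambda>s. indicator {0..t} s *\<^sub>R profile w \<psi> s)"
      using t by (auto simp: indicator_def fun_eq_iff)
    finally show ?thesis by (subst integrable_restrict_space) auto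
  qed
  have "duhamel w \<psi> t = (LINT s|lebesgue_on {0..t}. ?L (profile w \<psi> s))"
    by (simp add: duhamel_def U_eq inv_U profile_def)
  also have "\<dots> = ?L (LINT s|lebesgue_on {0..t}. profile w \<psi> s)"
    by (rule integral_bounded_linear[OF L i])
  also have "(LINT s|lebesgue_on {0..t}. profile w \<psi> s) = (LINT s|lebesgue. indicator {0..t} s *\<^sub>R profile w \<psi> s)"
    by (subst integral_restrict_space) auto
  also have "\<dots> = (LINT s|lebesgue. indicator {0..T} s *\<^sub>R (indicator {..t} s *\<^sub>R profile w \<psi> s))"
    using t by (intro Bochner_Integration.integral_cong) (auto simp: indicator_def)
  also have "\<dots> = running_integral T (profile w \<psi>) t"
    unfolding running_integral_def by (subst integral_restrict_space) auto
  finally show ?thesis .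
qed

lemma continuous_on_duhamel:
  assumes w: "continuous_on {0..T} w" and \<psi>: "integrable (lebesgue_on {0..T}) \<psi>"
  shows "continuous_on {0..T} (duhamel w \<psi>)"
  unfolding continuous_on_sequentially comp_def
proof (intro allI ballI impI, elim conjE)
  fix u t assume t: "t \<in> {0..T}" and u: "\<forall>n. u n \<in> {0..T}" "u \<longlonglongrightarrow> t"
  have "(\<lambda>n. inv_fourier (mult_l2 (chirp (w (u n))) (running_integral T (profile w \<psi>) (u n))))
      \<longlonglongrightarrow> inv_fourier (mult_l2 (chirp (w t)) (running_integral T (profile w \<psi>) t))"
    using u t w continuous_on_running_integral[OF integrable_profile[OF w \<psi>]]
    by (intro bounded_linear.tendsto[OF bounded_linear_inv_fourier] tendsto_mult_chirp)
      (auto simp: continuous_on_sequentially comp_def)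
  then show "(\<lambda>n. duhamel w \<psi> (u n)) \<longlonglongrightarrow> duhamel w \<psi> t"
    using u t by (simp add: duhamel_eq[OF w \<psi>])
qed

lemma norm_duhamel_le:
  assumes w: "continuous_on {0..T} w" and \<psi>: "integrable (lebesgue_on {0..T}) \<psi>" and t: "t \<in> {0..T}"
  shows "norm (duhamel w \<psi> t) \<le> (LINT s|lebesgue_on {0..T}. norm (\<psi> s))"
proof -
  have "norm (duhamel w \<psi> t) = norm (running_integral T (profile w \<psi>) t) / sqrt (2 * pi)"
    by (simp add: duhamel_eq[OF w \<psi> t] norm_inv_fourier norm_mult_chirp)
  also have "\<dots> \<le> (LINT s|lebesgue_on {0..T}. norm (profile w \<psi> s)) / sqrt (2 * pi)"
    by (intro divide_right_mono norm_running_integral_le integrable_profile w \<psi>) simp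
  also have "\<dots> = (LINT s|lebesgue_on {0..T}. norm (\<psi> s))" by (simp add: norm_profile)
  finally show ?thesis .
qed

text \<open>At almost every time the \<open>p\<close>-th power of the spatial norm is at most
  \<open>c t powr (p - 1) * P\<close>, where \<open>c t\<close> bounds the solution in space and
  \<open>P\<close> is the norm of the data. As \<open>p - 1 \<le> q\<close> on a finite time
  interval, the bound on the integral of \<open>m\<close> controls this.\<close>

proposition duhamel_estimate:
  assumes T: "T > 0" and w: "continuous_on {0..T} w" and A: "A \<ge> 0" and \<sigma>: "1/2 < \<sigma>" and q: "q = 4 * \<sigma>"
    and ball: "\<And>x r. r > 0 \<Longrightarrow> emeasure (lebesgue_on {0..T}) {s\<in>{0..T}. \<bar>x - w s\<bar> < r} \<le> ennreal (A * r powr \<sigma>)"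
    and p: "1 < p" "p - 1 \<le> q"
  shows "\<exists>C>0. \<forall>\<psi>. integrable (lebesgue_on {0..T}) \<psi> \<longrightarrow>
      in_Lp_Lq T p (2 * p) (\<lambda>t. rep_l2 (duhamel w \<psi> t)) \<and>
      Lp_Lq_norm T p (2 * p) (\<lambda>t. rep_l2 (duhamel w \<psi> t))
        \<le> C * (LINT s|lebesgue_on {0..T}. norm (\<psi> s))"
proof -
  obtain C0 where C0: "C0 > 0" and max: "\<And>\<phi>. integrable (lebesgue_on {0..T}) \<phi> \<Longrightarrow>
    (\<exists>m \<in> borel_measurable (lebesgue_on {0..T}).
      (\<integral>\<^sup>+t. m t \<partial>lebesgue_on {0..T}) \<le> ennreal ((C0 * (LINT s|lebesgue_on {0..T}. norm (\<phi> s))) powr q) \<and>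
      (\<forall>t\<in>{0..T}. \<forall>c\<ge>0. m t \<le> ennreal (c powr q) \<longrightarrow>
        (AE x in lborel. cmod (rep_l2 (inv_fourier (mult_l2 (chirp (w t)) (running_integral T \<phi> t))) x) \<le> c)))"
    using maximal_estimate[OF w A \<sigma> q ball] by blast
  define C1 where "C1 = C0 * sqrt (2 * pi)"
  \<comment> \<open>Integrating \<open>1 + (c t / Y) powr q\<close> over \<open>{0..T}\<close> gives
    \<open>T\<close> from the constant and at most \<open>C1 powr q\<close> from the estimate for
    \<open>m\<close>.\<close>
  define C2 where "C2 = T + C1 powr q"
  have C2: "C2 > 0" using T by (simp add: C2_def add_pos_nonneg)
  have q0: "q > 2" using \<sigma> q by simp
  define M where "M = lebesgue_on {0..T}"
  have space: "space M = {0..T}" by (simp add: M_def space_restrict_space)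
  interpret finite_measure M unfolding M_def by (rule finite_measure_lebesgue_on_Icc)
  have MT: "measure M (space M) = T" using T by (simp add: M_def measure_restrict_space space_restrict_space)
  have main: "in_Lp_Lq T p (2 * p) (\<lambda>t. rep_l2 (duhamel w \<psi> t)) \<and>
      Lp_Lq_norm T p (2 * p) (\<lambda>t. rep_l2 (duhamel w \<psi> t)) \<le> C2 powr (1 / p) * (LINT s|M. norm (\<psi> s))"
    if \<psi>: "integrable M \<psi>" for \<psi>
  proof -
    have \<psi>': "integrable (lebesgue_on {0..T}) \<psi>" using \<psi> by (simp add: M_def)
    define P where "P = (LINT s|M. norm (\<psi> s))"
    have P: "P \<ge> 0" unfolding P_def by (rule Bochner_Integration.integral_nonneg) simp
    define D where "D = duhamel w \<psi>"
    have "(LINT s|M. norm (profile w \<psi> s)) = sqrt (2 * pi) * P" by (simp add: norm_profile P_def)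
    then obtain m where mM [measurable]: "m \<in> borel_measurable M"
      and m: "(\<integral>\<^sup>+t. m t \<partial>M) \<le> ennreal ((C1 * P) powr q)"
      and mD: "\<And>t c. t \<in> {0..T} \<Longrightarrow> 0 \<le> c \<Longrightarrow> m t \<le> ennreal (c powr q) \<Longrightarrow> (AE x in lborel. cmod (rep_l2 (D t) x) \<le> c)"
      using max[OF integrable_profile[OF w \<psi>']]
      by (auto simp: M_def C1_def mult.assoc D_def duhamel_eq[OF w \<psi>'])
    have fin: "AE t in M. m t \<noteq> \<infinity>"
      using le_less_trans[OF m ennreal_less_top] by (intro nn_integral_PInf_AE) auto
    define c where "c t = enn2real (m t) powr (1 / q)" for t
    have c0: "0 \<le> c t" for t by (simp add: c_def)
    have c_q: "c t powr q = enn2real (m t)" for t using q0 by (simp add: c_def powr_powr)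
    have cM [measurable]: "c \<in> borel_measurable M" unfolding c_def by measurable
    have bd: "AE t in M. AE x in lborel. cmod (rep_l2 (D t) x) \<le> c t"
      using fin AE_space
    proof eventually_elim
      case (elim t)
      then show ?case using c0 by (intro mD) (auto simp: space c_q less_top)
    qed
    have Dc: "continuous_on {0..T} D" unfolding D_def by (rule continuous_on_duhamel[OF w \<psi>'])
    have DM: "D \<in> borel_measurable M" unfolding M_def
      by (rule borel_measurable_lebesgue_on_continuous[OF Dc]) simp
    have sm: "strongly_measurable_Lq T (2 * p) (\<lambda>t. rep_l2 (D t))"
      using T Dc p(1) bd c0 unfolding M_def
      by (intro strongly_measurable_Lq_continuous) (auto elim!: eventually_mono)
    define N where "N t = Lq_norm (2 * p) (rep_l2 (D t)) powr p" for t
    have [measurable]: "(\<lambda>t. Lq_norm (2 * p) (rep_l2 (D t))) \<in> borel_measurable M"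
      by (rule measurable_compose[OF DM Lq_norm_measurable]) (use p(1) in simp)
    have [measurable]: "N \<in> borel_measurable M" unfolding N_def by measurable
    have N0: "0 \<le> N t" for t by (simp add: N_def)
    have Nc: "AE t in M. N t \<le> c t powr (p - 1) * P"
      using bd AE_space
    proof eventually_elim
      case (elim t)
      have nD: "norm (D t) \<le> P"
        using norm_duhamel_le[OF w \<psi>', of t] elim by (simp add: D_def P_def M_def space_restrict_space)
      have "(LBINT x. cmod (rep_l2 (D t) x) powr (2 * p)) \<le> c t powr (2 * p - 2) * (norm (D t))\<^sup>2"
        using in_Lq_of_L2(2)[OF in_L2_rep c0 elim(1), of "2 * p"] p(1) by (simp add: abs_rep_l2)
      also have "\<dots> \<le> c t powr (2 * p - 2) * P\<^sup>2"
        using nD by (intro mult_left_mono power_mono) auto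
      also have "\<dots> = (c t powr (p - 1) * P)\<^sup>2"
      proof -
        have "c t powr (2 * p - 2) = c t powr (p - 1) * c t powr (p - 1)"
          by (simp add: powr_add[symmetric])
        then show ?thesis by (simp add: power2_eq_square)
      qed
      finally have le: "(LBINT x. cmod (rep_l2 (D t) x) powr (2 * p)) \<le> (c t powr (p - 1) * P)\<^sup>2" .
      have "N t = sqrt (LBINT x. cmod (rep_l2 (D t) x) powr (2 * p))"
        using p(1) by (simp add: N_def Lq_norm_def powr_powr powr_half_sqrt)
      also have "\<dots> \<le> sqrt ((c t powr (p - 1) * P)\<^sup>2)" using le by (rule real_sqrt_le_mono)
      also have "\<dots> = c t powr (p - 1) * P" using P by simp
      finally show ?case .
    qed
    \<comment> \<open>\<open>Y\<close> replaces \<open>P\<close> so that one can divide by it even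
      when the data vanish; at the end \<open>Y\<close> is allowed to approach
      \<open>P\<close>.\<close>
    have NY: "(\<integral>\<^sup>+t. ennreal (N t) \<partial>M) \<le> ennreal (C2 * Y powr p)" if Y: "P < Y" for Y
    proof -
      have Y0: "Y > 0" using P Y by linarith
      have "AE t in M. ennreal (N t) \<le> ennreal (Y powr p) + ennreal (Y powr (p - q)) * m t"
        using Nc fin
      proof eventually_elim
        case (elim t)
        \<comment> \<open>Takes the place of Hoelder's inequality in time: where the ratio exceeds
          1, its power \<open>p - 1\<close> is at most its power \<open>q\<close>.\<close>
        have "(c t / Y) powr (p - 1) \<le> 1 + (c t / Y) powr q"
        proof (cases "c t / Y \<le> 1")
          case True
          then have "(c t / Y) powr (p - 1) \<le> 1 powr (p - 1)" using p c0[of t] Y0 by (intro powr_mono2) auto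
          then show ?thesis by (simp add: add_increasing2)
        next
          case False
          then have "(c t / Y) powr (p - 1) \<le> (c t / Y) powr q" using p by (intro powr_mono) auto
          then show ?thesis by simp
        qed
        then have "Y powr p * (c t / Y) powr (p - 1) \<le> Y powr p * (1 + (c t / Y) powr q)"
          by (intro mult_left_mono) auto
        moreover have "Y powr p * (c t / Y) powr (p - 1) = Y * c t powr (p - 1)"
          using Y0 c0[of t] by (simp add: powr_divide powr_diff)
        moreover have "Y powr p * (1 + (c t / Y) powr q) = Y powr p + Y powr (p - q) * enn2real (m t)"
          using Y0 c0[of t] by (simp add: powr_divide powr_diff c_q[symmetric] distrib_left)
        moreover have "c t powr (p - 1) * P \<le> Y * c t powr (p - 1)"
          using Y by (subst mult.commute) (intro mult_right_mono, auto)
        ultimately have "N t \<le> Y powr p + Y powr (p - q) * enn2real (m t)" using elim(1) by linarith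
        then have "ennreal (N t) \<le> ennreal (Y powr p + Y powr (p - q) * enn2real (m t))" by (rule ennreal_leI)
        also have "\<dots> = ennreal (Y powr p) + ennreal (Y powr (p - q)) * ennreal (enn2real (m t))"
          by (simp add: ennreal_plus ennreal_mult)
        also have "ennreal (enn2real (m t)) = m t" using elim(2) by (simp add: less_top)
        finally show ?case .
      qed
      then have "(\<integral>\<^sup>+t. ennreal (N t) \<partial>M) \<le> (\<integral>\<^sup>+t. ennreal (Y powr p) + ennreal (Y powr (p - q)) * m t \<partial>M)"
        by (rule nn_integral_mono_AE)
      also have "\<dots> = ennreal (Y powr p) * emeasure M (space M) + ennreal (Y powr (p - q)) * (\<integral>\<^sup>+t. m t \<partial>M)"
        by (simp add: nn_integral_add nn_integral_cmult)
      also have "\<dots> \<le> ennreal (Y powr p) * ennreal T + ennreal (Y powr (p - q)) * ennreal ((C1 * Y) powr q)"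
      proof (intro add_mono mult_left_mono)
        show "emeasure M (space M) \<le> ennreal T" by (simp add: emeasure_eq_measure MT)
        have "(C1 * P) powr q \<le> (C1 * Y) powr q"
          using C0 P Y q0 by (intro powr_mono2 mult_left_mono) (auto simp: C1_def)
        then show "(\<integral>\<^sup>+t. m t \<partial>M) \<le> ennreal ((C1 * Y) powr q)" by (intro order_trans[OF m] ennreal_leI)
      qed auto
      also have "\<dots> = ennreal (Y powr p * T + Y powr (p - q) * (C1 * Y) powr q)"
        using T by (simp add: ennreal_plus ennreal_mult)
      also have "Y powr p * T + Y powr (p - q) * (C1 * Y) powr q = C2 * Y powr p"
        using Y0 C0 by (simp add: C2_def C1_def powr_mult powr_diff algebra_simps)
      finally show ?thesis .
    qed
    have Ni: "integrable M N"
    proof (rule integrableI_bounded)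
      have "(\<integral>\<^sup>+t. ennreal (N t) \<partial>M) < \<infinity>"
        using le_less_trans[OF NY[of "P + 1"] ennreal_less_top] by simp
      then show "(\<integral>\<^sup>+t. ennreal (norm (N t)) \<partial>M) < \<infinity>" using N0 by simp
    qed measurable
    have "(LINT t|M. N t) powr (1 / p) \<le> C2 powr (1 / p) * P"
    proof (rule dense_ge)
      fix z assume z: "C2 powr (1 / p) * P < z"
      define Y where "Y = z / C2 powr (1 / p)"
      have Y: "P < Y" using z C2 by (simp add: Y_def field_simps)
      then have Y0: "Y > 0" using P by linarith
      have "ennreal (LINT t|M. N t) \<le> ennreal (C2 * Y powr p)"
        using NY[OF Y] Ni N0 by (simp add: nn_integral_eq_integral)
      then have "(LINT t|M. N t) \<le> C2 * Y powr p" using C2 by (simp add: ennreal_le_iff)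
      then have "(LINT t|M. N t) powr (1 / p) \<le> (C2 * Y powr p) powr (1 / p)"
        using p N0 by (intro powr_mono2 Bochner_Integration.integral_nonneg) auto
      also have "\<dots> = C2 powr (1 / p) * Y" using C2 Y0 p by (simp add: powr_mult powr_powr)
      also have "\<dots> = z" using C2 by (simp add: Y_def)
      finally show "(LINT t|M. N t) powr (1 / p) \<le> z" .
    qed
    then show ?thesis
      using sm Ni unfolding in_Lp_Lq_def Lp_Lq_norm_def N_def D_def P_def M_def by blast
  qed
  show ?thesis
    using main C2 unfolding M_def by (intro exI[of _ "C2 powr (1 / p)"]) auto
qed

theorem theorem1p10:
  fixes p :: real
  assumes "2 < p" and "p \<le> 5"
  shows "\<exists>\<gamma>s>0. \<forall>T \<rho> \<gamma> :: real. \<forall>w :: real \<Rightarrow> real.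
    T > 0 \<longrightarrow> \<rho> > min (3 / 2 - 2 / p) 1 \<longrightarrow> \<gamma> > 1 / 2 \<longrightarrow>
    continuous_on {0..T} w \<longrightarrow> irregular \<rho> \<gamma> T w \<longrightarrow>
    (\<exists>C>0. \<forall>\<psi> :: real \<Rightarrow> l2. integrable (lebesgue_on {0..T}) \<psi> \<longrightarrow>
      in_Lp_Lq T p (2 * p) (\<lambda>t. rep_l2 (duhamel w \<psi> t)) \<and>
      Lp_Lq_norm T p (2 * p) (\<lambda>t. rep_l2 (duhamel w \<psi> t))
        \<le> C * T powr \<gamma>s * (LINT s|lebesgue_on {0..T}. norm (\<psi> s)))"
proof (rule exI[of _ 1], intro conjI allI impI)
  fix T \<rho> \<gamma> :: real and w :: "real \<Rightarrow> real"
  assume T: "T > 0" and \<rho>: "\<rho> > min (3 / 2 - 2 / p) 1" and w: "continuous_on {0..T} w" and irr: "irregular \<rho> \<gamma> T w"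
  define \<sigma> where "\<sigma> = min (3 / 2 - 2 / p) 1"
  have \<sigma>: "1/2 < \<sigma>" "\<sigma> \<le> 1" "\<sigma> < \<rho>" using assms \<rho> by (auto simp: \<sigma>_def field_simps)
  \<comment> \<open>If the minimum is 1 this is \<open>p \<le> 5\<close>; otherwise multiplication
    by \<open>p\<close> turns it into \<open>0 \<le> (p - 2) * (5 - p) + 2\<close>.\<close>
  have p4: "p - 1 \<le> 4 * \<sigma>"
  proof -
    have "(p - 1) * p \<le> 4 * (3 / 2 - 2 / p) * p"
    proof -
      have "0 \<le> (p - 2) * (5 - p) + 2" using assms by (intro add_nonneg_nonneg mult_nonneg_nonneg) auto
      then show ?thesis using assms by (simp add: algebra_simps)
    qed
    then have "p - 1 \<le> 4 * (3 / 2 - 2 / p)" using assms by (simp add: mult_le_cancel_right)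
    then show ?thesis using assms by (auto simp: \<sigma>_def min_def)
  qed
  obtain A where A: "A \<ge> 0" "\<And>x r. r > 0 \<Longrightarrow>
      emeasure (lebesgue_on {0..T}) {s\<in>{0..T}. \<bar>x - w s\<bar> < r} \<le> ennreal (A * r powr \<sigma>)"
    using irregular_ball_bound[OF T irr w, of \<sigma>] \<sigma> by auto
  obtain C where C: "C > 0" "\<And>\<psi>. integrable (lebesgue_on {0..T}) \<psi> \<Longrightarrow>
      in_Lp_Lq T p (2 * p) (\<lambda>t. rep_l2 (duhamel w \<psi> t)) \<and>
      Lp_Lq_norm T p (2 * p) (\<lambda>t. rep_l2 (duhamel w \<psi> t)) \<le> C * (LINT s|lebesgue_on {0..T}. norm (\<psi> s))"
    using duhamel_estimate[OF T w A(1) \<sigma>(1) refl A(2) _ p4] assms by auto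
  show "\<exists>C>0. \<forall>\<psi> :: real \<Rightarrow> l2. integrable (lebesgue_on {0..T}) \<psi> \<longrightarrow>
      in_Lp_Lq T p (2 * p) (\<lambda>t. rep_l2 (duhamel w \<psi> t)) \<and>
      Lp_Lq_norm T p (2 * p) (\<lambda>t. rep_l2 (duhamel w \<psi> t))
        \<le> C * T powr 1 * (LINT s|lebesgue_on {0..T}. norm (\<psi> s))"
    using C T by (intro exI[of _ "C / T"]) auto
qed simp

end
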